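(* Let $p\geqslant 3$ be a prime and let $G$ be a finite $p$-group such that $|G'/G''|=p^3$ and $G''\neq 1$. Then there are subgroups $H$ and $U$ of $G$ with $G=HU$ such that (i) $H$ is a normal subgroup of $G$ generated by at most $5$ elements; (ii) $\gamma_i(H)=\gamma_i(G)$ for all $i\geqslant 2$; (iii) $U$ is a normal subgroup of $G$ such that $U'\leqslant\gamma_5(G)$; (iv) $H$ and $U$ centralise each other.
   Context: For a group $G$, $\gamma_i(G)$ denotes the $i$-th term of the lower central series: $\gamma_1(G)=G$ and $\gamma_{i+1}(G)=[\gamma_i(G),G]$. Thus $\gamma_2(G)=G'$ is the derived subgroup; $G''=(G')'$ is the second derived subgroup. *)

theory Defs
  imports "HOL-Algebra.Algebra"
begin

text \<open>Commutators follow the convention of \<^const>\<open>derived\<close>, i.e.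
  \<open>[a, b] = a b a\<inverse> b\<inverse>\<close>. For subgroups \<open>A\<close> and \<open>B\<close>, the other common convention
  \<open>a\<inverse> b\<inverse> a b\<close> has the same set of values.\<close>

definition commutator_subgroup :: "('a, 'b) monoid_scheme \<Rightarrow> 'a set \<Rightarrow> 'a set \<Rightarrow> 'a set" where
  "commutator_subgroup G A B =
     generate G (\<Union>a \<in> A. \<Union>b \<in> B. {a \<otimes>\<^bsub>G\<^esub> b \<otimes>\<^bsub>G\<^esub> inv\<^bsub>G\<^esub> a \<otimes>\<^bsub>G\<^esub> inv\<^bsub>G\<^esub> b})"

text \<open>Numbering starts at \<open>\<gamma>\<^sub>1(G) = G\<close>; the value at index 0 is a dummy. The series of a subgroup
  \<open>H\<close> of \<open>G\<close> is that of the group \<open>G\<lparr>carrier := H\<rparr>\<close>, so commutators are taken with \<open>H\<close>, not \<open>G\<close>.\<close>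

fun lower_central :: "('a, 'b) monoid_scheme \<Rightarrow> nat \<Rightarrow> 'a set" where
  "lower_central G 0 = carrier G"
| "lower_central G (Suc 0) = carrier G"
| "lower_central G (Suc (Suc n)) =
     commutator_subgroup G (lower_central G (Suc n)) (carrier G)"

lemma commutator_subgroup_self: "commutator_subgroup G A A = derived G A"
  by (simp add: commutator_subgroup_def derived_def)

lemma lower_central_2: "lower_central G 2 = derived G (carrier G)"
  by (simp add: numeral_2_eq_2 commutator_subgroup_self)

end

theory Submission
  imports Defs "HOL-Number_Theory.Cong"
begin

text \<open>Commutators are computed in the graded Lie ring of the lower central series, one layer at a time, through
  additive maps \<open>e\<close> from \<open>\<gamma>\<^sub>i\<close> to the integers modulo \<open>p\<close> that vanish on \<open>\<gamma>\<^sub>i\<^sub>+\<^sub>1\<close>; the Hall-Witt identity becomes the Jacobi identity.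
  The Jacobi identity excludes that \<open>\<gamma>\<^sub>2/\<gamma>\<^sub>3\<close> has order \<open>p\<^sup>2\<close>, so the layers 2, 3, 4 have order \<open>p\<close> and
  \<open>G'' = \<gamma>\<^sub>5\<close>. It also yields \<open>\<gamma>\<^sub>6 = 1\<close> and that the form \<open>G \<times> G \<rightarrow> \<gamma>\<^sub>2/\<gamma>\<^sub>3\<close> has rank 2, with radical \<open>R\<close> of
  index \<open>p\<^sup>2\<close>. For suitable \<open>s, t\<close> outside \<open>R\<close>, further Jacobi identities show that \<open>G\<close> is generated by \<open>s\<close>, \<open>t\<close>, one
  more element \<open>r\<close>, \<open>G'\<close> and the preimage \<open>Y\<close> of the centre of \<open>G/\<gamma>\<^sub>5\<close>. Commutation pairs \<open>G\<close> with \<open>Y\<close> in the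
  group \<open>\<gamma>\<^sub>5\<close> of order \<open>p\<close>. Splitting off hyperbolic pairs in \<open>Y\<close> and correcting \<open>s, t, r\<close> by elements of \<open>Y\<close>,
  two elements \<open>y, z\<close> of \<open>Y\<close> suffice to obtain \<open>G = H U G'\<close> with \<open>H\<close> generated by \<open>s, t, r, y, z\<close> and \<open>U\<close> the centraliser
  of \<open>H\<close> in \<open>Y\<close>; hence \<open>G = H U\<close>.\<close>

section \<open>Commutators and the lower central series\<close>

text \<open>Integer-valued maps that are additive modulo p replace quotient groups and bases. The
  layers need not be known to be elementary abelian: every nontrivial normal subgroup of a p-group
  has a nonzero conjugation-invariant homomorphism to Z/p. The obstacle is the bottom layer:
  \<open>\<gamma> 5\<close> equals \<open>G''\<close>, but its order is unknown at first, so a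
  single character may lose information. This is repaired only after \<open>\<gamma> 6\<close> is
  shown to be trivial; then \<open>\<gamma> 5\<close> is generated by one central commutator of
  order p. Oddness of p enters only by cancelling a factor 2: each time a Jacobi identity yields
  twice the wanted quantity. The number five is 2 + 1 + 2. Two elements span G modulo the radical.
  Between the radical and \<open>Y\<close> stand three linear forms, two of them detected inside
  \<open>G'\<close>, so one new element suffices. Commutation with \<open>s, t, r\<close> gives
  three forms on \<open>Y\<close>, one detected inside \<open>G'\<close>, so two new elements
  suffice. Elements of \<open>G'\<close> cost nothing, because G is nilpotent and \<open>G'\<close>
  can be omitted from every generating set.\<close>

context group
begin

definition comm :: "'a \<Rightarrow> 'a \<Rightarrow> 'a" where
  "comm x y = x \<otimes> y \<otimes> inv x \<otimes> inv y"

lemma l_cancel_inv [simp]: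
  "\<lbrakk>x \<in> carrier G; y \<in> carrier G\<rbrakk> \<Longrightarrow> inv x \<otimes> (x \<otimes> y) = y"
  "\<lbrakk>x \<in> carrier G; y \<in> carrier G\<rbrakk> \<Longrightarrow> x \<otimes> (inv x \<otimes> y) = y"
  by (simp_all add: m_assoc [symmetric])

lemma comm_closed [simp]: "\<lbrakk>x \<in> carrier G; y \<in> carrier G\<rbrakk> \<Longrightarrow> comm x y \<in> carrier G"
  by (simp add: comm_def)

lemma comm_inv: "\<lbrakk>x \<in> carrier G; y \<in> carrier G\<rbrakk> \<Longrightarrow> inv (comm x y) = comm y x"
  by (simp add: comm_def inv_mult_group m_assoc)

lemma comm_mult_left:
  "\<lbrakk>x \<in> carrier G; y \<in> carrier G; z \<in> carrier G\<rbrakk>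
    \<Longrightarrow> comm (x \<otimes> y) z = x \<otimes> comm y z \<otimes> inv x \<otimes> comm x z"
  by (simp add: comm_def inv_mult_group m_assoc)

lemma comm_mult_right:
  "\<lbrakk>x \<in> carrier G; y \<in> carrier G; z \<in> carrier G\<rbrakk>
    \<Longrightarrow> comm x (y \<otimes> z) = comm x y \<otimes> (y \<otimes> comm x z \<otimes> inv y)"
  by (simp add: comm_def inv_mult_group m_assoc)

lemma conj_eq_comm: "\<lbrakk>x \<in> carrier G; y \<in> carrier G\<rbrakk> \<Longrightarrow> x \<otimes> y \<otimes> inv x = comm x y \<otimes> y"
  by (simp add: comm_def m_assoc)

lemma comm_eq_one_iff:
  "\<lbrakk>x \<in> carrier G; y \<in> carrier G\<rbrakk> \<Longrightarrow> comm x y = \<one> \<longleftrightarrow> x \<otimes> y = y \<otimes> x"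
proof
  assume x: "x \<in> carrier G" and y: "y \<in> carrier G" and 1: "comm x y = \<one>"
  have "x \<otimes> y = comm x y \<otimes> (y \<otimes> x)" using x y by (simp add: comm_def m_assoc)
  then show "x \<otimes> y = y \<otimes> x" using 1 x y by simp
next
  assume x: "x \<in> carrier G" and y: "y \<in> carrier G" and 1: "x \<otimes> y = y \<otimes> x"
  show "comm x y = \<one>" using x y by (simp add: comm_def 1) (simp add: m_assoc)
qed

lemma comm_self [simp]: "x \<in> carrier G \<Longrightarrow> comm x x = \<one>"
  by (simp add: comm_eq_one_iff)

lemma comm_one [simp]: "x \<in> carrier G \<Longrightarrow> comm x \<one> = \<one>" "x \<in> carrier G \<Longrightarrow> comm \<one> x = \<one>"
  by (simp_all add: comm_eq_one_iff)

lemma hall_witt: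
  assumes "x \<in> carrier G" "y \<in> carrier G" "z \<in> carrier G"
  shows "comm (comm x y) (y \<otimes> z \<otimes> inv y) \<otimes> comm (comm y z) (z \<otimes> x \<otimes> inv z)
    \<otimes> comm (comm z x) (x \<otimes> y \<otimes> inv x) = \<one>"
  using assms by (simp add: comm_def inv_mult_group m_assoc)

lemma normal_carrier: "N \<lhd> G \<Longrightarrow> x \<in> N \<Longrightarrow> x \<in> carrier G"
  by (meson normal_imp_subgroup subgroup.mem_carrier)

lemma normal_conj: "\<lbrakk>N \<lhd> G; x \<in> carrier G; u \<in> N\<rbrakk> \<Longrightarrow> x \<otimes> u \<otimes> inv x \<in> N"
  by (simp add: normal.inv_op_closed2)

lemma normal_comm_left: "\<lbrakk>N \<lhd> G; u \<in> N; x \<in> carrier G\<rbrakk> \<Longrightarrow> comm u x \<in> N"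
  using normal_conj[of N x "inv u"]
  by (simp add: comm_def m_assoc normal_carrier normal_imp_subgroup subgroup.m_closed
      subgroup.m_inv_closed)

lemma normal_comm_sym:
  "\<lbrakk>N \<lhd> G; x \<in> carrier G; y \<in> carrier G\<rbrakk> \<Longrightarrow> comm x y \<in> N \<longleftrightarrow> comm y x \<in> N"
  by (metis comm_inv normal_imp_subgroup subgroup.m_inv_closed)

text \<open>This is the preimage of a centraliser in \<open>G/N\<close>. Being a subgroup, it
  reduces a claim on commutators with all elements of a generated subgroup to the generators; many
  containments below are proved in this way.\<close>

lemma centralizer_mod_subgroup:
  assumes N: "N \<lhd> G" and A: "A \<subseteq> carrier G"
  shows "subgroup {x \<in> carrier G. \<forall>a\<in>A. comm x a \<in> N} G" (is "subgroup ?C G")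
proof (rule subgroupI)
  interpret N: normal N G by (rule N)
  show "?C \<subseteq> carrier G" by auto
  have "\<one> \<in> ?C" using A N.one_closed by auto
  then show "?C \<noteq> {}" by blast
  fix x assume x: "x \<in> ?C"
  show "inv x \<in> ?C"
  proof (simp add: x[simplified], intro ballI)
    fix a assume a: "a \<in> A"
    then have ac: "a \<in> carrier G" using A by auto
    have xc: "x \<in> carrier G" using x by simp
    have "comm (inv x) a = inv x \<otimes> inv (comm x a) \<otimes> inv (inv x)"
      using xc ac by (simp add: comm_def inv_mult_group m_assoc)
    also have "\<dots> \<in> N"
      using x a xc by (intro normal_conj[OF N]) auto
    finally show "comm (inv x) a \<in> N" .
  qed
  fix y assume y: "y \<in> ?C"
  show "x \<otimes> y \<in> ?C"
    using x y A by (auto simp: comm_mult_left subset_iff intro!: N.m_closed normal_conj[OF N])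
qed

section \<open>Terms of the lower central series and the weights of commutators\<close>

lemma lower_central_Suc:
  "i \<noteq> 0 \<Longrightarrow> lower_central G (Suc i) = commutator_subgroup G (lower_central G i) (carrier G)"
  by (cases i) auto

lemma commutator_subgroup_alt:
  "commutator_subgroup G A B = generate G {comm a b | a b. a \<in> A \<and> b \<in> B}"
proof -
  have "(\<Union>a\<in>A. \<Union>b\<in>B. {a \<otimes> b \<otimes> inv a \<otimes> inv b}) = {comm a b | a b. a \<in> A \<and> b \<in> B}"
    by (auto simp: comm_def)
  then show ?thesis by (simp add: commutator_subgroup_def)
qed

lemma commutator_subgroup_subset:
  assumes "subgroup N G" "\<And>a b. a \<in> A \<Longrightarrow> b \<in> B \<Longrightarrow> comm a b \<in> N"
  shows "commutator_subgroup G A B \<subseteq> N"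
  unfolding commutator_subgroup_alt using assms
  by (intro generate_subgroup_incl) auto

lemma comm_in_commutator_subgroup:
  "a \<in> A \<Longrightarrow> b \<in> B \<Longrightarrow> comm a b \<in> commutator_subgroup G A B"
  unfolding commutator_subgroup_alt by (rule generate.incl) auto

lemma comm_in_derived: "a \<in> A \<Longrightarrow> b \<in> A \<Longrightarrow> comm a b \<in> derived G A"
  using comm_in_commutator_subgroup[of a A b A] by (simp add: commutator_subgroup_self)

lemma derived_subset:
  assumes "subgroup N G" "\<And>a b. a \<in> A \<Longrightarrow> b \<in> A \<Longrightarrow> comm a b \<in> N"
  shows "derived G A \<subseteq> N"
  using commutator_subgroup_subset[of N A A] assms by (simp add: commutator_subgroup_self)

lemma commutator_subgroup_normal:
  assumes A: "A \<lhd> G" and B: "B \<lhd> G"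
  shows "commutator_subgroup G A B \<lhd> G"
  unfolding commutator_subgroup_alt
proof (rule normal_generateI)
  show "{comm a b |a b. a \<in> A \<and> b \<in> B} \<subseteq> carrier G"
    using normal_carrier[OF A] normal_carrier[OF B] by auto
  fix h g assume "h \<in> {comm a b |a b. a \<in> A \<and> b \<in> B}" and g: "g \<in> carrier G"
  then obtain a b where h: "h = comm a b" "a \<in> A" "b \<in> B" by auto
  have "g \<otimes> h \<otimes> inv g = comm (g \<otimes> a \<otimes> inv g) (g \<otimes> b \<otimes> inv g)"
    using g h normal_carrier[OF A] normal_carrier[OF B]
    by (simp add: comm_def inv_mult_group m_assoc)
  then show "g \<otimes> h \<otimes> inv g \<in> {comm a b |a b. a \<in> A \<and> b \<in> B}"
    using normal_conj[OF A g] normal_conj[OF B g] h by auto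
qed

lemma lower_central_normal: "lower_central G i \<lhd> G"
proof (induction i)
  case (Suc i)
  then show ?case
    by (cases i) (simp_all add: normal_self commutator_subgroup_normal)
qed (simp add: normal_self)

lemmas lower_central_subgroup = normal_imp_subgroup[OF lower_central_normal]

lemma lower_central_carrier: "x \<in> lower_central G i \<Longrightarrow> x \<in> carrier G"
  by (rule normal_carrier[OF lower_central_normal])

lemma lower_central_Suc_subset: "lower_central G (Suc i) \<subseteq> lower_central G i"
proof (cases "i = 0")
  case False
  then show ?thesis
    unfolding lower_central_Suc[OF False]
    by (intro commutator_subgroup_subset lower_central_subgroup
        normal_comm_left[OF lower_central_normal])
qed auto

lemma lower_central_antimono: "i \<le> j \<Longrightarrow> lower_central G j \<subseteq> lower_central G i"
proof (induction rule: dec_induct)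
  case (step k)
  then show ?case using lower_central_Suc_subset[of k] by simp
qed simp

lemma comm_lower_central_carrier:
  "\<lbrakk>x \<in> lower_central G i; y \<in> carrier G\<rbrakk> \<Longrightarrow> comm x y \<in> lower_central G (Suc i)"
  by (cases "i = 0")
    (auto simp: lower_central_Suc comm_in_commutator_subgroup lower_central_carrier)

text \<open>Elementwise form of the three subgroups lemma: in the Hall-Witt identity two factors in
  \<open>N\<close> force the third into \<open>N\<close>.\<close>

lemma three_subgroup_mod:
  assumes N: "N \<lhd> G" and x: "x \<in> carrier G" and y: "y \<in> carrier G" and z: "z \<in> carrier G"
    and 1: "comm (comm x y) (y \<otimes> z \<otimes> inv y) \<in> N"
    and 2: "comm (comm z x) (x \<otimes> y \<otimes> inv x) \<in> N"
  shows "comm (comm y z) (z \<otimes> x \<otimes> inv z) \<in> N"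
proof -
  interpret N: normal N G by (rule N)
  let ?a = "comm (comm x y) (y \<otimes> z \<otimes> inv y)" and ?b = "comm (comm y z) (z \<otimes> x \<otimes> inv z)"
    and ?c = "comm (comm z x) (x \<otimes> y \<otimes> inv x)"
  have cl: "?a \<in> carrier G" "?b \<in> carrier G" "?c \<in> carrier G" using x y z by auto
  have "?a \<otimes> ?b \<otimes> ?c = \<one>" by (rule hall_witt[OF x y z])
  moreover have "b = inv a \<otimes> inv c"
    if "a \<otimes> b \<otimes> c = \<one>" "a \<in> carrier G" "b \<in> carrier G" "c \<in> carrier G" for a b c
  proof -
    have "b = inv a \<otimes> (a \<otimes> b \<otimes> c) \<otimes> inv c" using that(2-) by (simp add: m_assoc)
    also have "\<dots> = inv a \<otimes> inv c" using that by simp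
    finally show ?thesis .
  qed
  ultimately have "?b = inv ?a \<otimes> inv ?c" using cl by blast
  then show ?thesis using 1 2 by simp
qed

text \<open>Induction on \<open>j\<close>: the elements that satisfy the claim against a fixed term
  form a subgroup, so only the generators \<open>comm y z\<close> of the next term matter, and these
  are reached through the Hall-Witt identity. The dummy index 0 does no harm, since the terms are
  normal.\<close>

lemma comm_lower_central:
  assumes "x \<in> lower_central G i" "y \<in> lower_central G j"
  shows "comm x y \<in> lower_central G (i + j)"
  using assms
proof (induction j arbitrary: i x y)
  case 0
  then show ?case by (simp add: normal_comm_left[OF lower_central_normal])
next
  case (Suc j)
  note IH = Suc.IH
  show ?case
  proof (cases "j = 0")
    case True
    then show ?thesis using Suc.prems comm_lower_central_carrier by simp
  next
    case False
    let ?N = "lower_central G (i + Suc j)"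
    let ?C = "{w \<in> carrier G. \<forall>a\<in>lower_central G i. comm w a \<in> ?N}"
    have "lower_central G (Suc j) \<subseteq> ?C"
      unfolding lower_central_Suc[OF False]
    proof (rule commutator_subgroup_subset)
      show "subgroup ?C G"
        by (rule centralizer_mod_subgroup[OF lower_central_normal])
          (auto intro: lower_central_carrier)
      fix y z assume y: "y \<in> lower_central G j" and z: "z \<in> carrier G"
      note yc = lower_central_carrier[OF y]
      have "comm (comm y z) x \<in> ?N" if x: "x \<in> lower_central G i" for x
      proof -
        note xc = lower_central_carrier[OF x]
        \<comment> \<open>The Hall-Witt identity contains \<open>x'\<close> conjugated by
          \<open>z\<close>; this choice makes that conjugate equal to \<open>x\<close>.\<close>
        define x' where "x' = inv z \<otimes> x \<otimes> inv (inv z)"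
        have x': "x' \<in> lower_central G i"
          unfolding x'_def by (rule normal_conj[OF lower_central_normal _ x]) (simp add: z)
        note x'c = lower_central_carrier[OF x']
        have eq: "z \<otimes> x' \<otimes> inv z = x" using z xc by (simp add: x'_def m_assoc)
        have "comm x' y \<in> lower_central G (i + j)" using IH x' y by blast
        then have 1: "comm (comm x' y) (y \<otimes> z \<otimes> inv y) \<in> ?N"
          using comm_lower_central_carrier[of _ "i + j" "y \<otimes> z \<otimes> inv y"] yc z by simp
        have "comm z x' \<in> lower_central G (Suc i)"
          using comm_lower_central_carrier[OF x' z]
            normal_comm_sym[OF lower_central_normal x'c z] by simp
        then have 2: "comm (comm z x') (x' \<otimes> y \<otimes> inv x') \<in> ?N"
          using IH[of "comm z x'" "Suc i"] normal_conj[OF lower_central_normal x'c y] by simp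
        show ?thesis
          using three_subgroup_mod[OF lower_central_normal x'c yc z 1 2] eq by simp
      qed
      then show "comm y z \<in> ?C" using yc z by simp
    qed
    then have "comm y x \<in> ?N" using Suc.prems by auto
    then show ?thesis
      using normal_comm_sym[OF lower_central_normal] Suc.prems lower_central_carrier by blast
  qed
qed

end

section \<open>Central characters of finite p-groups\<close>

locale finite_p_group = group G for G (structure) +
  fixes p n :: nat
  assumes prime_p: "Factorial_Ring.prime p" and order_G: "order G = p ^ n"
begin

section \<open>Congruence modulo p and orders of subgroups\<close>

definition eqp :: "int \<Rightarrow> int \<Rightarrow> bool" (infix "=\<^sub>p" 50) where
  "x =\<^sub>p y \<longleftrightarrow> [x = y] (mod int p)"

lemma eqp_refl [simp]: "a =\<^sub>p a"
  by (simp add: eqp_def)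

lemma eqp_sym: "a =\<^sub>p b \<Longrightarrow> b =\<^sub>p a"
  unfolding eqp_def by (rule cong_sym)

lemma eqp_trans [trans]: "a =\<^sub>p b \<Longrightarrow> b =\<^sub>p c \<Longrightarrow> a =\<^sub>p c"
  unfolding eqp_def by (rule cong_trans)

lemma eqp_add: "a =\<^sub>p b \<Longrightarrow> c =\<^sub>p d \<Longrightarrow> a + c =\<^sub>p b + d"
  unfolding eqp_def by (rule cong_add)

lemma eqp_diff: "a =\<^sub>p b \<Longrightarrow> c =\<^sub>p d \<Longrightarrow> a - c =\<^sub>p b - d"
  unfolding eqp_def by (rule cong_diff)

lemma eqp_mult: "a =\<^sub>p b \<Longrightarrow> c =\<^sub>p d \<Longrightarrow> a * c =\<^sub>p b * d"
  unfolding eqp_def by (rule cong_mult)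

lemma eqp_minus: "a =\<^sub>p b \<Longrightarrow> - a =\<^sub>p - b"
  by (simp add: eqp_def cong_minus_minus_iff)

lemma eqp_0_iff: "a =\<^sub>p 0 \<longleftrightarrow> int p dvd a"
  by (simp add: eqp_def cong_0_iff)

lemma eqp_iff_dvd_diff: "a =\<^sub>p b \<longleftrightarrow> int p dvd a - b"
  by (simp add: eqp_def cong_iff_dvd_diff)

lemma eqp_diff_iff: "a =\<^sub>p b \<longleftrightarrow> a - b =\<^sub>p 0"
  by (simp add: eqp_0_iff eqp_iff_dvd_diff)

lemma finite_G: "finite (carrier G)"
  using order_G prime_p by (metis card.infinite order_def power_eq_0_iff not_prime_0)

lemma card_subgroup: "subgroup H G \<Longrightarrow> \<exists>k. card H = p ^ k"
  using lagrange[of H] order_G divides_primepow_nat[OF prime_p]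
  by (metis dvd_triv_right)

lemma p_gt_1: "p > 1"
  using prime_p prime_gt_1_nat by blast

lemma card_subgroup_psubset:
  assumes "subgroup K G" "subgroup H G" "K \<subset> H"
  shows "\<exists>i j. card K = p ^ i \<and> card H = p ^ j \<and> i < j"
proof -
  obtain i j where ij: "card K = p ^ i" "card H = p ^ j"
    using card_subgroup assms by blast
  have "card K < card H"
    using finite_subset[OF subgroup.subset[OF assms(2)] finite_G] assms(3) by (rule psubset_card_mono)
  then have "i < j" unfolding ij by (rule power_less_imp_less_exp[OF p_gt_1])
  then show ?thesis using ij by blast
qed

lemma eqp_invertible: "\<not> a =\<^sub>p 0 \<Longrightarrow> \<exists>b. a * b =\<^sub>p 1"
proof -
  assume "\<not> a =\<^sub>p 0"
  then have "\<not> int p dvd a" by (simp add: eqp_0_iff)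
  then have "coprime a (int p)"
    using prime_p by (metis coprime_commute prime_imp_coprime prime_nat_int_transfer)
  then show ?thesis unfolding eqp_def by (rule cong_solve_coprime_int)
qed

lemma eqp_mult_0: "a * b =\<^sub>p 0 \<Longrightarrow> a =\<^sub>p 0 \<or> b =\<^sub>p 0"
  using prime_p by (metis eqp_0_iff prime_dvd_mult_iff prime_nat_int_transfer)

text \<open>Class equation: \<open>N - {\<one>}\<close> is a disjoint union of conjugacy classes of
  p-power size. If none were a singleton, p would divide both the order of \<open>N\<close> and its
  predecessor.\<close>

lemma central_element:
  assumes N: "N \<lhd> G" and N1: "N \<noteq> {\<one>}"
  shows "\<exists>z\<in>N. z \<noteq> \<one> \<and> (\<forall>x\<in>carrier G. comm z x = \<one>)"
proof (rule ccontr)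
  assume contra: "\<not> ?thesis"
  interpret N: normal N G by (rule N)
  interpret act: group_action G "carrier G" "\<lambda>g. \<lambda>h\<in>carrier G. g \<otimes> h \<otimes> inv g"
    by (rule action_by_conjugation)
  let ?orb = "orbit G (\<lambda>g. \<lambda>h\<in>carrier G. g \<otimes> h \<otimes> inv g)"
  have orb: "?orb x = {g \<otimes> x \<otimes> inv g | g. g \<in> carrier G}" if "x \<in> carrier G" for x
    unfolding orbit_def using that by auto
  have finN: "finite N" using finite_G N.subset finite_subset by blast
  have "subgroup {\<one>} G" by (rule triv_subgroup)
  moreover have "{\<one>} \<subset> N" using N1 by auto
  ultimately obtain i j where "card N = p ^ j" "i < j"
    using card_subgroup_psubset[of "{\<one>}" N] N.subgroup_axioms by auto
  then have pN: "p dvd card N" by (metis dvd_power less_nat_zero_code neq0_conv)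
  define C where "C = ?orb ` (N - {\<one>})"
  have x_orb: "x \<in> ?orb x" if "x \<in> carrier G" for x
    using act.orbit_refl[OF that] .
  have C: "\<Union>C = N - {\<one>}"
  proof
    show "N - {\<one>} \<subseteq> \<Union>C" unfolding C_def using x_orb by auto
    show "\<Union>C \<subseteq> N - {\<one>}"
    proof
      fix y assume "y \<in> \<Union>C"
      then obtain x g where xg: "x \<in> N" "x \<noteq> \<one>" "g \<in> carrier G" "y = g \<otimes> x \<otimes> inv g"
        unfolding C_def using orb by auto
      have "y \<in> N" using xg normal_conj[OF N] by simp
      moreover have "x = inv g \<otimes> y \<otimes> g" using xg by (simp add: m_assoc)
      then have "y \<noteq> \<one>" using xg by auto
      ultimately show "y \<in> N - {\<one>}" by simp
    qed
  qed
  have "p dvd card (\<Union>C)"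
  proof (rule dvd_partition)
    show "finite (\<Union>C)" using C finN by simp
    have "C \<subseteq> orbits G (carrier G) (\<lambda>g. \<lambda>h\<in>carrier G. g \<otimes> h \<otimes> inv g)"
      unfolding C_def orbits_def by auto
    then show "\<forall>c1\<in>C. \<forall>c2\<in>C. c1 \<noteq> c2 \<longrightarrow> c1 \<inter> c2 = {}"
      using act.disjoint_union by blast
    show "\<forall>c\<in>C. p dvd card c"
    proof
      fix c assume "c \<in> C"
      then obtain x where x: "x \<in> N" "x \<noteq> \<one>" "c = ?orb x" unfolding C_def by auto
      have "card c dvd p ^ n"
        using act.orbit_stabilizer_theorem[OF N.mem_carrier[OF x(1)]] unfolding order_G x(3)
        by (rule dvdI[OF sym])
      then obtain k where k: "card c = p ^ k" using divides_primepow_nat[OF prime_p] by blast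
      have "k \<noteq> 0"
      proof
        assume "k = 0"
        then have "card c = 1" using k by simp
        then have "c = {x}" using x_orb[OF N.mem_carrier[OF x(1)]] x(3)
          by (metis card_1_singletonE singletonD)
        then have gx: "g \<otimes> x \<otimes> inv g = x" if "g \<in> carrier G" for g
          using orb[of x] x that by auto
        then have "comm x g = \<one>" if "g \<in> carrier G" for g
        proof -
          have xc: "x \<in> carrier G" using x by simp
          have "comm g x = g \<otimes> x \<otimes> inv g \<otimes> inv x" by (simp add: comm_def)
          also have "\<dots> = \<one>" using gx[OF that] xc by simp
          finally show ?thesis using comm_inv[OF that xc] by simp
        qed
        then show False using contra x by blast
      qed
      then show "p dvd card c" using k by (metis dvd_power neq0_conv)
    qed
  qed
  then have "p dvd card N - 1" using C finN by simp
  moreover have "card N \<ge> 1" using finN N.one_closed by (metis One_nat_def Suc_leI card_gt_0_iff empty_iff)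
  ultimately have "p dvd 1" using pN dvd_diff_nat[of p "card N" "card N - 1"] by simp
  then show False using p_gt_1 by simp
qed

lemma factor_finite_p_group:
  assumes "M \<lhd> G"
  shows "\<exists>m. finite_p_group (G Mod M) p m"
proof -
  interpret M: normal M G by fact
  have "order (G Mod M) dvd p ^ n"
    using lagrange[OF M.subgroup_axioms] order_G
    by (metis FactGroup_def dvd_triv_left order_def partial_object.select_convs(1))
  then obtain m where "order (G Mod M) = p ^ m" using divides_primepow_nat[OF prime_p] by blast
  then show ?thesis
    using M.factorgroup_is_group prime_p
    by (auto simp: finite_p_group_def finite_p_group_axioms_def)
qed

text \<open>\<open>central_element\<close> in the factor group by \<open>M\<close>, pulled back so
  that later arguments can stay with elements of \<open>G\<close>.\<close>

lemma central_element_mod: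
  assumes M: "M \<lhd> G" and N: "N \<lhd> G" and MN: "M \<subset> N"
  shows "\<exists>x\<in>N. x \<notin> M \<and> (\<forall>g\<in>carrier G. comm x g \<in> M)"
proof -
  interpret M: normal M G by (rule M)
  interpret N: normal N G by (rule N)
  obtain m where "finite_p_group (G Mod M) p m" using factor_finite_p_group[OF M] by blast
  then interpret Q: finite_p_group "G Mod M" p m .
  let ?h = "\<lambda>a. M #> a"
  interpret h: group_hom G "G Mod M" ?h
    by (simp add: M.r_coset_hom_Mod Q.group_axioms group_hom.intro group_hom_axioms.intro)
  have eq: "M #> x = M \<longleftrightarrow> x \<in> M" if "x \<in> carrier G" for x
    using that coset_join1[of M x] coset_join2[of x M] M.subset M.subgroup_axioms by blast
  have "?h ` N \<lhd> G Mod M"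
    by (rule N.surj_hom_normal_subgroup) (auto simp: h.group_hom_axioms carrier_FactGroup)
  moreover have "?h ` N \<noteq> {\<one>\<^bsub>G Mod M\<^esub>}"
  proof -
    obtain x where "x \<in> N" "x \<notin> M" using MN by blast
    then have "M #> x \<in> ?h ` N" "M #> x \<noteq> M" using eq by auto
    then show ?thesis by auto
  qed
  ultimately have "\<exists>z\<in>?h ` N. z \<noteq> \<one>\<^bsub>G Mod M\<^esub> \<and> (\<forall>x\<in>carrier (G Mod M). Q.comm z x = \<one>\<^bsub>G Mod M\<^esub>)"
    by (rule Q.central_element)
  then obtain z where z: "z \<in> ?h ` N" "z \<noteq> M"
      "\<forall>x\<in>carrier (G Mod M). Q.comm z x = M"
    unfolding one_FactGroup by blast
  then obtain x where x: "x \<in> N" "z = M #> x" by auto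
  have xc: "x \<in> carrier G" using x by simp
  have "comm x g \<in> M" if g: "g \<in> carrier G" for g
  proof -
    have "?h (comm x g) = Q.comm z (?h g)"
      using xc g x by (simp add: comm_def Q.comm_def del: mult_FactGroup)
    also have "\<dots> = M" using z g by (auto simp: carrier_FactGroup)
    finally show ?thesis using eq xc g by simp
  qed
  moreover have "x \<notin> M" using z x eq xc by auto
  ultimately show ?thesis using x by blast
qed

end

section \<open>Extension of a normal subgroup by an element that is central modulo it\<close>

lemma (in group) comm_pow_mem:
  assumes N: "N \<lhd> G" and x: "x \<in> carrier G" and g: "g \<in> carrier G" and "comm x g \<in> N"
  shows "comm (x [^] (i::int)) g \<in> N"
proof -
  have "subgroup {x \<in> carrier G. \<forall>a\<in>{g}. comm x a \<in> N} G"
    using g by (intro centralizer_mod_subgroup[OF N]) simp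
  from subgroup_int_pow_closed[OF this, of x i] show ?thesis using assms by simp
qed

lemma (in group) cyclic_extension_normal:
  assumes M: "M \<lhd> G" and x: "x \<in> carrier G" and c: "\<And>g. g \<in> carrier G \<Longrightarrow> comm x g \<in> M"
  shows "{x [^] (i::int) \<otimes> m | i m. m \<in> M} \<lhd> G" (is "?N \<lhd> G")
  unfolding normal_inv_iff
proof (intro conjI ballI)
  interpret M: normal M G by (rule M)
  note mem = M.mem_carrier
  show "subgroup ?N G"
  proof (rule subgroupI)
    show "?N \<subseteq> carrier G" using x by auto
    show "?N \<noteq> {}" using M.one_closed by blast
    fix u assume "u \<in> ?N"
    then obtain i m where u: "u = x [^] (i::int) \<otimes> m" "m \<in> M" by auto
    have "inv u = x [^] (-i) \<otimes> (x [^] i \<otimes> inv m \<otimes> inv (x [^] i))"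
      using u x by (simp add: inv_mult_group int_pow_neg m_assoc)
    moreover have "x [^] i \<otimes> inv m \<otimes> inv (x [^] i) \<in> M"
      using u x by (intro normal_conj[OF M]) auto
    ultimately show "inv u \<in> ?N" by blast
    fix v assume "v \<in> ?N"
    then obtain j m' where v: "v = x [^] (j::int) \<otimes> m'" "m' \<in> M" by auto
    have "u \<otimes> v = x [^] (i + j) \<otimes> ((inv (x [^] j) \<otimes> m \<otimes> inv (inv (x [^] j))) \<otimes> m')"
      using u v x by (simp add: int_pow_mult m_assoc)
    moreover have "inv (x [^] j) \<otimes> m \<otimes> inv (inv (x [^] j)) \<otimes> m' \<in> M"
      using u v x by (intro M.m_closed normal_conj[OF M]) auto
    ultimately show "u \<otimes> v \<in> ?N" by blast
  qed
  fix g u assume g: "g \<in> carrier G" and "u \<in> ?N"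
  then obtain i m where u: "u = x [^] (i::int) \<otimes> m" "m \<in> M" by auto
  have "g \<otimes> u \<otimes> inv g = x [^] i \<otimes> (comm (inv (x [^] i)) g \<otimes> (g \<otimes> m \<otimes> inv g))"
    using u g x by (simp add: comm_def m_assoc)
  moreover have "comm (inv (x [^] i)) g \<in> M"
    using comm_pow_mem[OF M x g c[OF g], of "-i"] x by (simp add: int_pow_neg)
  ultimately show "g \<otimes> u \<otimes> inv g \<in> ?N"
    using normal_conj[OF M g u(2)] by blast
qed

context finite_p_group
begin

definition additive_mod :: "'a set \<Rightarrow> ('a \<Rightarrow> int) \<Rightarrow> bool" where
  "additive_mod A f \<longleftrightarrow> (\<forall>u\<in>A. \<forall>v\<in>A. f (u \<otimes> v) =\<^sub>p f u + f v)"

text \<open>A homomorphism from \<open>A\<close> to Z/p that kills \<open>[A, G]\<close>, that is,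
  one invariant under conjugation by \<open>G\<close>. Integer representatives are kept, and values
  outside \<open>A\<close> are arbitrary.\<close>

definition central_char :: "'a set \<Rightarrow> ('a \<Rightarrow> int) \<Rightarrow> bool" where
  "central_char A e \<longleftrightarrow> additive_mod A e \<and> (\<forall>u\<in>A. \<forall>x\<in>carrier G. e (comm u x) =\<^sub>p 0)"

text \<open>If p does not divide \<open>i\<close>, then \<open>i\<close> is invertible modulo the
  order \<open>p ^ n\<close> of \<open>G\<close>, and \<open>x\<close> is itself a power of
  \<open>x [^] i\<close>.\<close>

lemma p_dvd_exponent:
  assumes x: "x \<in> carrier G" and M: "subgroup M G" and "x \<notin> M" and i: "x [^] (i::int) \<in> M"
  shows "i =\<^sub>p 0"
proof (rule ccontr)
  assume "\<not> i =\<^sub>p 0"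
  then have "\<not> int p dvd i" by (simp add: eqp_0_iff)
  then have "coprime i (int p)"
    using prime_p by (metis coprime_commute prime_imp_coprime prime_nat_int_transfer)
  then have "coprime i (int p ^ n)" by simp
  then obtain j where "[i * j = 1] (mod int p ^ n)" using cong_solve_coprime_int by blast
  then obtain k where k: "i * j = 1 + int p ^ n * k"
    by (metis cong_iff_lin cong_sym)
  have "x [^] (i * j) = x \<otimes> x [^] (int (p ^ n) * k)"
    using x by (simp add: k int_pow_mult)
  also have "x [^] (int (p ^ n) * k) = \<one>"
    using x pow_order_eq_1[OF x] order_G by (metis int_pow_int int_pow_one int_pow_pow)
  finally have "x [^] (i * j) = x" using x by simp
  moreover have "x [^] (i * j) \<in> M"
    using subgroup_int_pow_closed[OF M i] x by (simp add: int_pow_pow)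
  ultimately show False using \<open>x \<notin> M\<close> by simp
qed

text \<open>Take \<open>M\<close> maximal among the normal subgroups of \<open>G\<close> properly contained in \<open>N\<close>, and \<open>x\<close> in \<open>N\<close> central
  modulo \<open>M\<close>; then \<open>N\<close> is the union of the cosets of \<open>M\<close> by powers of \<open>x\<close>, and the character reads off the exponent.\<close>

lemma central_char_exists:
  assumes N: "N \<lhd> G" and N1: "N \<noteq> {\<one>}"
  shows "\<exists>e. central_char N e \<and> (\<exists>x\<in>N. e x =\<^sub>p 1)"
proof -
  define S where "S = {M. M \<lhd> G \<and> M \<subset> N}"
  interpret N: normal N G by (rule N)
  have "finite (Pow N)" using finite_subset[OF N.subset finite_G] by simp
  moreover have "S \<subseteq> Pow N" unfolding S_def by blast
  ultimately have "finite S" by (rule rev_finite_subset)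
  moreover have "{\<one>} \<in> S" unfolding S_def using one_is_normal N1 N.one_closed by blast
  ultimately obtain M where MS: "M \<in> S" and max: "\<And>M'. M' \<in> S \<Longrightarrow> M \<subseteq> M' \<Longrightarrow> M' = M"
    using finite_has_maximal[of S] by blast
  then have M: "M \<lhd> G" and MN: "M \<subset> N" by (auto simp: S_def)
  interpret M: normal M G by (rule M)
  obtain x where x: "x \<in> N" "x \<notin> M" and c: "\<And>g. g \<in> carrier G \<Longrightarrow> comm x g \<in> M"
    using central_element_mod[OF M N MN] by blast
  have xc: "x \<in> carrier G" using x by simp
  let ?N = "{x [^] (i::int) \<otimes> m | i m. m \<in> M}"
  have "?N \<lhd> G" by (rule cyclic_extension_normal[OF M xc c])
  moreover have "M \<subseteq> ?N"
  proof
    fix m assume "m \<in> M"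
    then have "m = x [^] (0::int) \<otimes> m" by simp
    then show "m \<in> ?N" using \<open>m \<in> M\<close> by blast
  qed
  moreover have "x \<in> ?N"
  proof -
    have "x = x [^] (1::int) \<otimes> \<one>" using xc by simp
    then show ?thesis using M.one_closed by blast
  qed
  moreover have "?N \<subseteq> N"
    using MN x subgroup_int_pow_closed[OF N.subgroup_axioms] by auto
  ultimately have NN: "?N = N"
    using max[of ?N] x unfolding S_def by auto
  \<comment> \<open>The exponent is determined only modulo p, which \<open>uniq\<close> shows: no
    power of \<open>x\<close> with exponent prime to p lies in \<open>M\<close>.\<close>
  define e where "e u = (SOME i::int. \<exists>m\<in>M. u = x [^] i \<otimes> m)" for u
  have e: "\<exists>m\<in>M. u = x [^] e u \<otimes> m" if "u \<in> N" for u
  proof -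
    have "\<exists>i::int. \<exists>m\<in>M. u = x [^] i \<otimes> m" using that NN by auto
    then show ?thesis unfolding e_def by (rule someI_ex)
  qed
  have uniq: "e u =\<^sub>p i" if "u = x [^] i \<otimes> m" "m \<in> M" for u and i :: int and m
  proof -
    have "u \<in> N" using that NN by blast
    then obtain m' where m': "m' \<in> M" "u = x [^] e u \<otimes> m'" using e by blast
    have "x [^] (e u - i) = x [^] (- i) \<otimes> (x [^] e u \<otimes> m') \<otimes> inv m'"
      using m'(1) xc int_pow_mult[OF xc, of "- i" "e u"] by (simp add: m_assoc)
    also have "\<dots> = x [^] (- i) \<otimes> u \<otimes> inv m'"
      using m'(2) by simp
    also have "\<dots> = m \<otimes> inv m'"
      using that m' xc by (simp add: int_pow_neg m_assoc)
    also have "\<dots> \<in> M" using that m' by simp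
    finally have "e u - i =\<^sub>p 0" by (rule p_dvd_exponent[OF xc M.subgroup_axioms x(2)])
    then show ?thesis by (subst eqp_diff_iff)
  qed
  have "additive_mod N e"
    unfolding additive_mod_def
  proof (intro ballI)
    fix u v assume "u \<in> N" "v \<in> N"
    then obtain m m' where m: "m \<in> M" "u = x [^] e u \<otimes> m" and m': "m' \<in> M" "v = x [^] e v \<otimes> m'"
      using e by metis
    have "x [^] e u \<otimes> m \<otimes> (x [^] e v \<otimes> m')
      = x [^] (e u + e v) \<otimes> ((inv (x [^] e v) \<otimes> m \<otimes> inv (inv (x [^] e v))) \<otimes> m')"
      using m(1) m'(1) xc by (simp add: int_pow_mult m_assoc)
    then have eq: "u \<otimes> v = x [^] (e u + e v) \<otimes> ((inv (x [^] e v) \<otimes> m \<otimes> inv (inv (x [^] e v))) \<otimes> m')"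
      using m(2) m'(2) by simp
    show "e (u \<otimes> v) =\<^sub>p e u + e v"
      using m(1) m'(1) xc by (intro uniq[OF eq] M.m_closed normal_conj[OF M]) auto
  qed
  moreover have "e (comm u g) =\<^sub>p 0" if u: "u \<in> N" and g: "g \<in> carrier G" for u g
  proof -
    obtain m where m: "m \<in> M" "u = x [^] e u \<otimes> m" using e u by blast
    have "comm u g = x [^] e u \<otimes> comm m g \<otimes> inv (x [^] e u) \<otimes> comm (x [^] e u) g"
      using m xc g by (metis M.mem_carrier comm_mult_left int_pow_closed)
    also have "\<dots> \<in> M"
      using m xc g by (intro M.m_closed normal_conj[OF M] normal_comm_left[OF M] comm_pow_mem[OF M] c) auto
    finally have "comm u g \<in> M" .
    then show ?thesis using uniq[of "comm u g" 0 "comm u g"] u g by simp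
  qed
  moreover have "e x =\<^sub>p 1" using uniq[of x 1 \<one>] xc by simp
  ultimately show ?thesis using x(1) unfolding central_char_def by blast
qed

section \<open>Arithmetic of maps that are additive modulo p\<close>

lemma eqp_sum3: "\<lbrakk>a + b + c =\<^sub>p 0; a =\<^sub>p a'; b =\<^sub>p b'; c =\<^sub>p c'\<rbrakk> \<Longrightarrow> a' + b' + c' =\<^sub>p 0"
  by (meson eqp_add eqp_sym eqp_trans)

lemma eqp_0_add: "\<lbrakk>a =\<^sub>p 0; b =\<^sub>p 0\<rbrakk> \<Longrightarrow> a + b =\<^sub>p 0"
  using eqp_add[of a 0 b 0] by simp

lemma eqp_0_mult: "a =\<^sub>p 0 \<Longrightarrow> a * b =\<^sub>p 0" "a =\<^sub>p 0 \<Longrightarrow> b * a =\<^sub>p 0"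
  by (simp_all add: eqp_0_iff)

lemma not_1_eqp_0: "\<not> 1 =\<^sub>p 0"
  using p_gt_1 by (simp add: eqp_0_iff)

lemma additive_modD: "\<lbrakk>additive_mod A f; u \<in> A; v \<in> A\<rbrakk> \<Longrightarrow> f (u \<otimes> v) =\<^sub>p f u + f v"
  by (simp add: additive_mod_def)

lemma additive_mod_one:
  assumes "subgroup A G" "additive_mod A f"
  shows "f \<one> =\<^sub>p 0"
proof -
  have "f \<one> =\<^sub>p f \<one> + f \<one>"
    using additive_modD[OF assms(2), of \<one> \<one>] subgroup.one_closed[OF assms(1)] by simp
  then show ?thesis by (simp add: eqp_iff_dvd_diff eqp_0_iff)
qed

lemma additive_mod_inv:
  assumes A: "subgroup A G" and f: "additive_mod A f" and u: "u \<in> A"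
  shows "f (inv u) =\<^sub>p - f u"
proof -
  have "f (u \<otimes> inv u) =\<^sub>p f u + f (inv u)"
    by (rule additive_modD[OF f u subgroup.m_inv_closed[OF A u]])
  then have "f \<one> =\<^sub>p f u + f (inv u)" using subgroup.mem_carrier[OF A u] by simp
  then have "f u + f (inv u) =\<^sub>p 0" using additive_mod_one[OF A f] by (meson eqp_sym eqp_trans)
  then show ?thesis by (subst eqp_diff_iff) (simp add: algebra_simps)
qed

lemma additive_mod_nat_pow:
  assumes A: "subgroup A G" and f: "additive_mod A f" and u: "u \<in> A"
  shows "f (u [^] (k::nat)) =\<^sub>p int k * f u"
proof (induction k)
  case 0
  then show ?case using additive_mod_one[OF A f] by simp
next
  case (Suc k)
  have "u [^] k \<in> A"
    using subgroup_int_pow_closed[OF A u, of "int k"] by (simp add: int_pow_int)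
  then have "f (u [^] Suc k) =\<^sub>p f (u [^] k) + f u"
    using additive_modD[OF f _ u] by simp
  also have "\<dots> =\<^sub>p int k * f u + f u" by (rule eqp_add[OF Suc eqp_refl])
  also have "\<dots> = int (Suc k) * f u" by (simp add: algebra_simps)
  finally show ?case .
qed

lemma additive_mod_int_pow:
  assumes A: "subgroup A G" and f: "additive_mod A f" and u: "u \<in> A"
  shows "f (u [^] (i::int)) =\<^sub>p i * f u"
proof (cases i rule: int_cases2)
  case (nonneg k)
  then show ?thesis using additive_mod_nat_pow[OF assms, of k] by (simp add: int_pow_int)
next
  case (nonpos k)
  have "u [^] k \<in> A"
    using subgroup_int_pow_closed[OF A u, of "int k"] by (simp add: int_pow_int)
  then have "f (inv (u [^] k)) =\<^sub>p - f (u [^] k)" by (rule additive_mod_inv[OF A f])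
  also have "- f (u [^] k) =\<^sub>p - (int k * f u)"
    by (rule eqp_minus[OF additive_mod_nat_pow[OF assms]])
  finally show ?thesis
    using nonpos subgroup.mem_carrier[OF A u] by (simp add: int_pow_neg int_pow_int)
qed

lemma additive_mod_kernel_subgroup:
  assumes A: "subgroup A G" and f: "additive_mod A f"
  shows "subgroup {u \<in> A. f u =\<^sub>p 0} G"
proof (rule subgroupI)
  show "{u \<in> A. f u =\<^sub>p 0} \<subseteq> carrier G" using subgroup.subset[OF A] by blast
  show "{u \<in> A. f u =\<^sub>p 0} \<noteq> {}"
    using subgroup.one_closed[OF A] additive_mod_one[OF A f] by blast
  fix u assume u: "u \<in> {u \<in> A. f u =\<^sub>p 0}"
  then have "f (inv u) =\<^sub>p - f u" "- f u =\<^sub>p 0"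
    using additive_mod_inv[OF A f] eqp_minus[of "f u" 0] by auto
  then show "inv u \<in> {u \<in> A. f u =\<^sub>p 0}"
    using u subgroup.m_inv_closed[OF A] by (auto intro: eqp_trans)
  fix v assume v: "v \<in> {u \<in> A. f u =\<^sub>p 0}"
  have "f (u \<otimes> v) =\<^sub>p f u + f v" using u v additive_modD[OF f] by blast
  moreover have "f u + f v =\<^sub>p 0" using u v by (auto intro: eqp_0_add)
  ultimately show "u \<otimes> v \<in> {u \<in> A. f u =\<^sub>p 0}"
    using u v subgroup.m_closed[OF A] by (auto intro: eqp_trans)
qed

text \<open>A homomorphism to Z/p that vanishes on the kernel of \<open>e\<close> is a multiple of
  \<open>e\<close>. The element \<open>a\<close> serves as unit vector: the power
  \<open>- e u\<close> of \<open>a\<close> moves \<open>u\<close> into the kernel.\<close>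

lemma additive_mod_coordinate:
  assumes A: "subgroup A G" and e: "additive_mod A e" and f: "additive_mod A f"
    and ker: "\<And>u. u \<in> A \<Longrightarrow> e u =\<^sub>p 0 \<Longrightarrow> f u =\<^sub>p 0"
    and a: "a \<in> A" "e a =\<^sub>p 1" and u: "u \<in> A"
  shows "f u =\<^sub>p e u * f a"
proof -
  let ?w = "u \<otimes> a [^] (- e u)"
  have p: "a [^] (- e u) \<in> A" by (rule subgroup_int_pow_closed[OF A a(1)])
  have w: "g ?w =\<^sub>p g u - e u * g a" if "additive_mod A g" for g
  proof -
    have "g ?w =\<^sub>p g u + g (a [^] (- e u))" by (rule additive_modD[OF that u p])
    also have "\<dots> =\<^sub>p g u + (- e u) * g a"
      by (rule eqp_add[OF eqp_refl additive_mod_int_pow[OF A that a(1)]])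
    finally show ?thesis by simp
  qed
  have "e ?w =\<^sub>p e u - e u * e a" by (rule w[OF e])
  also have "\<dots> =\<^sub>p e u - e u * 1" by (intro eqp_diff eqp_mult eqp_refl a)
  finally have "f ?w =\<^sub>p 0" using ker[of ?w] subgroup.m_closed[OF A u p] by simp
  then have "f u - e u * f a =\<^sub>p 0" using w[OF f] by (meson eqp_sym eqp_trans)
  then show ?thesis by (subst eqp_diff_iff)
qed

section \<open>Central characters on commutators and the Jacobi identity\<close>

lemma central_char_additive: "central_char A e \<Longrightarrow> additive_mod A e"
  by (simp add: central_char_def)

lemma central_char_comm: "\<lbrakk>central_char A e; u \<in> A; x \<in> carrier G\<rbrakk> \<Longrightarrow> e (comm u x) =\<^sub>p 0"
  by (simp add: central_char_def)

lemma central_char_conj: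
  assumes A: "A \<lhd> G" and e: "central_char A e" and u: "u \<in> A" and x: "x \<in> carrier G"
  shows "e (x \<otimes> u \<otimes> inv x) =\<^sub>p e u"
proof -
  have uc: "u \<in> carrier G" using normal_carrier[OF A u] .
  have eq: "x \<otimes> u \<otimes> inv x = u \<otimes> comm (inv u) x"
    using uc x by (simp add: comm_def m_assoc)
  have iu: "inv u \<in> A" using subgroup.m_inv_closed[OF normal_imp_subgroup[OF A] u] .
  have "e (u \<otimes> comm (inv u) x) =\<^sub>p e u + e (comm (inv u) x)"
    by (rule additive_modD[OF central_char_additive[OF e] u normal_comm_left[OF A iu x]])
  also have "\<dots> =\<^sub>p e u + 0"
    by (rule eqp_add[OF eqp_refl central_char_comm[OF e iu x]])
  finally show ?thesis using eq by simp
qed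

text \<open>The commutator of a product with \<open>z\<close> contains a conjugated factor, and
  \<open>e\<close> does not see the conjugation. Only the commutators have to lie in
  \<open>A\<close>, so \<open>S\<close> may be much larger than \<open>A\<close>.\<close>

lemma central_char_comm_left:
  assumes A: "A \<lhd> G" and e: "central_char A e" and S: "S \<subseteq> carrier G" and z: "z \<in> carrier G"
    and SA: "\<And>x. x \<in> S \<Longrightarrow> comm x z \<in> A"
  shows "additive_mod S (\<lambda>x. e (comm x z))"
  unfolding additive_mod_def
proof (intro ballI)
  fix x y assume x: "x \<in> S" and y: "y \<in> S"
  have c: "x \<in> carrier G" "y \<in> carrier G" using x y S by auto
  have "e (x \<otimes> comm y z \<otimes> inv x \<otimes> comm x z) =\<^sub>p e (x \<otimes> comm y z \<otimes> inv x) + e (comm x z)"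
    by (rule additive_modD[OF central_char_additive[OF e] normal_conj[OF A c(1) SA[OF y]] SA[OF x]])
  also have "\<dots> =\<^sub>p e (comm y z) + e (comm x z)"
    by (rule eqp_add[OF central_char_conj[OF A e SA[OF y] c(1)] eqp_refl])
  finally show "e (comm (x \<otimes> y) z) =\<^sub>p e (comm x z) + e (comm y z)"
    using c z by (simp add: comm_mult_left add.commute)
qed

lemma central_char_comm_right:
  assumes A: "A \<lhd> G" and e: "central_char A e" and S: "S \<subseteq> carrier G" and z: "z \<in> carrier G"
    and SA: "\<And>x. x \<in> S \<Longrightarrow> comm z x \<in> A"
  shows "additive_mod S (\<lambda>x. e (comm z x))"
  unfolding additive_mod_def
proof (intro ballI)
  fix x y assume x: "x \<in> S" and y: "y \<in> S"
  have c: "x \<in> carrier G" "y \<in> carrier G" using x y S by auto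
  have "e (comm z x \<otimes> (x \<otimes> comm z y \<otimes> inv x)) =\<^sub>p e (comm z x) + e (x \<otimes> comm z y \<otimes> inv x)"
    by (rule additive_modD[OF central_char_additive[OF e] SA[OF x] normal_conj[OF A c(1) SA[OF y]]])
  also have "\<dots> =\<^sub>p e (comm z x) + e (comm z y)"
    by (rule eqp_add[OF eqp_refl central_char_conj[OF A e SA[OF y] c(1)]])
  finally show "e (comm z (x \<otimes> y)) =\<^sub>p e (comm z x) + e (comm z y)"
    using c z by (simp add: comm_mult_right)
qed

lemma central_char_comm_sym:
  assumes A: "A \<lhd> G" and e: "central_char A e" and c: "x \<in> carrier G" "y \<in> carrier G"
    and "comm x y \<in> A"
  shows "e (comm y x) =\<^sub>p - e (comm x y)"
  using additive_mod_inv[OF normal_imp_subgroup[OF A] central_char_additive[OF e] assms(5)] c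
  by (simp add: comm_inv)

text \<open>Since \<open>y \<otimes> z \<otimes> inv y\<close> is
  \<open>comm y z \<otimes> z\<close>, replacing \<open>z\<close> by it costs only the factor
  \<open>comm w (comm y z)\<close>, which \<open>e\<close> kills, and a conjugation.\<close>

lemma jacobi_term:
  assumes A: "A \<lhd> G" and e: "central_char A e"
    and c: "w \<in> carrier G" "y \<in> carrier G" "z \<in> carrier G"
    and 1: "comm w z \<in> A" and 2: "comm w (comm y z) \<in> A" "e (comm w (comm y z)) =\<^sub>p 0"
  shows "comm w (y \<otimes> z \<otimes> inv y) \<in> A \<and> e (comm w (y \<otimes> z \<otimes> inv y)) =\<^sub>p e (comm w z)"
proof -
  let ?k = "comm y z"
  have kc: "?k \<in> carrier G" using c by simp
  have eq: "comm w (y \<otimes> z \<otimes> inv y) = comm w ?k \<otimes> (?k \<otimes> comm w z \<otimes> inv ?k)"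
    using c by (simp only: conj_eq_comm comm_mult_right kc)
  have conj: "?k \<otimes> comm w z \<otimes> inv ?k \<in> A" by (rule normal_conj[OF A kc 1])
  have "e (comm w ?k \<otimes> (?k \<otimes> comm w z \<otimes> inv ?k)) =\<^sub>p e (comm w ?k) + e (?k \<otimes> comm w z \<otimes> inv ?k)"
    by (rule additive_modD[OF central_char_additive[OF e] 2(1) conj])
  also have "\<dots> =\<^sub>p 0 + e (comm w z)"
    by (rule eqp_add[OF 2(2) central_char_conj[OF A e 1 kc]])
  finally show ?thesis
    using eq conj 2(1) subgroup.m_closed[OF normal_imp_subgroup[OF A]] by simp
qed

text \<open>The Hall-Witt identity read through \<open>e\<close>. No weights are assumed, only that
  the error terms, commutators of two commutators, are killed; this admits entries whose commutators
  lie deeper than their weights predict.\<close>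

lemma jacobi:
  assumes A: "A \<lhd> G" and e: "central_char A e"
    and c: "x \<in> carrier G" "y \<in> carrier G" "z \<in> carrier G"
    and 1: "comm (comm x y) z \<in> A" "comm (comm y z) x \<in> A" "comm (comm z x) y \<in> A"
    and 2: "comm (comm x y) (comm y z) \<in> A" "comm (comm y z) (comm z x) \<in> A"
      "comm (comm z x) (comm x y) \<in> A"
    and 3: "e (comm (comm x y) (comm y z)) =\<^sub>p 0" "e (comm (comm y z) (comm z x)) =\<^sub>p 0"
      "e (comm (comm z x) (comm x y)) =\<^sub>p 0"
  shows "e (comm (comm x y) z) + e (comm (comm y z) x) + e (comm (comm z x) y) =\<^sub>p 0"
proof -
  let ?a = "comm (comm x y) (y \<otimes> z \<otimes> inv y)" and ?b = "comm (comm y z) (z \<otimes> x \<otimes> inv z)"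
    and ?c = "comm (comm z x) (x \<otimes> y \<otimes> inv x)"
  note m = subgroup.m_closed[OF normal_imp_subgroup[OF A]]
  note add = additive_modD[OF central_char_additive[OF e]]
  have a: "?a \<in> A \<and> e ?a =\<^sub>p e (comm (comm x y) z)"
    by (rule jacobi_term[OF A e]) (use c 1 2 3 in simp_all)
  have b: "?b \<in> A \<and> e ?b =\<^sub>p e (comm (comm y z) x)"
    by (rule jacobi_term[OF A e]) (use c 1 2 3 in simp_all)
  have cc: "?c \<in> A \<and> e ?c =\<^sub>p e (comm (comm z x) y)"
    by (rule jacobi_term[OF A e]) (use c 1 2 3 in simp_all)
  have "e (?a \<otimes> ?b \<otimes> ?c) =\<^sub>p e (?a \<otimes> ?b) + e ?c"
    using a b cc m by (intro add) auto
  also have "\<dots> =\<^sub>p e ?a + e ?b + e ?c"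
    using a b cc m by (intro eqp_add eqp_refl add) auto
  finally have "e \<one> =\<^sub>p e ?a + e ?b + e ?c" unfolding hall_witt[OF c] .
  then have "e ?a + e ?b + e ?c =\<^sub>p 0"
    using additive_mod_one[OF normal_imp_subgroup[OF A] central_char_additive[OF e]]
    by (meson eqp_sym eqp_trans)
  then show ?thesis using a b cc by (blast intro: eqp_sum3)
qed

lemma central_char_lower_central_Suc:
  assumes k: "k \<noteq> 0" and e: "central_char (lower_central G k) e" and u: "u \<in> lower_central G (Suc k)"
  shows "e u =\<^sub>p 0"
proof -
  have "lower_central G (Suc k) \<subseteq> {u \<in> lower_central G k. e u =\<^sub>p 0}"
    unfolding lower_central_Suc[OF k]
  proof (rule commutator_subgroup_subset)
    show "subgroup {u \<in> lower_central G k. e u =\<^sub>p 0} G"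
      by (rule additive_mod_kernel_subgroup[OF lower_central_subgroup central_char_additive[OF e]])
    fix a b assume "a \<in> lower_central G k" "b \<in> carrier G"
    then show "comm a b \<in> {u \<in> lower_central G k. e u =\<^sub>p 0}"
      using central_char_comm[OF e] normal_comm_left[OF lower_central_normal] by blast
  qed
  then show ?thesis using u by blast
qed

lemma central_char_lower_central_gt:
  assumes "k \<noteq> 0" "central_char (lower_central G k) e" "k < m" "u \<in> lower_central G m"
  shows "e u =\<^sub>p 0"
  using central_char_lower_central_Suc[OF assms(1,2)] lower_central_antimono[of "Suc k" m] assms(3,4)
  by auto

lemma jacobi_lower_central:
  assumes e: "central_char (lower_central G k) e" and k: "k = i + j + l" and pos: "0 < i" "0 < j" "0 < l"
    and x: "x \<in> lower_central G i" and y: "y \<in> lower_central G j" and z: "z \<in> lower_central G l"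
  shows "e (comm (comm x y) z) + e (comm (comm y z) x) + e (comm (comm z x) y) =\<^sub>p 0"
proof (rule jacobi[OF lower_central_normal e])
  show c: "x \<in> carrier G" "y \<in> carrier G" "z \<in> carrier G"
    using x y z lower_central_carrier by blast+
  note c2 = comm_lower_central
  have xy: "comm x y \<in> lower_central G (i + j)" and yz: "comm y z \<in> lower_central G (j + l)"
    and zx: "comm z x \<in> lower_central G (l + i)" using c2 x y z by blast+
  show "comm (comm x y) z \<in> lower_central G k" "comm (comm y z) x \<in> lower_central G k"
      "comm (comm z x) y \<in> lower_central G k"
    using c2[OF xy z] c2[OF yz x] c2[OF zx y] by (simp_all add: k ac_simps)
  \<comment> \<open>Each error term has weight above \<open>k\<close>, because one of the three
    entries, all of positive weight, is counted twice.\<close>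
  have s: "u \<in> lower_central G k \<and> e u =\<^sub>p 0" if "u \<in> lower_central G m" "k < m" for u m
    using that central_char_lower_central_gt[OF _ e that(2,1)] lower_central_antimono[of k m] k pos by auto
  show "comm (comm x y) (comm y z) \<in> lower_central G k" "e (comm (comm x y) (comm y z)) =\<^sub>p 0"
    using s[OF c2[OF xy yz]] k pos by simp_all
  show "comm (comm y z) (comm z x) \<in> lower_central G k" "e (comm (comm y z) (comm z x)) =\<^sub>p 0"
    using s[OF c2[OF yz zx]] k pos by simp_all
  show "comm (comm z x) (comm x y) \<in> lower_central G k" "e (comm (comm z x) (comm x y)) =\<^sub>p 0"
    using s[OF c2[OF zx xy]] k pos by simp_all
qed

text \<open>Nilpotency in the form needed: a nonzero central character of a term vanishes on the
  next term.\<close>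

lemma lower_central_psubset:
  assumes "lower_central G k \<noteq> {\<one>}" "k \<noteq> 0"
  shows "lower_central G (Suc k) \<subset> lower_central G k"
proof -
  obtain e x where e: "central_char (lower_central G k) e" "x \<in> lower_central G k" "e x =\<^sub>p 1"
    using central_char_exists[OF lower_central_normal assms(1)] by blast
  have "x \<notin> lower_central G (Suc k)"
    using central_char_lower_central_Suc[OF assms(2) e(1)] e(3) not_1_eqp_0
    by (meson eqp_sym eqp_trans)
  then show ?thesis using e(2) lower_central_Suc_subset by blast
qed

text \<open>A kernel strictly larger than \<open>K\<close> would lie strictly between
  \<open>K\<close> and \<open>A\<close>, which is impossible for a p-group with index p.\<close>

lemma kernel_eq_of_card:
  assumes A: "subgroup A G" and K: "subgroup K G" and e: "additive_mod A e"
    and x: "x \<in> A" "e x =\<^sub>p 1" and KA: "K \<subseteq> A" "\<And>u. u \<in> K \<Longrightarrow> e u =\<^sub>p 0" and card: "card A = p * card K"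
    and u: "u \<in> A" "e u =\<^sub>p 0"
  shows "u \<in> K"
proof (rule ccontr)
  assume "u \<notin> K"
  let ?L = "{u \<in> A. e u =\<^sub>p 0}"
  have L: "subgroup ?L G" by (rule additive_mod_kernel_subgroup[OF A e])
  have "\<not> e x =\<^sub>p 0" using x(2) not_1_eqp_0 by (meson eqp_sym eqp_trans)
  then have "?L \<subset> A" using x(1) by blast
  then obtain i j where ij: "card ?L = p ^ i" "card A = p ^ j" "i < j"
    using card_subgroup_psubset[OF L A] by blast
  have "K \<subset> ?L" using KA u \<open>u \<notin> K\<close> by blast
  then obtain i' j' where ij': "card K = p ^ i'" "card ?L = p ^ j'" "i' < j'"
    using card_subgroup_psubset[OF K L] by blast
  have "j' = i" using ij(1) ij'(2) p_gt_1 by (metis power_inject_exp)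
  moreover have "j = Suc i'" using card ij(2) ij'(1) p_gt_1 by (metis power_Suc power_inject_exp)
  ultimately show False using ij(3) ij'(3) by simp
qed

section \<open>The layers of the lower central series\<close>

abbreviation lcs ("\<gamma>") where "\<gamma> \<equiv> lower_central G"

lemma comm_lcs: "\<lbrakk>x \<in> \<gamma> i; y \<in> \<gamma> j; k \<le> i + j\<rbrakk> \<Longrightarrow> comm x y \<in> \<gamma> k"
  using comm_lower_central lower_central_antimono by blast

text \<open>Certificates for linear reasoning modulo p: the difference of the two sides is an
  integer combination of known differences. The coefficients are supplied at each use, and what
  remains is an identity over the integers.\<close>

lemma eqp_combine1:
  "\<lbrakk>a =\<^sub>p b; x - y = c * (a - b)\<rbrakk> \<Longrightarrow> x =\<^sub>p y"
  by (simp add: eqp_iff_dvd_diff)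

lemma eqp_combine2:
  "\<lbrakk>a =\<^sub>p b; a' =\<^sub>p b'; x - y = c * (a - b) + c' * (a' - b')\<rbrakk> \<Longrightarrow> x =\<^sub>p y"
  by (simp add: eqp_iff_dvd_diff)

lemma eqp_combine3:
  "\<lbrakk>a =\<^sub>p b; a' =\<^sub>p b'; a'' =\<^sub>p b''; x - y = c * (a - b) + c' * (a' - b') + c'' * (a'' - b'')\<rbrakk>
    \<Longrightarrow> x =\<^sub>p y"
  by (simp add: eqp_iff_dvd_diff)

text \<open>Every use of the hypothesis \<open>p \<ge> 3\<close> comes down to this
  cancellation.\<close>

lemma eqp_double_0:
  assumes "2 * a =\<^sub>p 0" "p \<ge> 3"
  shows "a =\<^sub>p 0"
proof -
  have "\<not> 2 =\<^sub>p 0"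
    using assms(2) zdvd_imp_le[of "int p" 2] by (auto simp: eqp_0_iff)
  then show ?thesis using eqp_mult_0[OF assms(1)] by blast
qed

lemma central_char_kernel_normal:
  assumes A: "A \<lhd> G" and e: "central_char A e"
  shows "{u \<in> A. e u =\<^sub>p 0} \<lhd> G"
  unfolding normal_inv_iff
proof (intro conjI ballI)
  show "subgroup {u \<in> A. e u =\<^sub>p 0} G"
    by (rule additive_mod_kernel_subgroup[OF normal_imp_subgroup[OF A] central_char_additive[OF e]])
  fix x u assume "x \<in> carrier G" "u \<in> {u \<in> A. e u =\<^sub>p 0}"
  then show "x \<otimes> u \<otimes> inv x \<in> {u \<in> A. e u =\<^sub>p 0}"
    using central_char_conj[OF A e] normal_conj[OF A] by (blast intro: eqp_trans)
qed

text \<open>A centraliser modulo the kernel of \<open>e\<close>, which is normal because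
  \<open>e\<close> is invariant under conjugation.\<close>

lemma central_char_kernel_subgroup:
  assumes A: "A \<lhd> G" and e: "central_char A e" and S: "subgroup S G" and T: "T \<subseteq> carrier G"
    and ST: "\<And>x y. x \<in> S \<Longrightarrow> y \<in> T \<Longrightarrow> comm x y \<in> A"
  shows "subgroup {x \<in> S. \<forall>y\<in>T. e (comm x y) =\<^sub>p 0} G"
proof -
  let ?N = "{u \<in> A. e u =\<^sub>p 0}"
  have "subgroup (S \<inter> {x \<in> carrier G. \<forall>y\<in>T. comm x y \<in> ?N}) G"
    by (rule subgroups_Inter_pair[OF S centralizer_mod_subgroup[OF central_char_kernel_normal[OF A e] T]])
  moreover have "S \<inter> {x \<in> carrier G. \<forall>y\<in>T. comm x y \<in> ?N} = {x \<in> S. \<forall>y\<in>T. e (comm x y) =\<^sub>p 0}"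
    using ST subgroup.mem_carrier[OF S] by auto
  ultimately show ?thesis by simp
qed

lemma additive_mod_lower_central_0:
  assumes f: "additive_mod (\<gamma> (Suc i)) f" and i: "i \<noteq> 0"
    and 0: "\<And>v x. v \<in> \<gamma> i \<Longrightarrow> x \<in> carrier G \<Longrightarrow> f (comm v x) =\<^sub>p 0"
    and u: "u \<in> \<gamma> (Suc i)"
  shows "f u =\<^sub>p 0"
proof -
  have "\<gamma> (Suc i) \<subseteq> {u \<in> \<gamma> (Suc i). f u =\<^sub>p 0}"
    by (subst lower_central_Suc[OF i], rule commutator_subgroup_subset)
      (auto simp: additive_mod_kernel_subgroup[OF lower_central_subgroup f] 0 comm_lower_central_carrier)
  then show ?thesis using u by blast
qed

lemma central_char_nontrivial:
  assumes f: "central_char (\<gamma> (Suc i)) f" and i: "i \<noteq> 0" and d: "d \<in> \<gamma> (Suc i)" "f d =\<^sub>p 1"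
  shows "\<exists>v\<in>\<gamma> i. \<exists>x\<in>carrier G. \<not> f (comm v x) =\<^sub>p 0"
proof (rule ccontr)
  assume "\<not> ?thesis"
  then have "f d =\<^sub>p 0"
    using additive_mod_lower_central_0[OF central_char_additive[OF f] i _ d(1)] by blast
  then show False using d(2) not_1_eqp_0 eqp_sym eqp_trans by blast
qed

lemma comm_left_additive:
  assumes f: "central_char (\<gamma> k) f" and k: "k = i + j" and x: "x \<in> \<gamma> j"
  shows "additive_mod (\<gamma> i) (\<lambda>u. f (comm u x))"
  using lower_central_carrier comm_lower_central[OF _ x]
  by (intro central_char_comm_left[OF lower_central_normal f] lower_central_carrier[OF x])
    (auto simp: k)

lemma comm_right_additive:
  assumes f: "central_char (\<gamma> k) f" and k: "k = i + j" and x: "x \<in> \<gamma> j"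
  shows "additive_mod (\<gamma> i) (\<lambda>u. f (comm x u))"
  using lower_central_carrier comm_lower_central[OF x]
  by (intro central_char_comm_right[OF lower_central_normal f] lower_central_carrier[OF x])
    (auto simp: k add.commute)

lemma comm_sym_lower_central:
  assumes f: "central_char (\<gamma> k) f" and k: "k = i + j" and x: "x \<in> \<gamma> i" and y: "y \<in> \<gamma> j"
  shows "f (comm y x) =\<^sub>p - f (comm x y)"
  using comm_lower_central[OF x y] lower_central_carrier x y
  by (intro central_char_comm_sym[OF lower_central_normal f]) (auto simp: k)

text \<open>\<open>e\<close> identifies the factor of two consecutive terms with Z/p, and
  \<open>a\<close> has coordinate 1. The last clause makes the kernel exactly the next term, which a
  central character alone does not guarantee.\<close>

definition layer_char :: "nat \<Rightarrow> ('a \<Rightarrow> int) \<Rightarrow> 'a \<Rightarrow> bool" where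
  "layer_char i e a \<longleftrightarrow> central_char (\<gamma> i) e \<and> a \<in> \<gamma> i \<and> e a =\<^sub>p 1 \<and>
     (\<forall>u\<in>\<gamma> i. e u =\<^sub>p 0 \<longrightarrow> u \<in> \<gamma> (Suc i))"

lemma layer_char_exists:
  assumes card: "card (\<gamma> i) = p * card (\<gamma> (Suc i))" and i: "i \<noteq> 0"
  shows "\<exists>e a. layer_char i e a"
proof -
  have "\<gamma> i \<noteq> {\<one>}"
  proof
    assume 1: "\<gamma> i = {\<one>}"
    then have "\<gamma> (Suc i) = {\<one>}"
      using lower_central_Suc_subset[of i] subgroup.one_closed[OF lower_central_subgroup[of "Suc i"]] by auto
    then show False using card 1 p_gt_1 by simp
  qed
  then obtain e a where e: "central_char (\<gamma> i) e" "a \<in> \<gamma> i" "e a =\<^sub>p 1"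
    using central_char_exists[OF lower_central_normal] by blast
  then have "layer_char i e a"
    unfolding layer_char_def
    using kernel_eq_of_card[OF lower_central_subgroup lower_central_subgroup central_char_additive[OF e(1)]
        e(2,3) lower_central_Suc_subset central_char_lower_central_Suc[OF i e(1)] card] by blast
  then show ?thesis by blast
qed

text \<open>The kernel of \<open>e\<close> is the next term, whose commutators with
  \<open>\<gamma> j\<close> have weight above \<open>k\<close> and are killed by \<open>f\<close>.
  So the value at \<open>a\<close> determines the whole pairing.\<close>

lemma layer_char_left:
  assumes e: "layer_char i e a" and f: "central_char (\<gamma> k) f" and k: "k = i + j" "k \<noteq> 0"
    and u: "u \<in> \<gamma> i" and x: "x \<in> \<gamma> j"
  shows "f (comm u x) =\<^sub>p e u * f (comm a x)"
proof (rule additive_mod_coordinate[where A = "\<gamma> i" and e = e and a = a and f = "\<lambda>u. f (comm u x)"])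
  show "subgroup (\<gamma> i) G" by (rule lower_central_subgroup)
  show "additive_mod (\<gamma> i) e" "a \<in> \<gamma> i" "e a =\<^sub>p 1"
    using e central_char_additive by (auto simp: layer_char_def)
  show "additive_mod (\<gamma> i) (\<lambda>u. f (comm u x))"
    by (rule comm_left_additive[OF f k(1) x])
  show "f (comm w x) =\<^sub>p 0" if "w \<in> \<gamma> i" "e w =\<^sub>p 0" for w
    using that e comm_lower_central[OF _ x, of w "Suc i"]
      central_char_lower_central_gt[OF k(2) f, of "Suc i + j"] k
    by (auto simp: layer_char_def)
qed (rule u)

lemma layer_char_right:
  assumes e: "layer_char i e a" and f: "central_char (\<gamma> k) f" and k: "k = i + j" "k \<noteq> 0"
    and u: "u \<in> \<gamma> i" and x: "x \<in> \<gamma> j"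
  shows "f (comm x u) =\<^sub>p e u * f (comm x a)"
proof -
  have a: "a \<in> \<gamma> i" using e by (simp add: layer_char_def)
  have 1: "f (comm x u) =\<^sub>p - f (comm u x)" "f (comm x a) =\<^sub>p - f (comm a x)"
    using comm_sym_lower_central[OF f k(1) _ x] u a by auto
  show ?thesis
    by (rule eqp_combine3[OF 1 layer_char_left[OF assms], of _ _ 1 "- e u" "-1"]) (simp add: algebra_simps)
qed

text \<open>The commutator induces an alternating form \<open>w\<close> on \<open>\<gamma>\<^sub>2/\<gamma>\<^sub>3\<close>. If it is nonzero, it is nondegenerate, so elements
  \<open>x, y\<close> acting trivially on \<open>\<gamma>\<^sub>3/\<gamma>\<^sub>4\<close> commute modulo \<open>\<gamma>\<^sub>3\<close>; the Jacobi identity for \<open>x, y, t\<close> then gives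
  \<open>2 w([t, x], [t, y]) = 0\<close>, and these values determine \<open>w\<close>.\<close>

lemma first_layer_not_rank_2:
  assumes p3: "p \<ge> 3" and card3: "card (\<gamma> 3) = p * card (\<gamma> 4)"
    and card2: "card (\<gamma> 2) = p ^ 2 * card (\<gamma> 3)"
    and d4: "derived G (\<gamma> 2) = \<gamma> 4" and ne: "\<gamma> 4 \<noteq> {\<one>}"
  shows False
proof -
  have g1: "\<gamma> 1 = carrier G" by simp
  obtain e3 b where e3: "layer_char 3 e3 b" using layer_char_exists[of 3] card3 by auto
  have c3: "central_char (\<gamma> 3) e3" and b: "b \<in> \<gamma> 3" "e3 b =\<^sub>p 1"
    using e3 by (auto simp: layer_char_def)
  obtain e4 d where c4: "central_char (\<gamma> 4) e4" and d: "d \<in> \<gamma> 4" "e4 d =\<^sub>p 1"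
    using central_char_exists[OF lower_central_normal ne] by blast
  note lcc = lower_central_carrier
  have comm1: "comm x y \<in> \<gamma> 2" if "x \<in> carrier G" "y \<in> carrier G" for x y
    using comm_lcs[of x 1 y 1 2] that by (simp add: g1)
  define \<psi> where "\<psi> x = e4 (comm b x)" for x
  define P where "P u x = e3 (comm u x)" for u x
  define w where "w u v = e4 (comm u v)" for u v
  have coord: "e4 (comm v x) =\<^sub>p e3 v * \<psi> x" if "v \<in> \<gamma> 3" "x \<in> carrier G" for v x
    unfolding \<psi>_def using layer_char_left[OF e3 c4, of 1 v x] that by simp
  have P_left: "additive_mod (\<gamma> 2) (\<lambda>u. P u x)" if "x \<in> carrier G" for x
    unfolding P_def using comm_left_additive[OF c3, of 2 1 x] that by simp
  have P_right: "additive_mod (carrier G) (P u)" if "u \<in> \<gamma> 2" for u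
    unfolding P_def using comm_right_additive[OF c3, of 1 2 u] that by simp
  have w_left: "additive_mod (\<gamma> 2) (\<lambda>u. w u v)" if "v \<in> \<gamma> 2" for v
    unfolding w_def using comm_left_additive[OF c4, of 2 2 v] that by simp
  have w_sym: "w v u =\<^sub>p - w u v" if "u \<in> \<gamma> 2" "v \<in> \<gamma> 2" for u v
    unfolding w_def using comm_sym_lower_central[OF c4, of 2 2] that by simp
  have \<psi>_add: "additive_mod (carrier G) \<psi>"
    unfolding \<psi>_def using comm_right_additive[OF c4, of 1 3 b] b by simp
  \<comment> \<open>Jacobi identity for \<open>x, y, u\<close> in weight 4. It expresses
    \<open>w\<close> through the commutation \<open>P\<close> from the second layer to the third and
    one linear form \<psi>.\<close>
  have F: "w (comm x y) u =\<^sub>p P u y * \<psi> x - P u x * \<psi> y"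
    if "x \<in> carrier G" "y \<in> carrier G" "u \<in> \<gamma> 2" for x y u
  proof -
    have uy: "comm y u \<in> \<gamma> 3" "comm u x \<in> \<gamma> 3"
      using comm_lcs[of y 1 u 2 3] comm_lcs[of u 2 x 1 3] that by (simp_all add: g1)
    have s: "e3 (comm y u) =\<^sub>p - P u y"
      unfolding P_def using comm_sym_lower_central[OF c3, of 2 1 u y] that by simp
    have j: "w (comm x y) u + e4 (comm (comm y u) x) + e4 (comm (comm u x) y) =\<^sub>p 0"
      unfolding w_def by (rule jacobi_lower_central[OF c4, of 1 1 2]) (use that in simp_all)
    have k: "e4 (comm (comm y u) x) =\<^sub>p - P u y * \<psi> x"
      using coord[OF uy(1) that(1)] eqp_mult[OF s eqp_refl, of "\<psi> x"] by (rule eqp_trans)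
    have l: "e4 (comm (comm u x) y) =\<^sub>p P u x * \<psi> y"
      unfolding P_def by (rule coord[OF uy(2) that(2)])
    show ?thesis
      by (rule eqp_combine3[OF j k l, of _ _ 1 "-1" "-1"]) (simp add: algebra_simps)
  qed
  have w_nontrivial: False if "\<And>u v. u \<in> \<gamma> 2 \<Longrightarrow> v \<in> \<gamma> 2 \<Longrightarrow> w u v =\<^sub>p 0"
  proof -
    have "derived G (\<gamma> 2) \<subseteq> {u \<in> \<gamma> 4. e4 u =\<^sub>p 0}"
      using that comm_lower_central[of _ 2 _ 2] unfolding w_def
      by (intro derived_subset additive_mod_kernel_subgroup[OF lower_central_subgroup central_char_additive[OF c4]])
        auto
    then show False using d d4 not_1_eqp_0 eqp_sym eqp_trans by blast
  qed
  obtain t where t: "t \<in> carrier G" "\<psi> t =\<^sub>p 1"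
  proof -
    obtain v x where vx: "v \<in> \<gamma> 3" "x \<in> carrier G" "\<not> e4 (comm v x) =\<^sub>p 0"
      using central_char_nontrivial[of 3 e4 d] c4 d by auto
    have "\<not> \<psi> x =\<^sub>p 0" using coord[OF vx(1,2)] vx(3) eqp_0_mult(2) eqp_trans by blast
    then obtain m where m: "\<psi> x * m =\<^sub>p 1" using eqp_invertible by blast
    have "\<psi> (x [^] m) =\<^sub>p m * \<psi> x" by (rule additive_mod_int_pow[OF subgroup_self \<psi>_add vx(2)])
    then have "\<psi> (x [^] m) =\<^sub>p 1" using m by (metis eqp_trans mult.commute)
    then show thesis using that[of "x [^] m"] vx(2) by simp
  qed
  \<comment> \<open>Nondegeneracy of \<open>w\<close>. If the radical \<open>?W\<close> were larger
    than \<open>\<gamma> 3\<close>, then the orthogonal \<open>?V\<close> of an element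
    \<open>v\<close> outside \<open>?W\<close> would contain \<open>?W\<close> strictly, as
    \<open>w\<close> is alternating. With \<open>?V\<close> proper in \<open>\<gamma> 2\<close>,
    three strict inclusions exceed the index \<open>p ^ 2\<close>; so \<open>w\<close> would
    vanish.\<close>
  have W3: "u \<in> \<gamma> 3" if u: "u \<in> \<gamma> 2" and uW: "\<And>v. v \<in> \<gamma> 2 \<Longrightarrow> w u v =\<^sub>p 0" for u
  proof (rule ccontr)
    assume u3: "u \<notin> \<gamma> 3"
    have sub: "subgroup {u \<in> \<gamma> 2. \<forall>v\<in>T. w u v =\<^sub>p 0} G" if "T \<subseteq> \<gamma> 2" for T
      unfolding w_def using that lcc comm_lower_central[of _ 2 _ 2]
      by (intro central_char_kernel_subgroup[OF lower_central_normal c4 lower_central_subgroup]) auto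
    let ?W = "{u \<in> \<gamma> 2. \<forall>v\<in>\<gamma> 2. w u v =\<^sub>p 0}"
    have "\<gamma> 3 \<subseteq> ?W"
    proof
      fix x assume x: "x \<in> \<gamma> 3"
      have "w x v =\<^sub>p 0" if "v \<in> \<gamma> 2" for v
        unfolding w_def using comm_lower_central[OF x that]
        by (intro central_char_lower_central_gt[OF _ c4, of 5]) auto
      then show "x \<in> ?W" using x lower_central_antimono[of 2 3] by auto
    qed
    moreover have "u \<in> ?W" using u uW by blast
    ultimately have 1: "\<gamma> 3 \<subset> ?W" using u3 by blast
    have "w x v =\<^sub>p 0" if x: "x \<in> \<gamma> 2" and v: "v \<in> \<gamma> 2" for x v
    proof (cases "v \<in> ?W")
      case True
      then have "w v x =\<^sub>p 0" using x by blast
      then show ?thesis using w_sym[OF v x] eqp_minus[of "w v x" 0] by (auto intro: eqp_trans)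
    next
      case False
      let ?V = "{x \<in> \<gamma> 2. \<forall>v\<in>{v}. w x v =\<^sub>p 0}"
      have "v \<in> ?V"
        using v lcc[OF v] additive_mod_one[OF lower_central_subgroup central_char_additive[OF c4]]
        by (simp add: w_def)
      then have 2: "?W \<subset> ?V" using False v by blast
      have "?V = \<gamma> 2"
      proof (rule ccontr)
        assume "?V \<noteq> \<gamma> 2"
        then have 3: "?V \<subset> \<gamma> 2" by blast
        have subV: "subgroup ?V G" using sub[of "{v}"] v by blast
        have subW: "subgroup ?W G" using sub[of "\<gamma> 2"] by blast
        obtain i j where ij: "card (\<gamma> 3) = p ^ i" "card ?W = p ^ j" "i < j"
          using card_subgroup_psubset[OF lower_central_subgroup subW 1] by blast
        obtain j' k where jk: "card ?W = p ^ j'" "card ?V = p ^ k" "j' < k"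
          using card_subgroup_psubset[OF subW subV 2] by blast
        obtain k' l where kl: "card ?V = p ^ k'" "card (\<gamma> 2) = p ^ l" "k' < l"
          using card_subgroup_psubset[OF subV lower_central_subgroup 3] by blast
        have "j' = j" "k' = k" using ij jk kl p_gt_1 by (metis power_inject_exp)+
        moreover have "p ^ l = p ^ (2 + i)" using card2 kl ij by (simp add: power_add power2_eq_square)
        then have "l = 2 + i" using p_gt_1 power_inject_exp by blast
        ultimately show False using ij jk kl by simp
      qed
      then show ?thesis using x by blast
    qed
    then show False using w_nontrivial by blast
  qed
  have Ft: "w (comm t y) u =\<^sub>p P u y" if "y \<in> carrier G" "\<psi> y =\<^sub>p 0" "u \<in> \<gamma> 2" for y u
    by (rule eqp_combine3[OF F[OF t(1) that(1,3)] t(2) that(2), of _ _ 1 "P u y" "- P u t"])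
      (simp add: algebra_simps)
  have tt: "w (comm t y) (comm t x) =\<^sub>p 0"
    if x: "x \<in> carrier G" "\<psi> x =\<^sub>p 0" and y: "y \<in> carrier G" "\<psi> y =\<^sub>p 0" for x y
  proof -
    have "w (comm x y) v =\<^sub>p 0" if "v \<in> \<gamma> 2" for v
      by (rule eqp_combine3[OF F[OF x(1) y(1) that] x(2) y(2), of _ _ 1 "P v y" "- P v x"])
        (simp add: algebra_simps)
    then have "comm x y \<in> \<gamma> 3" using W3 comm1 x y by blast
    then have "comm (comm x y) t \<in> \<gamma> 4"
      using comm_lower_central_carrier[of "comm x y" 3 t] t by simp
    then have 1: "P (comm x y) t =\<^sub>p 0"
      unfolding P_def by (intro central_char_lower_central_gt[OF _ c3, of 4]) auto
    have 2: "P (comm x y) t + P (comm y t) x + P (comm t x) y =\<^sub>p 0"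
      unfolding P_def by (rule jacobi_lower_central[OF c3, of 1 1 1]) (use x y t in simp_all)
    have 3: "P (comm y t) x =\<^sub>p - P (comm t y) x"
      using additive_mod_inv[OF lower_central_subgroup P_left[OF x(1)] comm1[OF t(1) y(1)]] t y
      by (simp add: comm_inv)
    have ct: "comm t x \<in> \<gamma> 2" "comm t y \<in> \<gamma> 2" using comm1 t x y by auto
    note 4 = Ft[OF y ct(1)] and 5 = Ft[OF x ct(2)] and 6 = w_sym[OF ct]
    have 7: "P (comm t x) y =\<^sub>p P (comm t y) x"
      by (rule eqp_combine3[OF 1 2 3, of _ _ "-1" 1 "-1"]) (simp add: algebra_simps)
    \<comment> \<open>Symmetric by the Jacobi identity, antisymmetric by \<open>w_sym\<close>:
      together they leave twice the value.\<close>
    have 8: "w (comm t y) (comm t x) =\<^sub>p w (comm t x) (comm t y)"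
      by (rule eqp_combine3[OF 4 5 7, of _ _ 1 "-1" 1]) (simp add: algebra_simps)
    have "2 * w (comm t y) (comm t x) =\<^sub>p 0"
      by (rule eqp_combine2[OF 8 6, of _ _ 1 1]) (simp add: algebra_simps)
    then show ?thesis by (rule eqp_double_0[OF _ p3])
  qed
  \<comment> \<open>Projection to the kernel of \<psi> along \<open>t\<close>, so that results on
    that kernel apply to arbitrary elements.\<close>
  define \<kappa> where "\<kappa> z = t [^] (- \<psi> z) \<otimes> z" for z
  have \<kappa>: "\<kappa> z \<in> carrier G" "\<psi> (\<kappa> z) =\<^sub>p 0" if "z \<in> carrier G" for z
  proof -
    have "\<psi> (\<kappa> z) =\<^sub>p \<psi> (t [^] (- \<psi> z)) + \<psi> z"
      unfolding \<kappa>_def by (rule additive_modD[OF \<psi>_add]) (use t that in auto)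
    moreover have "\<psi> (t [^] (- \<psi> z)) =\<^sub>p - \<psi> z * \<psi> t"
      by (rule additive_mod_int_pow[OF subgroup_self \<psi>_add t(1)])
    ultimately show "\<psi> (\<kappa> z) =\<^sub>p 0"
      by (rule eqp_combine3[OF _ _ t(2), of _ _ _ _ _ _ 1 1 "- \<psi> z"]) (simp add: algebra_simps)
  qed (use t that in \<open>simp add: \<kappa>_def\<close>)
  have P\<kappa>: "P u (\<kappa> z) =\<^sub>p - \<psi> z * P u t + P u z" if u: "u \<in> \<gamma> 2" and z: "z \<in> carrier G" for u z
  proof -
    have "P u (\<kappa> z) =\<^sub>p P u (t [^] (- \<psi> z)) + P u z"
      unfolding \<kappa>_def by (rule additive_modD[OF P_right[OF u]]) (use t z in auto)
    also have "\<dots> =\<^sub>p - \<psi> z * P u t + P u z"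
      by (rule eqp_add[OF additive_mod_int_pow[OF subgroup_self P_right[OF u] t(1)] eqp_refl])
    finally show ?thesis .
  qed
  have F': "w (comm x y) u =\<^sub>p P u (\<kappa> y) * \<psi> x - P u (\<kappa> x) * \<psi> y"
    if "x \<in> carrier G" "y \<in> carrier G" "u \<in> \<gamma> 2" for x y u
    by (rule eqp_combine3[OF F[OF that] P\<kappa>[OF that(3,1)] P\<kappa>[OF that(3,2)], of _ _ 1 "\<psi> y" "- \<psi> x"])
      (simp add: algebra_simps)
  \<comment> \<open>By \<open>Ft\<close> and antisymmetry, \<open>P (comm x y) k\<close> is
    \<open>- w (comm x y) (comm t k)\<close>. Expanding with \<open>F'\<close> leaves only values of
    \<open>P (comm t k)\<close> on the kernel of \<psi>, which are values of \<open>w\<close> killed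
    by \<open>tt\<close>.\<close>
  have PK: "P u k =\<^sub>p 0" if k: "k \<in> carrier G" "\<psi> k =\<^sub>p 0" and u: "u \<in> \<gamma> 2" for k u
  proof -
    have "P (comm x y) k =\<^sub>p 0" if x: "x \<in> carrier G" and y: "y \<in> carrier G" for x y
    proof -
      have tk: "comm t k \<in> \<gamma> 2" using comm1 t k by blast
      have z: "P (comm t k) (\<kappa> z) =\<^sub>p 0" if "z \<in> carrier G" for z
        using tt[OF k \<kappa>[OF that]] Ft[OF \<kappa>[OF that] tk] by (meson eqp_sym eqp_trans)
      have 1: "w (comm x y) (comm t k) =\<^sub>p 0"
        by (rule eqp_combine3[OF F'[OF x y tk] z[OF x] z[OF y], of _ _ 1 "- \<psi> y" "\<psi> x"])
          (simp add: algebra_simps)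
      show ?thesis
        by (rule eqp_combine3[OF Ft[OF k comm1[OF x y]] w_sym[OF comm1[OF x y] tk] 1, of _ _ "-1" 1 "-1"])
          (simp add: algebra_simps)
    qed
    then show ?thesis
      using additive_mod_lower_central_0[of 1 "\<lambda>u. P u k" u] P_left[OF k(1)] u
      by (simp add: numeral_2_eq_2)
  qed
  have wg: "w (comm x y) v =\<^sub>p 0" if "x \<in> carrier G" "y \<in> carrier G" "v \<in> \<gamma> 2" for x y v
    by (rule eqp_combine3[OF F'[OF that] PK[OF \<kappa>[OF that(1)] that(3)] PK[OF \<kappa>[OF that(2)] that(3)],
          of _ _ 1 "- \<psi> y" "\<psi> x"]) (simp add: algebra_simps)
  have "w u v =\<^sub>p 0" if u: "u \<in> \<gamma> 2" and v: "v \<in> \<gamma> 2" for u v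
    using additive_mod_lower_central_0[of 1 "\<lambda>u. w u v" u] w_left[OF v] u wg[OF _ _ v]
    by (simp add: numeral_2_eq_2)
  then show False using w_nontrivial by blast
qed

section \<open>Generation by one layer, and the orders of the layers\<close>

lemma layer_char_generate:
  assumes e: "layer_char i e a" and S: "subgroup S G" "a \<in> S" "\<gamma> (Suc i) \<subseteq> S" and u: "u \<in> \<gamma> i"
  shows "u \<in> S"
proof -
  have a: "a \<in> \<gamma> i" and ac: "a \<in> carrier G" and uc: "u \<in> carrier G"
    using e u lower_central_carrier by (auto simp: layer_char_def)
  have add: "additive_mod (\<gamma> i) e" using e central_char_additive by (auto simp: layer_char_def)
  let ?w = "u \<otimes> a [^] (- e u)"
  have p: "a [^] (- e u) \<in> \<gamma> i" by (rule subgroup_int_pow_closed[OF lower_central_subgroup a])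
  have "e ?w =\<^sub>p e u + e (a [^] (- e u))" by (rule additive_modD[OF add u p])
  moreover have "e (a [^] (- e u)) =\<^sub>p - e u * e a"
    by (rule additive_mod_int_pow[OF lower_central_subgroup add a])
  moreover have "e a =\<^sub>p 1" using e by (simp add: layer_char_def)
  ultimately have "e ?w =\<^sub>p 0"
    by (rule eqp_combine3[of _ _ _ _ _ _ _ _ 1 1 "- e u"]) (simp add: algebra_simps)
  moreover have "?w \<in> \<gamma> i" by (rule subgroup.m_closed[OF lower_central_subgroup u p])
  ultimately have "?w \<in> S" using e S(3) by (auto simp: layer_char_def)
  then have "?w \<otimes> a [^] e u \<in> S"
    by (rule subgroup.m_closed[OF S(1)]) (rule subgroup_int_pow_closed[OF S(1,2)])
  moreover have "?w \<otimes> a [^] e u = u"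
    using ac uc by (simp add: m_assoc int_pow_neg)
  ultimately show ?thesis by simp
qed

text \<open>\<open>\<gamma> 2\<close> is generated by \<open>a\<close> and
  \<open>\<gamma> 3\<close>, and \<open>a\<close> commutes with itself, so only the two listed kinds
  of commutators remain. This is how a layer of order p at the top pushes \<open>G''\<close>
  down.\<close>

lemma derived_layer_2_subset:
  assumes e: "layer_char 2 e a" and N: "N \<lhd> G"
    and 1: "\<And>v. v \<in> \<gamma> 3 \<Longrightarrow> comm a v \<in> N" and 2: "\<And>u v. u \<in> \<gamma> 3 \<Longrightarrow> v \<in> \<gamma> 3 \<Longrightarrow> comm u v \<in> N"
  shows "derived G (\<gamma> 2) \<subseteq> N"
proof -
  note cc = lower_central_carrier
  have a: "a \<in> \<gamma> 2" and ac: "a \<in> carrier G"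
    using e cc by (auto simp: layer_char_def)
  have C: "subgroup {x \<in> carrier G. \<forall>v\<in>A. comm x v \<in> N} G" if "A \<subseteq> carrier G" for A
    by (rule centralizer_mod_subgroup[OF N that])
  have g3: "\<gamma> (Suc 2) = \<gamma> 3" by simp
  have sub: "\<gamma> i \<subseteq> carrier G" for i using cc by blast
  have one: "\<one> \<in> N" using subgroup.one_closed[OF normal_imp_subgroup[OF N]] .
  have A: "comm u v \<in> N" if u: "u \<in> \<gamma> 2" and v: "v \<in> \<gamma> 3" for u v
  proof -
    have "u \<in> {x \<in> carrier G. \<forall>v\<in>\<gamma> 3. comm x v \<in> N}"
      by (rule layer_char_generate[OF e C[OF sub] _ _ u]) (use 1 2 ac sub in \<open>auto simp: g3 cc\<close>)
    then show ?thesis using v by blast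
  qed
  have B: "comm u a \<in> N" if u: "u \<in> \<gamma> 2" for u
  proof -
    have "u \<in> {x \<in> carrier G. \<forall>v\<in>{a}. comm x v \<in> N}"
      by (rule layer_char_generate[OF e C _ _ u])
        (use ac sub one A[OF a] normal_comm_sym[OF N ac] in \<open>auto simp: g3 cc\<close>)
    then show ?thesis by blast
  qed
  have A': "comm v u \<in> N" if "u \<in> \<gamma> 2" "v \<in> \<gamma> 3" for u v
    using A[OF that] normal_comm_sym[OF N cc cc] that by blast
  have B': "comm a u \<in> N" if "u \<in> \<gamma> 2" for u
    using B[OF that] normal_comm_sym[OF N cc ac] that by blast
  have "comm u v \<in> N" if u: "u \<in> \<gamma> 2" and v: "v \<in> \<gamma> 2" for u v
  proof -
    have "u \<in> {x \<in> carrier G. \<forall>v\<in>\<gamma> 2. comm x v \<in> N}"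
      by (rule layer_char_generate[OF e C[OF sub] _ _ u])
        (use ac A' B' in \<open>auto simp: g3 cc\<close>)
    then show ?thesis using v by blast
  qed
  then show ?thesis
    by (intro derived_subset normal_imp_subgroup[OF N]) auto
qed

end

locale small_second_derived = finite_p_group +
  assumes p_ge_3: "p \<ge> 3"
    and card_derived: "card (\<gamma> 2) = p ^ 3 * card (derived G (\<gamma> 2))"
    and second_derived_nontrivial: "derived G (\<gamma> 2) \<noteq> {\<one>}"
begin

text \<open>All orders are powers of p, the chain from \<open>\<gamma> 2\<close> to
  \<open>\<gamma> 5\<close> is strict, and \<open>G''\<close> lies in \<open>\<gamma> 4\<close> with
  index \<open>p ^ 3\<close> in \<open>\<gamma> 2\<close>. Once \<open>G''\<close> is known to
  differ from \<open>\<gamma> 4\<close>, the exponents are forced.\<close>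

lemma layer_orders:
  "card (\<gamma> 2) = p * card (\<gamma> 3)" "card (\<gamma> 3) = p * card (\<gamma> 4)" "card (\<gamma> 4) = p * card (\<gamma> 5)"
  "derived G (\<gamma> 2) = \<gamma> 5"
proof -
  let ?D = "derived G (\<gamma> 2)"
  have subD: "subgroup ?D G"
    by (rule derived_is_subgroup) (use lower_central_carrier in auto)
  have D4: "?D \<subseteq> \<gamma> 4"
    by (intro derived_subset lower_central_subgroup comm_lcs[where i = 2 and j = 2]) auto
  then have ne4: "\<gamma> 4 \<noteq> {\<one>}"
    using second_derived_nontrivial subgroup.one_closed[OF subD] by auto
  have ne: "\<gamma> k \<noteq> {\<one>}" if "k \<le> 4" for k
    using ne4 lower_central_antimono[OF that] subgroup.one_closed[OF lower_central_subgroup[of 4]] by auto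
  note ps = card_subgroup_psubset[OF lower_central_subgroup lower_central_subgroup]
  have s: "\<gamma> 3 \<subset> \<gamma> 2" "\<gamma> 4 \<subset> \<gamma> 3" "\<gamma> 5 \<subset> \<gamma> 4"
    using lower_central_psubset[of 2] lower_central_psubset[of 3] lower_central_psubset[of 4] ne by auto
  obtain n2 n3 n4 n5 d where c: "card (\<gamma> 2) = p ^ n2" "card (\<gamma> 3) = p ^ n3" "card (\<gamma> 4) = p ^ n4"
    "card (\<gamma> 5) = p ^ n5" "card ?D = p ^ d"
    using card_subgroup[OF lower_central_subgroup] card_subgroup[OF subD] by metis
  have inj: "i = j" if "p ^ i = p ^ j" for i j
    using that p_gt_1 power_inject_exp by blast
  have n: "n3 < n2" "n4 < n3" "n5 < n4"
    using ps[OF s(1)] ps[OF s(2)] ps[OF s(3)] c inj by metis+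
  have "p ^ n2 = p ^ (3 + d)" using card_derived c by (simp add: power_add)
  then have n2: "n2 = 3 + d" by (rule inj)
  \<comment> \<open>An alternating form on a layer of order p vanishes, so \<open>G''\<close> drops
    from \<open>\<gamma> 4\<close> to \<open>\<gamma> 5\<close>.\<close>
  have D5: "?D \<subseteq> \<gamma> 5" if "n2 = Suc n3"
  proof -
    have "card (\<gamma> 2) = p * card (\<gamma> (Suc 2))" using that c by simp
    then obtain e a where e: "layer_char 2 e a" using layer_char_exists[of 2] by auto
    have "a \<in> \<gamma> 2" using e by (simp add: layer_char_def)
    then show ?thesis
      by (intro derived_layer_2_subset[OF e lower_central_normal] comm_lcs[where j = 3])
        (auto intro: comm_lcs)
  qed
  have "?D \<noteq> \<gamma> 4"
  proof
    assume D: "?D = \<gamma> 4"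
    then have "n4 = d" using c inj by metis
    \<comment> \<open>The two ways to distribute \<open>p ^ 3\<close> over two layers: order
      \<open>p ^ 2\<close> on top is excluded by the Jacobi argument, order p on top by
      \<open>D5\<close>.\<close>
    then consider "n3 = Suc d" | "n3 = Suc (Suc d)" using n n2 by linarith
    then show False
    proof cases
      case 1
      have "card (\<gamma> 3) = p * card (\<gamma> 4)" "card (\<gamma> 2) = p ^ 2 * card (\<gamma> 3)"
        using c 1 n2 \<open>n4 = d\<close> by (simp_all add: power_add power2_eq_square power3_eq_cube)
      then show False using first_layer_not_rank_2[OF p_ge_3 _ _ D ne4] by blast
    next
      case 2
      then have "?D \<subseteq> \<gamma> 5" using D5 n2 by simp
      then show False using D s(3) by blast
    qed
  qed
  then have "?D \<subset> \<gamma> 4" using D4 by blast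
  then have "d < n4" using card_subgroup_psubset[OF subD lower_central_subgroup] c inj by metis
  then have n34: "n4 = Suc d" "n3 = Suc (Suc d)" using n n2 by auto
  then have D5': "?D \<subseteq> \<gamma> 5" using D5 n2 by simp
  have "?D = \<gamma> 5"
  proof (rule ccontr)
    assume "?D \<noteq> \<gamma> 5"
    then have "?D \<subset> \<gamma> 5" using D5' by blast
    then have "d < n5" using card_subgroup_psubset[OF subD lower_central_subgroup] c inj by metis
    then show False using n n34 by simp
  qed
  moreover from this have "n5 = d" using c inj by metis
  ultimately show "card (\<gamma> 2) = p * card (\<gamma> 3)" "card (\<gamma> 3) = p * card (\<gamma> 4)"
    "card (\<gamma> 4) = p * card (\<gamma> 5)" "?D = \<gamma> 5"
    using c n2 n34 by (simp_all add: power_add power3_eq_cube)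
qed

end

section \<open>Structure constants\<close>

locale layer_coordinates = small_second_derived +
  fixes e2 e3 e4 e5 :: "'a \<Rightarrow> int" and a b c d :: 'a
  assumes e2: "layer_char 2 e2 a" and e3: "layer_char 3 e3 b" and e4: "layer_char 4 e4 c"
    and c5: "central_char (\<gamma> 5) e5" and d5: "d \<in> \<gamma> 5" "e5 d =\<^sub>p 1"
begin

lemma c2: "central_char (\<gamma> 2) e2" and c3: "central_char (\<gamma> 3) e3" and c4: "central_char (\<gamma> 4) e4"
  using e2 e3 e4 by (auto simp: layer_char_def)

lemma mem_layers: "a \<in> \<gamma> 2" "b \<in> \<gamma> 3" "c \<in> \<gamma> 4"
  using e2 e3 e4 by (auto simp: layer_char_def)

lemma mem_carrier_layers: "a \<in> carrier G" "b \<in> carrier G" "c \<in> carrier G"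
  using mem_layers lower_central_carrier by auto

lemma g1: "\<gamma> 1 = carrier G"
  by simp

text \<open>Modulo the next term of the series, \<open>[x, y] = a\<^sup>B\<close>, \<open>[a, x] = b\<^sup>\<phi>\<close>, \<open>[b, x] = c\<^sup>\<psi>\<close>; the bottom layer \<open>\<gamma>\<^sub>5\<close> is seen only
  through \<open>e5\<close>, whose kernel is identified later.\<close>

definition B :: "'a \<Rightarrow> 'a \<Rightarrow> int" where "B x y = e2 (comm x y)"
definition \<phi> :: "'a \<Rightarrow> int" where "\<phi> x = e3 (comm a x)"
definition \<psi> :: "'a \<Rightarrow> int" where "\<psi> x = e4 (comm b x)"
definition \<chi> :: "'a \<Rightarrow> int" where "\<chi> x = e5 (comm c x)"
definition \<epsilon> :: int where "\<epsilon> = e5 (comm a b)"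

lemma comm_2_2: "u \<in> \<gamma> 2 \<Longrightarrow> v \<in> \<gamma> 2 \<Longrightarrow> comm u v \<in> \<gamma> 5"
  using comm_in_derived layer_orders(4) by blast

lemma e3_comm: "u \<in> \<gamma> 2 \<Longrightarrow> x \<in> carrier G \<Longrightarrow> e3 (comm u x) =\<^sub>p e2 u * \<phi> x"
  unfolding \<phi>_def using layer_char_left[OF e2 c3, of 1 u x] by simp

lemma e4_comm: "u \<in> \<gamma> 3 \<Longrightarrow> x \<in> carrier G \<Longrightarrow> e4 (comm u x) =\<^sub>p e3 u * \<psi> x"
  unfolding \<psi>_def using layer_char_left[OF e3 c4, of 1 u x] by simp

lemma e5_comm: "u \<in> \<gamma> 4 \<Longrightarrow> x \<in> carrier G \<Longrightarrow> e5 (comm u x) =\<^sub>p e4 u * \<chi> x"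
  unfolding \<chi>_def using layer_char_left[OF e4 c5, of 1 u x] by simp

lemma e5_comm_2_3:
  assumes u: "u \<in> \<gamma> 2" and v: "v \<in> \<gamma> 3"
  shows "e5 (comm u v) =\<^sub>p e2 u * e3 v * \<epsilon>"
proof -
  have 1: "e5 (comm u v) =\<^sub>p e2 u * e5 (comm a v)"
    using layer_char_left[OF e2 c5, of 3 u v] u v by simp
  have 2: "e5 (comm a v) =\<^sub>p e3 v * \<epsilon>"
    unfolding \<epsilon>_def using layer_char_right[OF e3 c5, of 2 v a] mem_layers v by simp
  show ?thesis by (rule eqp_combine2[OF 1 2, of _ _ 1 "e2 u"]) (simp add: algebra_simps)
qed

lemma additive_\<psi>: "additive_mod (carrier G) \<psi>"
  unfolding \<psi>_def using comm_right_additive[OF c4, of 1 3 b] mem_layers by simp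

lemma additive_\<chi>: "additive_mod (carrier G) \<chi>"
  unfolding \<chi>_def using comm_right_additive[OF c5, of 1 4 c] mem_layers by simp

lemma comm_3: "u \<in> \<gamma> 2 \<Longrightarrow> x \<in> carrier G \<Longrightarrow> comm u x \<in> \<gamma> 3 \<and> comm x u \<in> \<gamma> 3"
  using comm_lcs[of u 2 x 1 3] comm_lcs[of x 1 u 2 3] by (simp add: g1)

lemma comm_4: "u \<in> \<gamma> 3 \<Longrightarrow> x \<in> carrier G \<Longrightarrow> comm u x \<in> \<gamma> 4 \<and> comm x u \<in> \<gamma> 4"
  using comm_lcs[of u 3 x 1 4] comm_lcs[of x 1 u 3 4] by (simp add: g1)

lemma comm_5: "u \<in> \<gamma> 4 \<Longrightarrow> x \<in> carrier G \<Longrightarrow> comm u x \<in> \<gamma> 5 \<and> comm x u \<in> \<gamma> 5"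
  using comm_lcs[of u 4 x 1 5] comm_lcs[of x 1 u 4 5] by (simp add: g1)

lemma comm_2: "x \<in> carrier G \<Longrightarrow> y \<in> carrier G \<Longrightarrow> comm x y \<in> \<gamma> 2"
  using comm_lcs[of x 1 y 1 2] by (simp add: g1)

text \<open>Jacobi identity for \<open>x, y, a\<close> in weight 4. The term pairing
  \<open>comm x y\<close> with \<open>a\<close> vanishes because \<open>G''\<close> is
  \<open>\<gamma> 5\<close>; the rest says that \<phi> and \<psi> are proportional.\<close>

lemma relation_\<phi>_\<psi>:
  assumes x: "x \<in> carrier G" and y: "y \<in> carrier G"
  shows "\<phi> x * \<psi> y =\<^sub>p \<phi> y * \<psi> x"
proof -
  have j: "e4 (comm (comm x y) a) + e4 (comm (comm y a) x) + e4 (comm (comm a x) y) =\<^sub>p 0"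
    by (rule jacobi_lower_central[OF c4, of 1 1 2]) (use x y mem_layers in simp_all)
  have 1: "e4 (comm (comm x y) a) =\<^sub>p 0"
    by (rule central_char_lower_central_gt[OF _ c4, of 5])
      (use comm_2_2 comm_2 x y mem_layers in auto)
  have 2: "e4 (comm (comm a x) y) =\<^sub>p \<phi> x * \<psi> y"
    unfolding \<phi>_def by (rule e4_comm) (use comm_3 mem_layers x y in auto)
  have 3: "e4 (comm (comm y a) x) =\<^sub>p - \<phi> y * \<psi> x"
  proof -
    have "e4 (comm (comm y a) x) =\<^sub>p e3 (comm y a) * \<psi> x"
      by (rule e4_comm) (use comm_3 mem_layers x y in auto)
    moreover have "e3 (comm y a) =\<^sub>p - \<phi> y"
      unfolding \<phi>_def using comm_sym_lower_central[OF c3, of 2 1 a y] mem_layers y by simp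
    ultimately show ?thesis
      by (rule eqp_combine2[of _ _ _ _ _ _ 1 "\<psi> x"]) (simp add: algebra_simps)
  qed
  have "0 + - \<phi> y * \<psi> x + \<phi> x * \<psi> y =\<^sub>p 0" by (rule eqp_sum3[OF j 1 3 2])
  then show ?thesis by (rule eqp_combine1[of _ _ _ _ 1]) (simp add: algebra_simps)
qed

text \<open>Jacobi identity for \<open>x, y, b\<close> in weight 5. Once \<epsilon> is invertible,
  it bounds the rank of \<open>B\<close> by 2 and places the common kernel of \<psi> and \<chi> in
  its radical.\<close>

lemma relation_B:
  assumes x: "x \<in> carrier G" and y: "y \<in> carrier G"
  shows "\<epsilon> * B x y =\<^sub>p \<psi> y * \<chi> x - \<psi> x * \<chi> y"
proof -
  have j: "e5 (comm (comm x y) b) + e5 (comm (comm y b) x) + e5 (comm (comm b x) y) =\<^sub>p 0"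
    by (rule jacobi_lower_central[OF c5, of 1 1 3]) (use x y mem_layers in simp_all)
  have 1: "e5 (comm (comm x y) b) =\<^sub>p B x y * e3 b * \<epsilon>"
    unfolding B_def by (rule e5_comm_2_3) (use comm_2 x y mem_layers in auto)
  have 2: "e5 (comm (comm b x) y) =\<^sub>p \<psi> x * \<chi> y"
    unfolding \<psi>_def by (rule e5_comm) (use comm_4 mem_layers x y in auto)
  have 3: "e5 (comm (comm y b) x) =\<^sub>p - \<psi> y * \<chi> x"
  proof -
    have "e5 (comm (comm y b) x) =\<^sub>p e4 (comm y b) * \<chi> x"
      by (rule e5_comm) (use comm_4 mem_layers x y in auto)
    moreover have "e4 (comm y b) =\<^sub>p - \<psi> y"
      unfolding \<psi>_def using comm_sym_lower_central[OF c4, of 3 1 b y] mem_layers y by simp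
    ultimately show ?thesis
      by (rule eqp_combine2[of _ _ _ _ _ _ 1 "\<chi> x"]) (simp add: algebra_simps)
  qed
  have 4: "B x y * e3 b * \<epsilon> + - \<psi> y * \<chi> x + \<psi> x * \<chi> y =\<^sub>p 0" by (rule eqp_sum3[OF j 1 3 2])
  have 5: "e3 b =\<^sub>p 1" using e3 by (simp add: layer_char_def)
  show ?thesis
    by (rule eqp_combine2[OF 4 5, of _ _ 1 "- B x y * \<epsilon>"]) (simp add: algebra_simps)
qed

text \<open>A character of \<open>\<gamma> 5\<close>, which is \<open>G''\<close>, is determined at
  \<open>comm a b\<close>: only commutators of \<open>a\<close> with \<open>\<gamma> 3\<close>
  matter, and \<open>f\<close> reads these off the coordinate \<open>e3\<close>.\<close>

lemma central_char_5_zero: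
  assumes f: "central_char (\<gamma> 5) f" and 0: "f (comm a b) =\<^sub>p 0" and u: "u \<in> \<gamma> 5"
  shows "f u =\<^sub>p 0"
proof -
  have "derived G (\<gamma> 2) \<subseteq> {u \<in> \<gamma> 5. f u =\<^sub>p 0}"
  proof (rule derived_layer_2_subset[OF e2 central_char_kernel_normal[OF lower_central_normal f]])
    fix v assume v: "v \<in> \<gamma> 3"
    have "f (comm a v) =\<^sub>p e3 v * f (comm a b)"
      using layer_char_right[OF e3 f, of 2 v a] mem_layers v by simp
    also have "\<dots> =\<^sub>p 0" by (rule eqp_0_mult(2)[OF 0])
    finally show "comm a v \<in> {u \<in> \<gamma> 5. f u =\<^sub>p 0}"
      using comm_lcs[of a 2 v 3 5] mem_layers v by simp
    fix w assume w: "w \<in> \<gamma> 3"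
    have "comm v w \<in> \<gamma> 6" "comm v w \<in> \<gamma> 5"
      using comm_lcs[OF v w] by auto
    then show "comm v w \<in> {u \<in> \<gamma> 5. f u =\<^sub>p 0}"
      using central_char_lower_central_gt[OF _ f, of 6] by simp
  qed
  then show ?thesis using u layer_orders(4) by blast
qed

lemma \<epsilon>_nonzero: "\<not> \<epsilon> =\<^sub>p 0"
  using central_char_5_zero[OF c5 _ d5(1)] d5(2) not_1_eqp_0 eqp_sym eqp_trans
  unfolding \<epsilon>_def by blast

lemma B_nonzero: "\<exists>x\<in>carrier G. \<exists>y\<in>carrier G. \<not> B x y =\<^sub>p 0"
  unfolding B_def using central_char_nontrivial[of 1 e2 a] e2
  by (auto simp: layer_char_def numeral_2_eq_2)

text \<open>For \<open>\<eta> = e6 [a, c]\<close> the Jacobi identities of \<open>(x, a, b)\<close> and \<open>(x, y, c)\<close>, compared with \<open>relation_B\<close>, give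
  \<open>2 \<epsilon> (B x y) \<eta> = 0\<close>.\<close>

lemma lower_central_6: "\<gamma> 6 = {\<one>}"
proof (rule ccontr)
  assume "\<gamma> 6 \<noteq> {\<one>}"
  then obtain e6 d6 where c6: "central_char (\<gamma> 6) e6" and d6: "d6 \<in> \<gamma> 6" "e6 d6 =\<^sub>p 1"
    using central_char_exists[OF lower_central_normal] by blast
  define \<eta> where "\<eta> = e6 (comm a c)"
  define g where "g x = e6 (comm (comm a b) x)" for x
  have g: "g x =\<^sub>p \<psi> x * \<eta>" if x: "x \<in> carrier G" for x
  proof -
    have j: "e6 (comm (comm x a) b) + e6 (comm (comm a b) x) + e6 (comm (comm b x) a) =\<^sub>p 0"
      by (rule jacobi_lower_central[OF c6, of 1 2 3]) (use x mem_layers in simp_all)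
    \<comment> \<open>Modulo \<open>\<gamma> 4\<close>, \<open>comm x a\<close> is a power of
      \<open>b\<close>, and \<open>b\<close> commutes with itself.\<close>
    have 1: "e6 (comm (comm x a) b) =\<^sub>p 0"
    proof -
      have "e6 (comm (comm x a) b) =\<^sub>p e3 (comm x a) * e6 (comm b b)"
        using layer_char_left[OF e3 c6, of 3 "comm x a" b] comm_3 mem_layers x by simp
      also have "\<dots> =\<^sub>p 0"
        using additive_mod_one[OF lower_central_subgroup central_char_additive[OF c6]]
        by (intro eqp_0_mult) (simp add: mem_carrier_layers)
      finally show ?thesis .
    qed
    have 2: "e6 (comm (comm b x) a) =\<^sub>p \<psi> x * e6 (comm c a)"
      unfolding \<psi>_def using layer_char_left[OF e4 c6, of 2 "comm b x" a] comm_4 mem_layers x by simp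
    have 3: "e6 (comm c a) =\<^sub>p - \<eta>"
      unfolding \<eta>_def using comm_sym_lower_central[OF c6, of 2 4 a c] mem_layers by simp
    have 4: "0 + g x + \<psi> x * e6 (comm c a) =\<^sub>p 0"
      unfolding g_def by (rule eqp_sum3[OF j 1 eqp_refl 2])
    show ?thesis by (rule eqp_combine2[OF 4 3, of _ _ 1 "- \<psi> x"]) (simp add: algebra_simps)
  qed
  \<comment> \<open>As functions of \<open>u\<close>, both sides are characters of
    \<open>\<gamma> 5\<close> that agree at \<open>comm a b\<close>. This stands in for a coordinate
    on \<open>\<gamma> 5\<close>, whose order is not yet known.\<close>
  have g5: "\<epsilon> * e6 (comm u x) =\<^sub>p e5 u * g x" if u: "u \<in> \<gamma> 5" and x: "x \<in> carrier G" for u x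
  proof -
    let ?f = "\<lambda>u. \<epsilon> * e6 (comm u x) - e5 u * g x"
    have add: "additive_mod (\<gamma> 5) (\<lambda>u. e6 (comm u x))"
      using comm_left_additive[OF c6, of 5 1 x] x by simp
    have "central_char (\<gamma> 5) ?f"
      unfolding central_char_def additive_mod_def
    proof (intro conjI ballI)
      fix v w assume vw: "v \<in> \<gamma> 5" "w \<in> \<gamma> 5"
      show "?f (v \<otimes> w) =\<^sub>p ?f v + ?f w"
        by (rule eqp_combine2[OF additive_modD[OF add vw] additive_modD[OF central_char_additive[OF c5] vw],
            of _ _ \<epsilon> "- g x"]) (simp add: algebra_simps)
    next
      fix v y assume vy: "v \<in> \<gamma> 5" "y \<in> carrier G"
      have v6: "comm v y \<in> \<gamma> 6" using comm_lcs[of v 5 y 1 6] vy by (simp add: g1)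
      then have "comm (comm v y) x \<in> \<gamma> 7" using comm_lcs[of _ 6 x 1 7] x by (simp add: g1)
      then have 1: "e6 (comm (comm v y) x) =\<^sub>p 0"
        by (intro central_char_lower_central_gt[OF _ c6, of 7]) auto
      have 2: "e5 (comm v y) =\<^sub>p 0" by (rule central_char_comm[OF c5 vy])
      show "?f (comm v y) =\<^sub>p 0"
        by (rule eqp_combine2[OF 1 2, of _ _ \<epsilon> "- g x"]) (simp add: algebra_simps)
    qed
    moreover have "?f (comm a b) =\<^sub>p 0" by (simp add: \<epsilon>_def g_def)
    ultimately have "?f u =\<^sub>p 0" using central_char_5_zero u by blast
    then show ?thesis by (subst eqp_diff_iff)
  qed
  obtain x y where x: "x \<in> carrier G" and y: "y \<in> carrier G" and Bxy: "\<not> B x y =\<^sub>p 0"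
    using B_nonzero by blast
  have j: "e6 (comm (comm x y) c) + e6 (comm (comm y c) x) + e6 (comm (comm c x) y) =\<^sub>p 0"
    by (rule jacobi_lower_central[OF c6, of 1 1 4]) (use x y mem_layers in simp_all)
  have 1: "e6 (comm (comm x y) c) =\<^sub>p B x y * \<eta>"
    unfolding B_def \<eta>_def using layer_char_left[OF e2 c6, of 4 "comm x y" c] comm_2 mem_layers x y by simp
  have 2: "\<epsilon> * e6 (comm (comm c x) y) =\<^sub>p \<chi> x * \<psi> y * \<eta>"
  proof -
    have i: "\<epsilon> * e6 (comm (comm c x) y) =\<^sub>p \<chi> x * g y"
      unfolding \<chi>_def using g5 comm_5 mem_layers x y by blast
    show ?thesis
      by (rule eqp_combine2[OF i g[OF y], of _ _ 1 "\<chi> x"]) (simp add: algebra_simps)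
  qed
  have 3: "\<epsilon> * e6 (comm (comm y c) x) =\<^sub>p - \<chi> y * \<psi> x * \<eta>"
  proof -
    have i: "\<epsilon> * e6 (comm (comm y c) x) =\<^sub>p e5 (comm y c) * g x"
      using g5 comm_5 mem_layers x y by blast
    have ii: "e5 (comm y c) =\<^sub>p - \<chi> y"
      unfolding \<chi>_def using comm_sym_lower_central[OF c5, of 4 1 c y] mem_layers y by simp
    show ?thesis
      by (rule eqp_combine3[OF i ii g[OF x], of _ _ 1 "g x" "- \<chi> y"]) (simp add: algebra_simps)
  qed
  have 4: "\<epsilon> * e6 (comm (comm x y) c) + \<epsilon> * e6 (comm (comm y c) x) + \<epsilon> * e6 (comm (comm c x) y) =\<^sub>p 0"
    using eqp_mult[OF eqp_refl[of \<epsilon>] j] by (simp add: algebra_simps)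
  have 5: "\<epsilon> * B x y * \<eta> + - \<chi> y * \<psi> x * \<eta> + \<chi> x * \<psi> y * \<eta> =\<^sub>p 0"
    by (rule eqp_sum3[OF 4 _ 3 2]) (use eqp_mult[OF eqp_refl[of \<epsilon>] 1] in \<open>simp add: algebra_simps\<close>)
  have "2 * (\<epsilon> * B x y * \<eta>) =\<^sub>p 0"
    by (rule eqp_combine2[OF 5 relation_B[OF x y], of _ _ 1 \<eta>]) (simp add: algebra_simps)
  then have "\<epsilon> * B x y * \<eta> =\<^sub>p 0" by (rule eqp_double_0[OF _ p_ge_3])
  then have \<eta>: "\<eta> =\<^sub>p 0" using eqp_mult_0 \<epsilon>_nonzero Bxy by blast
  have "e6 (comm u z) =\<^sub>p 0" if u: "u \<in> \<gamma> 5" and z: "z \<in> carrier G" for u z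
  proof -
    have "\<epsilon> * e6 (comm u z) =\<^sub>p 0"
      by (rule eqp_combine3[OF g5[OF u z] g[OF z] \<eta>, of _ _ 1 "e5 u" "e5 u * \<psi> z"])
        (simp add: algebra_simps)
    then show ?thesis using eqp_mult_0 \<epsilon>_nonzero by blast
  qed
  then show False using central_char_nontrivial[of 5 e6 d6] c6 d6 by auto
qed

lemma lower_central_5_central: "u \<in> \<gamma> 5 \<Longrightarrow> x \<in> carrier G \<Longrightarrow> comm u x = \<one>"
  using comm_lcs[of u 5 x 1 6] lower_central_6 by (simp add: g1)

lemma comm_a_b_pow: "comm a (b [^] (k::nat)) = comm a b [^] k"
proof (induction k)
  case (Suc k)
  have "comm a b \<in> \<gamma> 5" using comm_2_2[of a b] mem_layers lower_central_antimono[of 2 3] by auto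
  then have "b [^] k \<otimes> comm a b \<otimes> inv (b [^] k) = comm a b"
    using mem_carrier_layers lower_central_5_central[of "comm a b" "b [^] k"]
    by (simp add: comm_eq_one_iff m_assoc)
      (metis comm_closed inv_closed m_assoc nat_pow_closed r_inv r_one)
  then show ?case
    using mem_carrier_layers Suc by (simp add: comm_mult_right)
qed (simp add: mem_carrier_layers)

text \<open>With \<open>\<gamma> 6\<close> trivial, \<open>\<gamma> 5\<close> is generated by the
  central element \<open>comm a b\<close>. Its p-th power is \<open>comm a (b [^] p)\<close>, and
  \<open>b [^] p\<close> lies in \<open>\<gamma> 4\<close>, so this commutator lies in
  \<open>\<gamma> 6\<close>. Thus \<open>\<gamma> 5\<close> has order p.\<close>

lemma e5_exact:
  assumes u: "u \<in> \<gamma> 5" and 0: "e5 u =\<^sub>p 0"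
  shows "u = \<one>"
proof -
  let ?x = "comm a b"
  have x5: "?x \<in> \<gamma> 5" using comm_lcs[of a 2 b 3 5] mem_layers by simp
  have xc: "?x \<in> carrier G" using mem_carrier_layers by simp
  \<comment> \<open>The cyclic group generated by \<open>?x\<close>, written over the trivial
    subgroup so that \<open>cyclic_extension_normal\<close> applies.\<close>
  let ?N = "{?x [^] (i::int) \<otimes> m | i m. m \<in> {\<one>}}"
  have N: "?N \<lhd> G"
    by (rule cyclic_extension_normal[OF one_is_normal xc]) (simp add: lower_central_5_central[OF x5])
  note subN = normal_imp_subgroup[OF N]
  have one: "\<one> \<in> ?N" by (rule subgroup.one_closed[OF subN])
  have c6: "comm v w \<in> ?N" if "v \<in> \<gamma> i" "w \<in> \<gamma> j" "6 \<le> i + j" for v w i j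
    using comm_lcs[OF that] lower_central_6 one by simp
  have "derived G (\<gamma> 2) \<subseteq> ?N"
  proof (rule derived_layer_2_subset[OF e2 N])
    fix v assume v: "v \<in> \<gamma> 3"
    have "v \<in> {x \<in> carrier G. \<forall>y\<in>{a}. comm x y \<in> ?N}"
    proof (rule layer_char_generate[OF e3 _ _ _ v])
      show "subgroup {x \<in> carrier G. \<forall>y\<in>{a}. comm x y \<in> ?N} G"
        by (rule centralizer_mod_subgroup[OF N]) (simp add: mem_carrier_layers)
      have "?x = ?x [^] (1::int) \<otimes> \<one>" using xc by simp
      then have "?x \<in> ?N" by blast
      then have "comm b a \<in> ?N"
        using normal_comm_sym[OF N mem_carrier_layers(1,2)] by blast
      then show "b \<in> {x \<in> carrier G. \<forall>y\<in>{a}. comm x y \<in> ?N}"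
        using mem_carrier_layers by blast
      show "\<gamma> (Suc 3) \<subseteq> {x \<in> carrier G. \<forall>y\<in>{a}. comm x y \<in> ?N}"
        using c6[of _ 4 a 2] mem_layers lower_central_carrier by auto
    qed
    then have "comm v a \<in> ?N" by blast
    then show "comm a v \<in> ?N"
      using normal_comm_sym[OF N lower_central_carrier[OF v] mem_carrier_layers(1)] by blast
    fix w assume "w \<in> \<gamma> 3"
    then show "comm v w \<in> ?N" using c6 v by auto
  qed
  then obtain i :: int where i: "u = ?x [^] i" using u layer_orders(4) xc by auto
  have "e5 u =\<^sub>p i * \<epsilon>"
    unfolding i \<epsilon>_def
    by (rule additive_mod_int_pow[OF lower_central_subgroup central_char_additive[OF c5] x5])
  then have "i * \<epsilon> =\<^sub>p 0" using 0 eqp_sym eqp_trans by blast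
  then have "i =\<^sub>p 0" using eqp_mult_0 \<epsilon>_nonzero by blast
  then obtain k where k: "i = int p * k" by (auto simp: eqp_0_iff)
  have "e3 (b [^] p) =\<^sub>p int p * e3 b"
    by (rule additive_mod_nat_pow[OF lower_central_subgroup central_char_additive[OF c3] mem_layers(2)])
  then have "e3 (b [^] p) =\<^sub>p 0"
    using eqp_0_mult(1)[of "int p" "e3 b"] by (meson dvd_refl eqp_0_iff eqp_trans)
  moreover have "b [^] p \<in> \<gamma> 3"
    using subgroup_int_pow_closed[OF lower_central_subgroup mem_layers(2), of "int p"]
    by (simp add: int_pow_int)
  ultimately have "b [^] p \<in> \<gamma> 4" using e3 by (auto simp: layer_char_def)
  then have "comm a (b [^] p) = \<one>"
    using comm_lcs[of a 2 "b [^] p" 4 6] mem_layers lower_central_6 by simp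
  then have "?x [^] int p = \<one>" by (simp add: comm_a_b_pow int_pow_int)
  then have "?x [^] (int p * k) = \<one>"
    using xc by (metis int_pow_one int_pow_pow)
  then show ?thesis using i k by simp
qed

end

section \<open>Generators modulo a central section\<close>

context finite_p_group
begin

text \<open>For entries in the radical, commutators lie deeper than the weights predict;
  \<open>m\<close>, \<open>o'\<close> and \<open>q\<close> record the actual depths.\<close>

lemma jacobi_filtered:
  assumes e: "central_char (\<gamma> k) e" and k: "k \<noteq> 0"
    and x: "x \<in> \<gamma> i" and y: "y \<in> \<gamma> j" and z: "z \<in> \<gamma> l"
    and xy: "comm x y \<in> \<gamma> m" and yz: "comm y z \<in> \<gamma> o'" and zx: "comm z x \<in> \<gamma> q"
    and le: "k \<le> m + l" "k \<le> o' + i" "k \<le> q + j" and less: "k < m + o'" "k < o' + q" "k < q + m"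
  shows "e (comm (comm x y) z) + e (comm (comm y z) x) + e (comm (comm z x) y) =\<^sub>p 0"
proof (rule jacobi[OF lower_central_normal e])
  show "x \<in> carrier G" "y \<in> carrier G" "z \<in> carrier G"
    using x y z lower_central_carrier by blast+
  show "comm (comm x y) z \<in> \<gamma> k" "comm (comm y z) x \<in> \<gamma> k" "comm (comm z x) y \<in> \<gamma> k"
    using comm_lcs[OF xy z le(1)] comm_lcs[OF yz x le(2)] comm_lcs[OF zx y le(3)] by auto
  have s: "e u =\<^sub>p 0" if "u \<in> \<gamma> h" "k < h" for u h
    using central_char_lower_central_gt[OF k e that(2,1)] .
  show "comm (comm x y) (comm y z) \<in> \<gamma> k" "comm (comm y z) (comm z x) \<in> \<gamma> k"
    "comm (comm z x) (comm x y) \<in> \<gamma> k"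
    using comm_lcs[OF xy yz, of k] comm_lcs[OF yz zx, of k] comm_lcs[OF zx xy, of k] less by auto
  show "e (comm (comm x y) (comm y z)) =\<^sub>p 0" "e (comm (comm y z) (comm z x)) =\<^sub>p 0"
    "e (comm (comm z x) (comm x y)) =\<^sub>p 0"
    using s[OF comm_lower_central[OF xy yz] less(1)] s[OF comm_lower_central[OF yz zx] less(2)]
      s[OF comm_lower_central[OF zx xy] less(3)] by auto
qed

lemma additive_mod_mult_pow:
  assumes S: "subgroup S G" and f: "additive_mod S f" and x: "x \<in> S" and g: "g \<in> S"
  shows "x \<otimes> g [^] (i::int) \<in> S \<and> f (x \<otimes> g [^] i) =\<^sub>p f x + i * f g"
proof
  have p: "g [^] i \<in> S" by (rule subgroup_int_pow_closed[OF S g])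
  show "x \<otimes> g [^] i \<in> S" by (rule subgroup.m_closed[OF S x p])
  have "f (x \<otimes> g [^] i) =\<^sub>p f x + f (g [^] i)" by (rule additive_modD[OF f x p])
  also have "\<dots> =\<^sub>p f x + i * f g" by (rule eqp_add[OF eqp_refl additive_mod_int_pow[OF S f g]])
  finally show "f (x \<otimes> g [^] i) =\<^sub>p f x + i * f g" .
qed

lemma additive_mod_solve:
  assumes S: "subgroup S G" and f: "additive_mod S f" and x: "x \<in> S" and g: "g \<in> S"
    and fg: "\<not> f g =\<^sub>p 0"
  shows "\<exists>i::int. x \<otimes> g [^] i \<in> S \<and> f (x \<otimes> g [^] i) =\<^sub>p 0"
proof -
  obtain m where m: "f g * m =\<^sub>p 1" using eqp_invertible[OF fg] by blast
  let ?i = "- m * f x"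
  have "f (x \<otimes> g [^] ?i) =\<^sub>p f x + ?i * f g"
    using additive_mod_mult_pow[OF S f x g] by blast
  then have "f (x \<otimes> g [^] ?i) =\<^sub>p 0"
    by (rule eqp_combine2[OF _ m, of _ _ _ _ 1 "- f x"]) (simp add: algebra_simps)
  then show ?thesis using additive_mod_mult_pow[OF S f x g] by blast
qed

text \<open>One linear form costs at most one generator: the kernel together with \<open>g\<close>
  generates \<open>S\<close>, with \<open>g = \<one>\<close> allowed when the form is zero.\<close>

lemma additive_mod_kernel_generator:
  assumes S: "subgroup S G" and f: "additive_mod S f"
  shows "\<exists>g\<in>S. \<forall>x\<in>S. \<exists>i::int. x \<otimes> g [^] i \<in> S \<and> f (x \<otimes> g [^] i) =\<^sub>p 0"
proof (cases "\<forall>x\<in>S. f x =\<^sub>p 0")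
  case True
  then have "x \<otimes> \<one> [^] (0::int) \<in> S \<and> f (x \<otimes> \<one> [^] (0::int)) =\<^sub>p 0" if "x \<in> S" for x
    using that subgroup.mem_carrier[OF S that] by simp
  then show ?thesis using subgroup.one_closed[OF S] by blast
next
  case False
  then show ?thesis using additive_mod_solve[OF S f] by blast
qed

lemma subgroup_mult_pow_cancel:
  assumes "subgroup L G" "x \<otimes> g [^] (i::int) \<in> L" "g \<in> L" "x \<in> carrier G"
  shows "x \<in> L"
proof -
  have gc: "g \<in> carrier G" by (rule subgroup.mem_carrier[OF assms(1,3)])
  have "x \<otimes> g [^] i \<otimes> g [^] (- i) \<in> L"
    by (rule subgroup.m_closed[OF assms(1,2) subgroup_int_pow_closed[OF assms(1,3)]])
  then show ?thesis using gc assms(4) by (simp add: m_assoc int_pow_neg)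
qed

end

section \<open>The radical of the commutator form and a dual pair outside it\<close>

locale layer_generators = layer_coordinates +
  fixes s t :: 'a
  assumes s: "s \<in> carrier G" "\<psi> s =\<^sub>p 0" "\<chi> s =\<^sub>p 1"
    and t: "t \<in> carrier G" "\<psi> t =\<^sub>p 1" "\<chi> t =\<^sub>p 0"
begin

text \<open>By \<open>relation_B\<close> this is the radical of \<open>B\<close>, described by the
  two forms to which \<open>s\<close> and \<open>t\<close> are dual.\<close>

definition R :: "'a set" where "R = {r \<in> carrier G. \<psi> r =\<^sub>p 0 \<and> \<chi> r =\<^sub>p 0}"

lemma R_carrier: "r \<in> R \<Longrightarrow> r \<in> carrier G"
  by (simp add: R_def)

lemma R_subgroup: "subgroup R G"
proof -
  have "R = {r \<in> carrier G. \<psi> r =\<^sub>p 0} \<inter> {r \<in> carrier G. \<chi> r =\<^sub>p 0}" by (auto simp: R_def)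
  then show ?thesis
    by (simp add: subgroups_Inter_pair additive_mod_kernel_subgroup subgroup_self additive_\<psi> additive_\<chi>)
qed

lemma B_s_t: "\<epsilon> * B s t =\<^sub>p 1"
  by (rule eqp_combine3[OF relation_B[OF s(1) t(1)] eqp_mult[OF t(2) s(3)] eqp_mult[OF s(2) t(3)],
      of _ _ 1 1 "-1"]) (simp add: algebra_simps)

lemma \<phi>_eq: "x \<in> carrier G \<Longrightarrow> \<phi> x =\<^sub>p \<phi> t * \<psi> x"
  by (rule eqp_combine2[OF relation_\<phi>_\<psi>[OF _ t(1)] t(2), of x _ _ 1 "- \<phi> x"])
    (simp_all add: algebra_simps)

lemma \<phi>_t_nonzero: "\<not> \<phi> t =\<^sub>p 0"
proof -
  obtain v x where vx: "v \<in> \<gamma> 2" "x \<in> carrier G" "\<not> e3 (comm v x) =\<^sub>p 0"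
    using central_char_nontrivial[of 2 e3 b] e3 by (auto simp: layer_char_def)
  show ?thesis
  proof
    assume 0: "\<phi> t =\<^sub>p 0"
    have "e3 (comm v x) =\<^sub>p 0"
      by (rule eqp_combine3[OF e3_comm[OF vx(1,2)] \<phi>_eq[OF vx(2)] 0, of _ _ 1 "e2 v" "e2 v * \<psi> x"])
        (simp add: algebra_simps)
    then show False using vx by blast
  qed
qed

lemma \<phi>_zero: "x \<in> carrier G \<Longrightarrow> \<psi> x =\<^sub>p 0 \<Longrightarrow> \<phi> x =\<^sub>p 0"
  by (rule eqp_trans[OF \<phi>_eq eqp_0_mult(2)])

text \<open>As \<phi> is a multiple of \<psi>, the condition on \<psi> also makes \<phi> vanish,
  which gains one step over the expected \<open>\<gamma> 3\<close>.\<close>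

lemma comm_2_4: "u \<in> \<gamma> 2 \<Longrightarrow> x \<in> carrier G \<Longrightarrow> \<psi> x =\<^sub>p 0 \<Longrightarrow> comm u x \<in> \<gamma> 4 \<and> comm x u \<in> \<gamma> 4"
proof -
  assume u: "u \<in> \<gamma> 2" and x: "x \<in> carrier G" and 0: "\<psi> x =\<^sub>p 0"
  have "e3 (comm u x) =\<^sub>p 0"
    using e3_comm[OF u x] eqp_0_mult(2)[OF \<phi>_zero[OF x 0]] eqp_trans by blast
  then have "comm u x \<in> \<gamma> 4" using e3 comm_3[OF u x] by (auto simp: layer_char_def)
  then show ?thesis
    using normal_comm_sym[OF lower_central_normal lower_central_carrier[OF u] x] by blast
qed

lemma comm_3_R: "u \<in> \<gamma> 3 \<Longrightarrow> r \<in> R \<Longrightarrow> comm u r \<in> \<gamma> 5 \<and> comm r u \<in> \<gamma> 5"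
proof -
  assume u: "u \<in> \<gamma> 3" and r: "r \<in> R"
  have rc: "r \<in> carrier G" "\<psi> r =\<^sub>p 0" using r by (auto simp: R_def)
  have "e4 (comm u r) =\<^sub>p 0"
    using e4_comm[OF u rc(1)] eqp_0_mult(2)[OF rc(2)] eqp_trans by blast
  then have "comm u r \<in> \<gamma> 5" using e4 comm_4[OF u rc(1)] by (auto simp: layer_char_def)
  then show ?thesis
    using normal_comm_sym[OF lower_central_normal lower_central_carrier[OF u] rc(1)] by blast
qed

lemma e5_comm_4_R: "u \<in> \<gamma> 4 \<Longrightarrow> r \<in> R \<Longrightarrow> e5 (comm u r) =\<^sub>p 0"
  using e5_comm[of u r] eqp_0_mult(2)[of "\<chi> r"] eqp_trans by (auto simp: R_def)

lemma comm_R: "r \<in> R \<Longrightarrow> x \<in> carrier G \<Longrightarrow> comm r x \<in> \<gamma> 3 \<and> comm x r \<in> \<gamma> 3"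
proof -
  assume r: "r \<in> R" and x: "x \<in> carrier G"
  have rc: "r \<in> carrier G" "\<psi> r =\<^sub>p 0" "\<chi> r =\<^sub>p 0" using r by (auto simp: R_def)
  have "\<epsilon> * B r x =\<^sub>p 0"
    by (rule eqp_combine3[OF relation_B[OF rc(1) x] rc(2,3), of _ _ 1 "- \<chi> x" "\<psi> x"])
      (simp add: algebra_simps)
  then have "e2 (comm r x) =\<^sub>p 0" using eqp_mult_0 \<epsilon>_nonzero unfolding B_def by blast
  then have "comm r x \<in> \<gamma> 3"
    using e2 comm_2[OF rc(1) x] by (auto simp: layer_char_def)
  then show ?thesis
    using normal_comm_sym[OF lower_central_normal rc(1) x] by blast
qed

lemma lower_central_2_subset_R: "\<gamma> 2 \<subseteq> R"
proof
  fix u assume u: "u \<in> \<gamma> 2"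
  have "comm b u \<in> \<gamma> 5" "comm c u \<in> \<gamma> 6" using comm_lcs mem_layers u by auto
  then have "\<psi> u =\<^sub>p 0" "\<chi> u =\<^sub>p 0"
    using central_char_lower_central_gt[OF _ c4, of 5] central_char_lower_central_gt[OF _ c5, of 6]
    by (auto simp: \<psi>_def \<chi>_def)
  then show "u \<in> R" using lower_central_carrier[OF u] by (simp add: R_def)
qed

text \<open>With \<open>\<alpha> = e3 [r, s]\<close> and \<open>u = [s, t]\<close>, the Jacobi identity of \<open>(r, s, t)\<close> gives \<open>e4 [u, r] = - \<alpha>\<close>, and then that
  of \<open>(u, s, r)\<close> gives \<open>2 \<alpha> = 0\<close>.\<close>

lemma comm_R_s: "r \<in> R \<Longrightarrow> comm r s \<in> \<gamma> 4 \<and> comm s r \<in> \<gamma> 4"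
proof -
  assume r: "r \<in> R"
  have rc: "r \<in> carrier G" "\<psi> r =\<^sub>p 0" "\<chi> r =\<^sub>p 0" using r by (auto simp: R_def)
  define u where "u = comm s t"
  have u: "u \<in> \<gamma> 2" unfolding u_def by (rule comm_2[OF s(1) t(1)])
  have uc: "u \<in> carrier G" by (rule lower_central_carrier[OF u])
  have rs: "comm r s \<in> \<gamma> 3" "comm s r \<in> \<gamma> 3" and tr: "comm t r \<in> \<gamma> 3"
    using comm_R r s t by auto
  have ur: "comm u r \<in> \<gamma> 4" "comm r u \<in> \<gamma> 4" using comm_2_4 u rc by auto
  have us: "comm u s \<in> \<gamma> 4" using comm_2_4 u s by auto
  \<comment> \<open>Weights alone put \<open>comm u r\<close> only into \<open>\<gamma> 3\<close>;
    it lies in \<open>\<gamma> 4\<close> because \<psi> vanishes at \<open>r\<close>. Hence the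
    general form \<open>jacobi\<close> is used.\<close>
  have j: "e4 (comm (comm r s) t) + e4 (comm (comm s t) r) + e4 (comm (comm t r) s) =\<^sub>p 0"
  proof -
    have "comm (comm s t) r \<in> \<gamma> 4" using ur by (simp add: u_def)
    moreover have "e4 v =\<^sub>p 0 \<and> v \<in> \<gamma> 4" if "v \<in> \<gamma> 5" for v
      using that central_char_lower_central_gt[OF _ c4, of 5] lower_central_antimono[of 4 5] by auto
    ultimately show ?thesis
      using comm_lcs[OF rs(1) u, of 5] comm_lcs[OF u tr, of 5] comm_lcs[OF tr rs(1), of 5]
        comm_4[OF rs(1) t(1)] comm_4[OF tr s(1)] rc s t
      by (intro jacobi[OF lower_central_normal c4]) (auto simp: u_def)
  qed
  have 1: "e4 (comm (comm r s) t) =\<^sub>p e3 (comm r s) * \<psi> t" by (rule e4_comm[OF rs(1) t(1)])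
  have 2: "e4 (comm (comm t r) s) =\<^sub>p e3 (comm t r) * \<psi> s" by (rule e4_comm[OF tr s(1)])
  have 3: "e3 (comm r s) * \<psi> t + e4 (comm u r) + e3 (comm t r) * \<psi> s =\<^sub>p 0"
    by (rule eqp_sum3[OF j 1 _ 2]) (simp add: u_def)
  have 4: "e4 (comm u r) =\<^sub>p - e3 (comm r s)"
    by (rule eqp_combine3[OF 3 t(2) s(2), of _ _ 1 "- e3 (comm r s)" "- e3 (comm t r)"])
      (simp add: algebra_simps)
  have j': "e5 (comm (comm u s) r) + e5 (comm (comm s r) u) + e5 (comm (comm r u) s) =\<^sub>p 0"
    by (rule jacobi_filtered[OF c5 _ u, of s 1 r 1 4 3 4]) (use s rc us rs ur in simp_all)
  have 5: "e5 (comm (comm u s) r) =\<^sub>p 0" by (rule e5_comm_4_R[OF us r])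
  have 6: "e5 (comm (comm s r) u) =\<^sub>p - (B s t * e3 (comm s r) * \<epsilon>)"
  proof -
    have "e5 (comm (comm s r) u) =\<^sub>p - e5 (comm u (comm s r))"
      using comm_sym_lower_central[OF c5, of 2 3 u "comm s r"] u rs by simp
    also have "\<dots> =\<^sub>p - (B s t * e3 (comm s r) * \<epsilon>)"
      unfolding B_def u_def[symmetric] by (rule eqp_minus[OF e5_comm_2_3[OF u rs(2)]])
    finally show ?thesis .
  qed
  have 7: "e5 (comm (comm r u) s) =\<^sub>p e4 (comm r u) * \<chi> s" by (rule e5_comm[OF ur(2) s(1)])
  have 8: "0 + - (B s t * e3 (comm s r) * \<epsilon>) + e4 (comm r u) * \<chi> s =\<^sub>p 0"
    by (rule eqp_sum3[OF j' 5 6 7])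
  have 9: "e3 (comm s r) =\<^sub>p - e3 (comm r s)"
    by (rule central_char_comm_sym[OF lower_central_normal c3 rc(1) s(1) rs(1)])
  have 10: "e4 (comm r u) =\<^sub>p - e4 (comm u r)"
    by (rule central_char_comm_sym[OF lower_central_normal c4 uc rc(1) ur(1)])
  have 11: "e4 (comm r u) =\<^sub>p e3 (comm r s)"
    by (rule eqp_combine2[OF 10 4, of _ _ 1 "-1"]) simp
  have 12: "- (B s t * e3 (comm s r) * \<epsilon>) + e4 (comm r u) =\<^sub>p 0"
    by (rule eqp_combine2[OF 8 s(3), of _ _ 1 "- e4 (comm r u)"]) (simp add: algebra_simps)
  have 13: "- e3 (comm s r) + e4 (comm r u) =\<^sub>p 0"
    by (rule eqp_combine2[OF 12 B_s_t, of _ _ 1 "e3 (comm s r)"]) (simp add: algebra_simps)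
  have "2 * e3 (comm r s) =\<^sub>p 0"
    by (rule eqp_combine3[OF 13 9 11, of _ _ 1 1 "-1"]) (simp add: algebra_simps)
  then have "e3 (comm r s) =\<^sub>p 0" by (rule eqp_double_0[OF _ p_ge_3])
  then have "comm r s \<in> \<gamma> 4" using e3 rs by (auto simp: layer_char_def)
  then show ?thesis
    using normal_comm_sym[OF lower_central_normal rc(1) s(1)] by blast
qed

text \<open>Two Jacobi identities, each gaining one step: with \<open>t\<close> in weight 4, where
  \<psi> is 1 at \<open>t\<close>, and with \<open>s\<close> in weight 5, where \<chi> is 1 at
  \<open>s\<close>. The other terms vanish by the action of \<open>R\<close> on the lower layers;
  the second identity relies on \<open>comm_R_s\<close>.\<close>

lemma comm_R_R: "r \<in> R \<Longrightarrow> x \<in> R \<Longrightarrow> comm r x \<in> \<gamma> 5"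
proof -
  assume r: "r \<in> R" and x: "x \<in> R"
  note rc = R_carrier[OF r] and xc = R_carrier[OF x]
  have rx: "comm r x \<in> \<gamma> 3" and xt: "comm x t \<in> \<gamma> 3" and tr: "comm t r \<in> \<gamma> 3"
    using comm_R r x t rc xc by auto
  have j: "e4 (comm (comm r x) t) + e4 (comm (comm x t) r) + e4 (comm (comm t r) x) =\<^sub>p 0"
    by (rule jacobi_filtered[OF c4 _ _ _ _ rx xt tr, of 1 1 1]) (use rc xc t in simp_all)
  have 0: "e4 v =\<^sub>p 0" if "v \<in> \<gamma> 5" for v
    using that central_char_lower_central_gt[OF _ c4, of 5] by auto
  have "e3 (comm r x) * \<psi> t + 0 + 0 =\<^sub>p 0"
    by (rule eqp_sum3[OF j e4_comm[OF rx t(1)] 0 0]) (use comm_3_R xt tr r x in auto)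
  then have "e3 (comm r x) =\<^sub>p 0"
    by (rule eqp_combine2[OF _ t(2), of _ _ _ _ 1 "- e3 (comm r x)"]) (simp add: algebra_simps)
  then have rx4: "comm r x \<in> \<gamma> 4" using e3 rx by (auto simp: layer_char_def)
  have xs: "comm x s \<in> \<gamma> 4" and sr: "comm s r \<in> \<gamma> 4" using comm_R_s r x by auto
  have j': "e5 (comm (comm r x) s) + e5 (comm (comm x s) r) + e5 (comm (comm s r) x) =\<^sub>p 0"
    by (rule jacobi_filtered[OF c5 _ _ _ _ rx4 xs sr, of 1 1 1]) (use rc xc s in simp_all)
  have "e4 (comm r x) * \<chi> s + 0 + 0 =\<^sub>p 0"
    by (rule eqp_sum3[OF j' e5_comm[OF rx4 s(1)] e5_comm_4_R[OF xs r] e5_comm_4_R[OF sr x]])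
  then have "e4 (comm r x) =\<^sub>p 0"
    by (rule eqp_combine2[OF _ s(3), of _ _ _ _ 1 "- e4 (comm r x)"]) (simp add: algebra_simps)
  then show ?thesis using e4 rx4 by (auto simp: layer_char_def)
qed

lemma generate_s_t_R:
  assumes L: "subgroup L G" "s \<in> L" "t \<in> L" "R \<subseteq> L" and x: "x \<in> carrier G"
  shows "x \<in> L"
proof -
  let ?y = "x \<otimes> t [^] (- \<psi> x)"
  let ?r = "?y \<otimes> s [^] (- \<chi> x)"
  have yc: "?y \<in> carrier G" using x t by simp
  have f: "f ?r =\<^sub>p f x - \<psi> x * f t - \<chi> x * f s" if "additive_mod (carrier G) f" for f
  proof -
    note m = additive_mod_mult_pow[OF subgroup_self that, THEN conjunct2]
    show ?thesis
      by (rule eqp_combine2[OF m[OF yc s(1), of "- \<chi> x"] m[OF x t(1), of "- \<psi> x"], of _ _ 1 1])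
        (simp add: algebra_simps)
  qed
  have "\<psi> ?r =\<^sub>p 0"
    by (rule eqp_combine3[OF f[OF additive_\<psi>] t(2) s(2), of _ _ 1 "- \<psi> x" "- \<chi> x"])
      (simp add: algebra_simps)
  moreover have "\<chi> ?r =\<^sub>p 0"
    by (rule eqp_combine3[OF f[OF additive_\<chi>] t(3) s(3), of _ _ 1 "- \<psi> x" "- \<chi> x"])
      (simp add: algebra_simps)
  moreover have "?r \<in> carrier G" using x s t by simp
  ultimately have "?r \<in> L" using L(4) by (auto simp: R_def)
  then have "?y \<in> L" using subgroup_mult_pow_cancel[OF L(1) _ L(2) yc] by blast
  then show ?thesis using subgroup_mult_pow_cancel[OF L(1) _ L(3) x] by blast
qed

text \<open>Modulo \<open>\<gamma> 5\<close> the elements of \<open>R\<close> commute with each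
  other, so only \<open>s\<close> and \<open>t\<close> have to be tested.\<close>

lemma central_mod_5I:
  assumes r: "r \<in> R" and "comm r s \<in> \<gamma> 5" "comm r t \<in> \<gamma> 5" and x: "x \<in> carrier G"
  shows "comm r x \<in> \<gamma> 5"
proof -
  note rc = R_carrier[OF r]
  note sym = normal_comm_sym[OF lower_central_normal rc]
  have "x \<in> {x \<in> carrier G. \<forall>y\<in>{r}. comm x y \<in> \<gamma> 5}"
    by (rule generate_s_t_R[OF centralizer_mod_subgroup[OF lower_central_normal] _ _ _ x])
      (use assms rc s t sym comm_R_R[OF _ r] R_carrier in auto)
  then show ?thesis using sym[OF x] by blast
qed

text \<open>Three forms lead from \<open>R\<close> down to the preimage of the centre:
  \<open>e3\<close> and \<open>e4\<close> of the commutator with \<open>t\<close>, then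
  \<open>e4\<close> of the commutator with \<open>s\<close>. The first two are detected by
  \<open>a\<close> and \<open>b\<close> in \<open>\<gamma> 2\<close>, as \<phi> and \<psi> do not
  vanish at \<open>t\<close>; only the third may need a new element.\<close>

lemma third_generator:
  "\<exists>r\<in>carrier G. \<forall>L. subgroup L G \<longrightarrow> s \<in> L \<longrightarrow> t \<in> L \<longrightarrow> r \<in> L \<longrightarrow> \<gamma> 2 \<subseteq> L \<longrightarrow>
     {y \<in> carrier G. \<forall>x\<in>carrier G. comm y x \<in> \<gamma> 5} \<subseteq> L \<longrightarrow> L = carrier G"
proof -
  have sub: "subgroup {r \<in> R. comm r t \<in> \<gamma> k} G" for k
  proof -
    have "subgroup (R \<inter> {x \<in> carrier G. \<forall>y\<in>{t}. comm x y \<in> \<gamma> k}) G"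
      by (rule subgroups_Inter_pair[OF R_subgroup centralizer_mod_subgroup[OF lower_central_normal]])
        (simp add: t)
    moreover have "R \<inter> {x \<in> carrier G. \<forall>y\<in>{t}. comm x y \<in> \<gamma> k} = {r \<in> R. comm r t \<in> \<gamma> k}"
      using R_carrier by auto
    ultimately show ?thesis by simp
  qed
  let ?R1 = "{r \<in> R. comm r t \<in> \<gamma> 4}" and ?R2 = "{r \<in> R. comm r t \<in> \<gamma> 5}"
  have Rc: "R \<subseteq> carrier G" using R_carrier by auto
  have f3: "additive_mod R (\<lambda>r. e3 (comm r t))"
    by (rule central_char_comm_left[OF lower_central_normal c3 Rc t(1)]) (use comm_R t in blast)
  have f4: "additive_mod ?R1 (\<lambda>r. e4 (comm r t))"
    by (rule central_char_comm_left[OF lower_central_normal c4 _ t(1)]) (use Rc in auto)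
  have f5: "additive_mod ?R2 (\<lambda>r. e4 (comm r s))"
    by (rule central_char_comm_left[OF lower_central_normal c4 _ s(1)]) (use Rc comm_R_s in auto)
  obtain r where r: "r \<in> ?R2"
    and r': "\<And>x. x \<in> ?R2 \<Longrightarrow> \<exists>i::int. x \<otimes> r [^] i \<in> ?R2 \<and> e4 (comm (x \<otimes> r [^] i) s) =\<^sub>p 0"
    using additive_mod_kernel_generator[OF sub f5] by blast
  have aR: "a \<in> R" and bR: "b \<in> ?R1" and bc: "b \<in> \<gamma> 2"
    using lower_central_2_subset_R mem_layers lower_central_antimono[of 2 3] comm_4[of b t] t by auto
  show ?thesis
  proof (intro bexI[of _ r] allI impI)
    fix L
    assume L: "subgroup L G" and sL: "s \<in> L" and tL: "t \<in> L" and rL: "r \<in> L" and 2: "\<gamma> 2 \<subseteq> L"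
      and YL: "{y \<in> carrier G. \<forall>x\<in>carrier G. comm y x \<in> \<gamma> 5} \<subseteq> L"
    have "?R2 \<subseteq> L"
    proof
      fix x assume x: "x \<in> ?R2"
      then obtain i :: int where i: "x \<otimes> r [^] i \<in> ?R2" "e4 (comm (x \<otimes> r [^] i) s) =\<^sub>p 0"
        using r' by blast
      then have "comm (x \<otimes> r [^] i) s \<in> \<gamma> 5"
        using e4 comm_R_s by (auto simp: layer_char_def)
      then have "x \<otimes> r [^] i \<in> L"
        using i YL R_carrier central_mod_5I by blast
      then show "x \<in> L" using subgroup_mult_pow_cancel[OF L _ rL] x R_carrier by blast
    qed
    have "?R1 \<subseteq> L"
    proof
      fix x assume x: "x \<in> ?R1"
      have "\<not> e4 (comm b t) =\<^sub>p 0"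
        using t(2) not_1_eqp_0 eqp_sym eqp_trans unfolding \<psi>_def by blast
      then obtain i :: int where i: "x \<otimes> b [^] i \<in> ?R1" "e4 (comm (x \<otimes> b [^] i) t) =\<^sub>p 0"
        using additive_mod_solve[OF sub f4 x bR] by blast
      then have "x \<otimes> b [^] i \<in> ?R2" using e4 by (auto simp: layer_char_def)
      then have "x \<otimes> b [^] i \<in> L" using \<open>?R2 \<subseteq> L\<close> by blast
      then show "x \<in> L" using subgroup_mult_pow_cancel[OF L, of x b i] x R_carrier bc 2 by blast
    qed
    have "R \<subseteq> L"
    proof
      fix x assume x: "x \<in> R"
      obtain i :: int where i: "x \<otimes> a [^] i \<in> R" "e3 (comm (x \<otimes> a [^] i) t) =\<^sub>p 0"
        using additive_mod_solve[OF R_subgroup f3 x aR] \<phi>_t_nonzero unfolding \<phi>_def by blast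
      then have "x \<otimes> a [^] i \<in> ?R1" using e3 comm_R t by (auto simp: layer_char_def)
      then have "x \<otimes> a [^] i \<in> L" using \<open>?R1 \<subseteq> L\<close> by blast
      then show "x \<in> L"
        using subgroup_mult_pow_cancel[OF L, of x a i] x R_carrier mem_layers(1) 2 by blast
    qed
    then show "L = carrier G"
      using generate_s_t_R[OF L sL tL] subgroup.subset[OF L] by blast
  qed (use r R_carrier in blast)
qed

end

context layer_coordinates
begin

lemma s_t_exist:
  "\<exists>s\<in>carrier G. \<exists>t\<in>carrier G. \<psi> s =\<^sub>p 0 \<and> \<chi> s =\<^sub>p 1 \<and> \<psi> t =\<^sub>p 1 \<and> \<chi> t =\<^sub>p 0"
proof -
  obtain x y where x: "x \<in> carrier G" and y: "y \<in> carrier G" and Bxy: "\<not> B x y =\<^sub>p 0"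
    using B_nonzero by blast
  let ?D = "\<psi> y * \<chi> x - \<psi> x * \<chi> y"
  have "\<not> ?D =\<^sub>p 0"
    using relation_B[OF x y] Bxy \<epsilon>_nonzero eqp_mult_0 eqp_trans by blast
  then obtain m where m: "?D * m =\<^sub>p 1" using eqp_invertible by blast
  define z where "z i j = x [^] (i::int) \<otimes> y [^] (j::int)" for i j
  have f: "f (z i j) =\<^sub>p i * f x + j * f y" if "additive_mod (carrier G) f" for f i j
  proof -
    have xi: "x [^] i \<in> carrier G" using x by simp
    have "f (z i j) =\<^sub>p f (x [^] i) + j * f y"
      using additive_mod_mult_pow[OF subgroup_self that xi y, of j] by (simp add: z_def)
    also have "\<dots> =\<^sub>p i * f x + j * f y"
      by (rule eqp_add[OF additive_mod_int_pow[OF subgroup_self that x] eqp_refl])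
    finally show ?thesis .
  qed
  \<comment> \<open>Cramer's rule for \<psi> and \<chi> on the exponents of \<open>x\<close> and
    \<open>y\<close>. The determinant \<open>?D\<close> is congruent to
    \<open>\<epsilon> * B x y\<close>, and \<open>m\<close> is its inverse.\<close>
  let ?s = "z (m * \<psi> y) (- m * \<psi> x)" and ?t = "z (- m * \<chi> y) (m * \<chi> x)"
  have "\<psi> ?s =\<^sub>p 0"
    by (rule eqp_combine1[OF f[OF additive_\<psi>, of "m * \<psi> y" "- m * \<psi> x"], of _ _ 1]) (simp add: algebra_simps)
  moreover have "\<chi> ?s =\<^sub>p 1"
    by (rule eqp_combine2[OF f[OF additive_\<chi>, of "m * \<psi> y" "- m * \<psi> x"] m, of _ _ 1 1]) (simp add: algebra_simps)
  moreover have "\<psi> ?t =\<^sub>p 1"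
    by (rule eqp_combine2[OF f[OF additive_\<psi>, of "- m * \<chi> y" "m * \<chi> x"] m, of _ _ 1 1]) (simp add: algebra_simps)
  moreover have "\<chi> ?t =\<^sub>p 0"
    by (rule eqp_combine1[OF f[OF additive_\<chi>, of "- m * \<chi> y" "m * \<chi> x"], of _ _ 1]) (simp add: algebra_simps)
  moreover have "?s \<in> carrier G" "?t \<in> carrier G" using x y by (auto simp: z_def)
  ultimately show ?thesis by blast
qed

end

section \<open>Central decomposition\<close>

context group
begin

section \<open>The lower central series of a subgroup, and supplements of its terms\<close>

lemma commutator_subgroup_consistent:
  assumes H: "subgroup H G" and A: "A \<subseteq> H" and B: "B \<subseteq> H"
  shows "commutator_subgroup (G\<lparr>carrier := H\<rparr>) A B = commutator_subgroup G A B"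
    and "commutator_subgroup G A B \<subseteq> H"
proof -
  let ?S = "\<Union>a\<in>A. \<Union>b\<in>B. {a \<otimes> b \<otimes> inv a \<otimes> inv b}"
  have S: "?S \<subseteq> H"
    using A B H by (auto intro!: subgroup.m_closed subgroup.m_inv_closed)
  have "(\<Union>a\<in>A. \<Union>b\<in>B. {a \<otimes>\<^bsub>G\<lparr>carrier := H\<rparr>\<^esub> b \<otimes>\<^bsub>G\<lparr>carrier := H\<rparr>\<^esub> inv\<^bsub>G\<lparr>carrier := H\<rparr>\<^esub> a
      \<otimes>\<^bsub>G\<lparr>carrier := H\<rparr>\<^esub> inv\<^bsub>G\<lparr>carrier := H\<rparr>\<^esub> b}) = ?S"
    using A B m_inv_consistent[OF H] by (intro SUP_cong refl) (auto simp: subset_iff)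
  then show "commutator_subgroup (G\<lparr>carrier := H\<rparr>) A B = commutator_subgroup G A B"
    unfolding commutator_subgroup_def using generate_consistent[OF S H] by simp
  show "commutator_subgroup G A B \<subseteq> H"
    unfolding commutator_subgroup_def by (rule generate_subgroup_incl[OF S H])
qed

lemma lower_central_subgroup_Suc:
  assumes H: "subgroup H G"
  shows "lower_central (G\<lparr>carrier := H\<rparr>) (Suc (Suc i)) =
    commutator_subgroup G (lower_central (G\<lparr>carrier := H\<rparr>) (Suc i)) H"
  using group.lower_central_antimono[OF subgroup.subgroup_is_group[OF H group_axioms], of 0 "Suc i"]
  by (simp add: commutator_subgroup_consistent(1)[OF H])

lemma lower_central_subgroup_subset:
  assumes H: "subgroup H G"
  shows "lower_central (G\<lparr>carrier := H\<rparr>) i \<subseteq> lower_central G i"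
proof (induction i)
  case (Suc i)
  show ?case
  proof (cases i)
    case 0
    then show ?thesis using subgroup.subset[OF H] by simp
  next
    case (Suc j)
    have "comm x y \<in> lower_central G (Suc i)"
      if "x \<in> lower_central (G\<lparr>carrier := H\<rparr>) i" "y \<in> H" for x y
      using comm_lower_central_carrier[of x i y] that Suc.IH subgroup.subset[OF H] by blast
    then show ?thesis
      unfolding Suc lower_central_subgroup_Suc[OF H]
      by (intro commutator_subgroup_subset lower_central_subgroup) (simp_all only: Suc)
  qed
qed (use subgroup.subset[OF H] in simp)

lemma set_multI: "h \<in> H \<Longrightarrow> k \<in> K \<Longrightarrow> h \<otimes> k \<in> H <#> K"
  unfolding set_mult_def by blast

lemma set_mult_subset:
  assumes L: "subgroup L G" and "A \<subseteq> L" "B \<subseteq> L"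
  shows "A <#> B \<subseteq> L"
proof
  fix x assume "x \<in> A <#> B"
  then obtain a b where "a \<in> A" "b \<in> B" "x = a \<otimes> b" unfolding set_mult_def by blast
  then show "x \<in> L" using assms(2,3) subgroup.m_closed[OF L, of a b] by blast
qed

lemma set_mult_subsets:
  assumes N: "subgroup N G" and H: "subgroup H G"
  shows "N \<subseteq> N <#> H" "H \<subseteq> N <#> H"
proof -
  show "N \<subseteq> N <#> H"
  proof
    fix x assume "x \<in> N"
    then show "x \<in> N <#> H"
      using set_multI[of x N \<one> H] subgroup.one_closed[OF H] subgroup.mem_carrier[OF N] by simp
  qed
  show "H \<subseteq> N <#> H"
  proof
    fix x assume "x \<in> H"
    then show "x \<in> N <#> H"
      using set_multI[of \<one> N x H] subgroup.one_closed[OF N] subgroup.mem_carrier[OF H] by simp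
  qed
qed

text \<open>Each term is central modulo the next. So if G is a term times \<open>P\<close>, all
  commutators of G are commutators in \<open>P\<close> modulo the next term, and that term times
  \<open>P\<close> contains \<open>\<gamma> 2\<close> and is again G. In a nilpotent group this lets
  \<open>G'\<close> be dropped from generating sets.\<close>

lemma lower_central_supplement:
  assumes P: "subgroup P G" and G: "lower_central G 2 <#> P = carrier G"
  shows "lower_central G (k + 2) <#> P = carrier G"
proof (induction k)
  case (Suc k)
  let ?M = "lower_central G (k + 2)" and ?N = "lower_central G (Suc k + 2)"
  let ?L = "?N <#> P"
  have L: "subgroup ?L G" by (rule mult_norm_subgroup[OF lower_central_normal P])
  note sub = set_mult_subsets[OF lower_central_subgroup[of "Suc k + 2"] P]
  note Pc = subgroup.mem_carrier[OF P]
  have NL: "comm m x \<in> ?N \<and> comm x m \<in> ?N" if "m \<in> ?M" "x \<in> carrier G" for m x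
  proof -
    have "comm m x \<in> ?N" using comm_lower_central_carrier[OF that] by (simp only: add_Suc)
    then show ?thesis
      using normal_comm_sym[OF lower_central_normal lower_central_carrier[OF that(1)] that(2)] by blast
  qed
  have "comm x y \<in> ?L" if x: "x \<in> carrier G" and y: "y \<in> carrier G" for x y
  proof -
    obtain m q where mq: "m \<in> ?M" "q \<in> P" "x = m \<otimes> q"
      using x Suc.IH unfolding set_mult_def by blast
    obtain m' q' where mq': "m' \<in> ?M" "q' \<in> P" "y = m' \<otimes> q'"
      using y Suc.IH unfolding set_mult_def by blast
    have c: "m \<in> carrier G" "q \<in> carrier G" "m' \<in> carrier G" "q' \<in> carrier G"
      using mq(1,2) mq'(1,2) Pc lower_central_carrier by blast+
    have eq: "comm x y = m \<otimes> (comm q m' \<otimes> (m' \<otimes> comm q q' \<otimes> inv m')) \<otimes> inv m \<otimes> comm m y"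
      using c y by (simp only: mq(3) comm_mult_left comm_mult_right[symmetric] mq'(3))
    \<comment> \<open>Arranged so that \<open>comm q q'\<close> stands alone and every other factor
      is a commutator involving \<open>?M\<close>, or a conjugate of one.\<close>
    also have "\<dots> = (m \<otimes> comm q m' \<otimes> inv m) \<otimes> comm (m \<otimes> m') (comm q q')
        \<otimes> comm q q' \<otimes> comm m y"
      using c y by (simp add: comm_def[of "m \<otimes> m'"] inv_mult_group m_assoc)
    also have "\<dots> \<in> ?L"
    proof -
      have 1: "m \<otimes> comm q m' \<otimes> inv m \<in> ?L"
        using normal_conj[OF lower_central_normal c(1), of "comm q m'" "Suc k + 2"] NL[OF mq'(1) c(2)] sub by blast
      have "m \<otimes> m' \<in> ?M" by (rule subgroup.m_closed[OF lower_central_subgroup mq(1) mq'(1)])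
      then have 2: "comm (m \<otimes> m') (comm q q') \<in> ?L"
        using NL[OF _ comm_closed[OF c(2,4)]] sub(1) by blast
      have "comm q q' \<in> P"
        unfolding comm_def using mq mq' P by (intro subgroup.m_closed subgroup.m_inv_closed)
      then have 3: "comm q q' \<in> ?L" using sub(2) by blast
      have 4: "comm m y \<in> ?L" using NL[OF mq(1) y] sub(1) by blast
      note mult = subgroup.m_closed[OF L]
      show ?thesis by (rule mult[OF mult[OF mult[OF 1 2] 3] 4])
    qed
    finally show ?thesis .
  qed
  then have "lower_central G 2 \<subseteq> ?L"
    unfolding lower_central_2 by (intro derived_subset[OF L])
  then have "lower_central G 2 <#> P \<subseteq> ?L"
    by (rule set_mult_subset[OF L _ sub(2)])
  then show ?case using G subgroup.subset[OF L] by blast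
qed (use G in \<open>simp only: add_0\<close>)

text \<open>Since \<open>U\<close> centralises \<open>H\<close>, the two factors contribute independently to commutators, and \<open>U\<close> contributes
  nothing beyond \<open>[U, U]\<close>.\<close>

lemma lower_central_central_factor:
  assumes H: "subgroup H G" and U: "subgroup U G" and G: "carrier G = H <#> U"
    and HU: "\<And>h u. h \<in> H \<Longrightarrow> u \<in> U \<Longrightarrow> comm h u = \<one>"
    and U5: "\<And>u v. u \<in> U \<Longrightarrow> v \<in> U \<Longrightarrow> comm u v \<in> lower_central G 5"
    and G6: "lower_central G 6 = {\<one>}" and i: "2 \<le> i"
  shows "lower_central (G\<lparr>carrier := H\<rparr>) i = lower_central G i"
proof -
  let ?K = "lower_central (G\<lparr>carrier := H\<rparr>)" and ?g = "lower_central G"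
  interpret H: group "G\<lparr>carrier := H\<rparr>" by (rule subgroup.subgroup_is_group[OF H group_axioms])
  note Hc = subgroup.mem_carrier[OF H] and Uc = subgroup.mem_carrier[OF U]
  have KH: "?K i \<subseteq> H" for i using H.lower_central_antimono[of 0 i] by simp
  have K: "?K (Suc (Suc j)) = commutator_subgroup G (?K (Suc j)) H" for j
    by (rule lower_central_subgroup_Suc[OF H])
  have Ks: "subgroup (?K i) G" for i
    using H H.lower_central_subgroup[of i] by (rule incl_subgroup)
  have cent: "comm z x = \<one>" if "z \<in> ?g 5" "x \<in> carrier G" for z x
    using comm_lower_central_carrier[OF that] G6 by simp
  have dec: "\<exists>h\<in>H. \<exists>u\<in>U. x = h \<otimes> u" if "x \<in> carrier G" for x
    using that G unfolding set_mult_def by blast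
  have UH: "comm u h = \<one>" if "h \<in> H" "u \<in> U" for h u
    using HU[OF that] comm_inv[OF Hc Uc] that inv_one by metis
  have conj: "x \<otimes> z \<otimes> inv x = z" if "z \<in> ?g 5" "x \<in> carrier G" for z x
  proof -
    have "comm x z = \<one>"
      using cent[OF that] comm_inv[OF lower_central_carrier[OF that(1)] that(2)] by simp
    then show ?thesis
      using conj_eq_comm[OF that(2) lower_central_carrier[OF that(1)]]
        lower_central_carrier[OF that(1)] by simp
  qed
  have H_comm: "comm k (h \<otimes> u) = comm k h" if "k \<in> H" "h \<in> H" "u \<in> U" for k h u
    using that HU[OF that(1,3)] Hc Uc by (simp add: comm_mult_right)
  \<comment> \<open>Commutators inside \<open>U\<close> are the only defect; they lie in the fifth
    term, which is central.\<close>
  have 2: "?g 2 \<subseteq> ?g 5 <#> ?K 2"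
  proof -
    have L: "subgroup (?g 5 <#> ?K 2) G" by (rule mult_norm_subgroup[OF lower_central_normal Ks])
    have "comm x y \<in> ?g 5 <#> ?K 2" if x: "x \<in> carrier G" and y: "y \<in> carrier G" for x y
    proof -
      obtain h u h' u' where hu: "h \<in> H" "u \<in> U" "x = h \<otimes> u" "h' \<in> H" "u' \<in> U" "y = h' \<otimes> u'"
        using dec[OF x] dec[OF y] by metis
      have c: "h \<in> carrier G" "u \<in> carrier G" "h' \<in> carrier G" "u' \<in> carrier G"
        using hu Hc Uc by auto
      note z = U5[OF hu(2,5)]
      have "comm u y = comm u u'"
        using c UH hu conj[OF z c(3)] by (simp add: comm_mult_right)
      then have "comm x y = comm u u' \<otimes> comm h h'"
        using c y hu(3) conj[OF z c(1)] H_comm[OF hu(1,4,5)] hu(6) by (simp add: comm_mult_left)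
      moreover have "comm h h' \<in> ?K 2"
        using comm_in_commutator_subgroup[of h "?K 1" h' H] hu K[of 0] by (simp add: numeral_2_eq_2)
      ultimately show ?thesis using z set_multI by simp
    qed
    then show ?thesis unfolding lower_central_2 by (intro derived_subset L[unfolded lower_central_2])
  qed
  \<comment> \<open>One further commutator removes the central factor.\<close>
  have step: "?g (Suc (Suc j)) \<subseteq> ?K (Suc (Suc j))"
    if "?g (Suc j) \<subseteq> ?g 5 <#> ?K (Suc j)" for j
  proof -
    have "comm v x \<in> ?K (Suc (Suc j))" if v: "v \<in> ?g (Suc j)" and x: "x \<in> carrier G" for v x
    proof -
      obtain z k where zk: "z \<in> ?g 5" "k \<in> ?K (Suc j)" "v = z \<otimes> k"
        using v \<open>?g (Suc j) \<subseteq> _\<close> unfolding set_mult_def by blast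
      obtain h u where hu: "h \<in> H" "u \<in> U" "x = h \<otimes> u" using dec[OF x] by blast
      have kH: "k \<in> H" using zk KH by blast
      have c: "z \<in> carrier G" "k \<in> carrier G" "h \<in> carrier G"
        using zk(1) kH hu Hc lower_central_carrier by auto
      have kh: "comm k h \<in> ?K (Suc (Suc j))"
        unfolding K by (rule comm_in_commutator_subgroup[OF zk(2) hu(1)])
      have "z \<otimes> comm k h \<otimes> inv z = comm k h"
        using cent[OF zk(1), of "comm k h"] conj_eq_comm[OF c(1), of "comm k h"] c by simp
      then have "comm v x = comm k h"
        using cent[OF zk(1) x] c x H_comm[OF kH hu(1,2)] hu(3)
        by (simp add: zk(3) comm_mult_left)
      then show ?thesis using kh by simp
    qed
    then have "commutator_subgroup G (?g (Suc j)) (carrier G) \<subseteq> ?K (Suc (Suc j))"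
      by (rule commutator_subgroup_subset[OF Ks])
    then show ?thesis unfolding lower_central.simps(3)[of G j] .
  qed
  have 3: "?g (j + 3) \<subseteq> ?K (j + 3)" for j
  proof (induction j)
    case 0
    show ?case using step[of 1] 2 by (simp add: numeral_3_eq_3 numeral_2_eq_2 del: lower_central.simps)
  next
    case (Suc j)
    have "?g (Suc (j + 2)) \<subseteq> ?g 5 <#> ?K (Suc (j + 2))"
      using Suc.IH set_mult_subsets(2)[OF lower_central_subgroup Ks] by (simp add: numeral_3_eq_3 del: lower_central.simps) blast
    from step[OF this] show ?case by (simp add: numeral_3_eq_3 del: lower_central.simps)
  qed
  \<comment> \<open>The fifth terms already agree, so the defect in \<open>2\<close> is absorbed;
    for this reason \<open>i = 2\<close> is settled after all larger indices.\<close>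
  have "?g 5 \<subseteq> ?K 2"
    using 3[of 2] H.lower_central_antimono[of 2 5] by simp
  then have "?g 5 <#> ?K 2 \<subseteq> ?K 2"
    by (rule set_mult_subset[OF Ks _ order_refl])
  then have "?g 2 \<subseteq> ?K 2" using 2 by blast
  moreover have "?g i \<subseteq> ?K i" if "3 \<le> i" using 3[of "i - 3"] that by simp
  ultimately have "?g i \<subseteq> ?K i" using i by (cases "i = 2") auto
  then show ?thesis using lower_central_subgroup_subset[OF H] by blast
qed

end

section \<open>Reduction of the commutation pairing to an abelian remainder\<close>

context finite_p_group
begin

text \<open>The bilinear form \<open>(x, y) \<mapsto> e[x, y]\<close> on \<open>G \<times> Y\<close> restricts to an alternating form on \<open>Y\<close>. As long as the
  latter is nonzero, a hyperbolic pair \<open>u, v\<close> is split off from \<open>Y\<close>. When it has become zero, the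
  centraliser of \<open>s, t, r\<close> is cut out by three linear forms, one of them detected by \<open>c\<close>.\<close>

lemma central_extraction:
  assumes A: "A \<lhd> G" and e: "central_char A e" and exact: "\<And>u. u \<in> A \<Longrightarrow> e u =\<^sub>p 0 \<Longrightarrow> u = \<one>"
    and Y: "subgroup Y G" and YA: "\<And>x y. x \<in> carrier G \<Longrightarrow> y \<in> Y \<Longrightarrow> comm x y \<in> A"
    and c: "c \<in> Y" and cY: "\<And>y. y \<in> Y \<Longrightarrow> comm y c = \<one>" and sc: "comm s c \<noteq> \<one>"
    and str: "s \<in> carrier G" "t \<in> carrier G" "r \<in> carrier G"
  shows "\<exists>s' t' r' y z. (\<exists>w\<in>Y. s' = s \<otimes> w) \<and> (\<exists>w\<in>Y. t' = t \<otimes> w) \<and> (\<exists>w\<in>Y. r' = r \<otimes> w) \<and>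
    y \<in> Y \<and> z \<in> Y \<and>
    (\<forall>L. subgroup L G \<longrightarrow> {s', t', r', y, z, c} \<union> {w \<in> Y. \<forall>g\<in>{s', t', r', y, z}. comm g w = \<one>} \<subseteq> L
       \<longrightarrow> Y \<subseteq> L)"
  using Y YA c cY sc str
proof (induction "card Y" arbitrary: Y s t r rule: less_induct)
  case less
  note Y = less.prems(1) and YA = less.prems(2) and c = less.prems(3) and cY = less.prems(4)
    and sc = less.prems(5) and str = less.prems(6-8)
  note Yc = subgroup.mem_carrier[OF Y]
  have zero: "e (comm x y) =\<^sub>p 0 \<longleftrightarrow> comm x y = \<one>" if "x \<in> carrier G" "y \<in> Y" for x y
    using exact[OF YA[OF that]] additive_mod_one[OF normal_imp_subgroup[OF A] central_char_additive[OF e]]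
    by auto
  have sym: "comm x y = \<one> \<longleftrightarrow> comm y x = \<one>" if "x \<in> carrier G" "y \<in> carrier G" for x y
    using comm_inv[OF that] comm_inv[OF that(2,1)] by (metis inv_one)
  have right: "additive_mod S (\<lambda>y. e (comm x y))" if "x \<in> carrier G" "S \<subseteq> Y" for x S
    using that Yc by (intro central_char_comm_right[OF A e]) (auto intro: YA)
  have left: "additive_mod (carrier G) (\<lambda>x. e (comm x y))" if "y \<in> Y" for y
    using that Yc by (intro central_char_comm_left[OF A e]) (auto intro: YA)
  have cent: "subgroup {y \<in> S. comm x y = \<one>} G"
    if x: "x \<in> carrier G" and S: "subgroup S G" "S \<subseteq> Y" for x S
  proof -
    have "{y \<in> S. comm x y = \<one>} = {y \<in> S. e (comm x y) =\<^sub>p 0}"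
      using zero[OF x] S(2) by blast
    then show ?thesis using additive_mod_kernel_subgroup[OF S(1) right[OF x S(2)]] by simp
  qed
  show ?case
  proof (cases "\<forall>u\<in>Y. \<forall>v\<in>Y. comm u v = \<one>")
    \<comment> \<open>Each form costs one generator: \<open>c\<close> for \<open>s\<close>,
      \<open>y\<close> for \<open>t\<close>, \<open>z\<close> for \<open>r\<close>. As
      \<open>Y\<close> is abelian, commuting with \<open>y\<close> and \<open>z\<close> is no
      further restriction, and \<open>?Y3\<close> is the centraliser of all five.\<close>
    case abelian: True
    let ?Y1 = "{y \<in> Y. comm s y = \<one>}"
    let ?Y2 = "{y \<in> ?Y1. comm t y = \<one>}"
    let ?Y3 = "{y \<in> ?Y2. comm r y = \<one>}"
    have Y1: "subgroup ?Y1 G" by (rule cent[OF str(1) Y order_refl])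
    have Y2: "subgroup ?Y2 G" by (rule cent[OF str(2) Y1]) blast
    obtain y where y: "y \<in> ?Y1" and y': "\<And>x. x \<in> ?Y1 \<Longrightarrow> \<exists>i::int. x \<otimes> y [^] i \<in> ?Y1 \<and> e (comm t (x \<otimes> y [^] i)) =\<^sub>p 0"
      using additive_mod_kernel_generator[OF Y1 right[OF str(2)]] by blast
    obtain z where z: "z \<in> ?Y2" and z': "\<And>x. x \<in> ?Y2 \<Longrightarrow> \<exists>i::int. x \<otimes> z [^] i \<in> ?Y2 \<and> e (comm r (x \<otimes> z [^] i)) =\<^sub>p 0"
      using additive_mod_kernel_generator[OF Y2 right[OF str(3)]] by blast
    have gen: "Y \<subseteq> L" if L: "subgroup L G"
        "{s, t, r, y, z, c} \<union> {w \<in> Y. \<forall>g\<in>{s, t, r, y, z}. comm g w = \<one>} \<subseteq> L" for L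
    proof -
      have "?Y3 \<subseteq> L" using L(2) abelian y z by blast
      have "?Y2 \<subseteq> L"
      proof
        fix x assume x: "x \<in> ?Y2"
        then obtain i :: int where i: "x \<otimes> z [^] i \<in> ?Y2" "e (comm r (x \<otimes> z [^] i)) =\<^sub>p 0"
          using z' by blast
        then have "x \<otimes> z [^] i \<in> L" using zero[OF str(3)] \<open>?Y3 \<subseteq> L\<close> by blast
        then show "x \<in> L" using subgroup_mult_pow_cancel[OF L(1), of x z i] x Yc L(2) by blast
      qed
      have "?Y1 \<subseteq> L"
      proof
        fix x assume x: "x \<in> ?Y1"
        then obtain i :: int where i: "x \<otimes> y [^] i \<in> ?Y1" "e (comm t (x \<otimes> y [^] i)) =\<^sub>p 0"
          using y' by blast
        then have "x \<otimes> y [^] i \<in> L" using zero[OF str(2)] \<open>?Y2 \<subseteq> L\<close> by blast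
        then show "x \<in> L" using subgroup_mult_pow_cancel[OF L(1), of x y i] x Yc L(2) by blast
      qed
      show "Y \<subseteq> L"
      proof
        fix x assume x: "x \<in> Y"
        obtain i :: int where i: "x \<otimes> c [^] i \<in> Y" "e (comm s (x \<otimes> c [^] i)) =\<^sub>p 0"
          using additive_mod_solve[OF Y right[OF str(1) order_refl] x c] zero[OF str(1) c] sc by blast
        then have "x \<otimes> c [^] i \<in> L" using zero[OF str(1)] \<open>?Y1 \<subseteq> L\<close> by blast
        then show "x \<in> L" using subgroup_mult_pow_cancel[OF L(1), of x c i] x Yc L(2) by blast
      qed
    qed
    have triv: "\<exists>w\<in>Y. x = x \<otimes> w" if "x \<in> carrier G" for x
      using subgroup.one_closed[OF Y] that by (intro bexI[of _ \<one>]) auto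
    show ?thesis
    proof (intro exI conjI allI impI)
      show "\<exists>w\<in>Y. s = s \<otimes> w" "\<exists>w\<in>Y. t = t \<otimes> w" "\<exists>w\<in>Y. r = r \<otimes> w"
        using triv str by blast+
      show "y \<in> Y" "z \<in> Y" using y z by auto
    qed (rule gen)
  next
    case False
    then obtain u v where u: "u \<in> Y" and v: "v \<in> Y" and uv: "comm u v \<noteq> \<one>" by blast
    note uc = Yc[OF u] and vc = Yc[OF v]
    have vu: "comm v u \<noteq> \<one>" using uv sym uc vc by blast
    \<comment> \<open>Projection to the orthogonal of the pair: a power of \<open>u\<close> corrects
      the commutator with \<open>v\<close>, then a power of \<open>v\<close> the one with
      \<open>u\<close>. The second correction preserves the first because \<open>v\<close> commutes
      with itself.\<close>
    have adjust: "\<exists>w\<in>Y. comm (x \<otimes> w) u = \<one> \<and> comm (x \<otimes> w) v = \<one> \<and>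
        (\<forall>L. subgroup L G \<longrightarrow> u \<in> L \<longrightarrow> v \<in> L \<longrightarrow> w \<in> L)" if x: "x \<in> carrier G" for x
    proof -
      have "\<not> e (comm u v) =\<^sub>p 0" "\<not> e (comm v u) =\<^sub>p 0" using zero uc vc u v uv vu by auto
      then obtain i :: int where i: "e (comm (x \<otimes> u [^] i) v) =\<^sub>p 0"
        using additive_mod_solve[OF subgroup_self left[OF v] x uc] by blast
      have xu: "x \<otimes> u [^] i \<in> carrier G" using x uc by simp
      obtain j :: int where j: "e (comm (x \<otimes> u [^] i \<otimes> v [^] j) u) =\<^sub>p 0"
        using additive_mod_solve[OF subgroup_self left[OF u] xu vc] \<open>\<not> e (comm v u) =\<^sub>p 0\<close> by blast
      have k: "e (comm (x \<otimes> u [^] i \<otimes> v [^] j) v) =\<^sub>p e (comm (x \<otimes> u [^] i) v) + j * e (comm v v)"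
        using additive_mod_mult_pow[OF subgroup_self left[OF v] xu vc] by blast
      have l: "e (comm v v) =\<^sub>p 0" using zero[OF vc v] vc by simp
      have m: "e (comm (x \<otimes> u [^] i \<otimes> v [^] j) v) =\<^sub>p 0"
        by (rule eqp_combine3[OF k i l, of _ _ 1 1 j]) (simp add: algebra_simps)
      have eq: "x \<otimes> u [^] i \<otimes> v [^] j = x \<otimes> (u [^] i \<otimes> v [^] j)"
        using x uc vc by (simp add: m_assoc)
      have xw: "x \<otimes> (u [^] i \<otimes> v [^] j) \<in> carrier G" using x uc vc by simp
      have in_sub: "u [^] i \<otimes> v [^] j \<in> L" if "subgroup L G" "u \<in> L" "v \<in> L" for L
        using that by (intro subgroup.m_closed subgroup_int_pow_closed)
      show ?thesis
        using zero[OF xw u] zero[OF xw v] j m in_sub in_sub[OF Y u v] unfolding eq by blast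
    qed
    let ?Y1 = "{y \<in> Y. comm u y = \<one>}"
    let ?Y' = "{y \<in> ?Y1. comm v y = \<one>}"
    have Y': "subgroup ?Y' G"
      by (rule cent[OF vc cent[OF uc Y order_refl]]) blast
    have "finite Y" using finite_G subgroup.subset[OF Y] finite_subset by blast
    moreover have "?Y' \<subset> Y" using u vu by blast
    ultimately have card: "card ?Y' < card Y" by (rule psubset_card_mono)
    obtain ws where ws: "ws \<in> Y" "comm (s \<otimes> ws) u = \<one>" "comm (s \<otimes> ws) v = \<one>"
      and wsL: "\<And>L. subgroup L G \<Longrightarrow> u \<in> L \<Longrightarrow> v \<in> L \<Longrightarrow> ws \<in> L" using adjust[OF str(1)] by blast
    obtain wt where wt: "wt \<in> Y" "comm (t \<otimes> wt) u = \<one>" "comm (t \<otimes> wt) v = \<one>"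
      and wtL: "\<And>L. subgroup L G \<Longrightarrow> u \<in> L \<Longrightarrow> v \<in> L \<Longrightarrow> wt \<in> L" using adjust[OF str(2)] by blast
    obtain wr where wr: "wr \<in> Y" "comm (r \<otimes> wr) u = \<one>" "comm (r \<otimes> wr) v = \<one>"
      and wrL: "\<And>L. subgroup L G \<Longrightarrow> u \<in> L \<Longrightarrow> v \<in> L \<Longrightarrow> wr \<in> L" using adjust[OF str(3)] by blast
    \<comment> \<open>Since \<open>c\<close> commutes with \<open>Y\<close>, it survives in the
      orthogonal complement, and correcting \<open>s\<close> inside \<open>Y\<close> does not change
      its commutator with \<open>c\<close>.\<close>
    have cY': "c \<in> ?Y'" using c cY u v by blast
    have "comm (s \<otimes> ws) c = s \<otimes> comm ws c \<otimes> inv s \<otimes> comm s c"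
      by (rule comm_mult_left[OF str(1) Yc[OF ws(1)] Yc[OF c]])
    then have sc': "comm (s \<otimes> ws) c \<noteq> \<one>" using sc cY[OF ws(1)] str Yc[OF c] by simp
    have str': "s \<otimes> ws \<in> carrier G" "t \<otimes> wt \<in> carrier G" "r \<otimes> wr \<in> carrier G"
      using str ws wt wr Yc by auto
    have "\<exists>s' t' r' y z. (\<exists>w\<in>?Y'. s' = s \<otimes> ws \<otimes> w) \<and> (\<exists>w\<in>?Y'. t' = t \<otimes> wt \<otimes> w) \<and>
      (\<exists>w\<in>?Y'. r' = r \<otimes> wr \<otimes> w) \<and> y \<in> ?Y' \<and> z \<in> ?Y' \<and>
      (\<forall>L. subgroup L G \<longrightarrow> {s', t', r', y, z, c} \<union> {w \<in> ?Y'. \<forall>g\<in>{s', t', r', y, z}. comm g w = \<one>} \<subseteq> L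
         \<longrightarrow> ?Y' \<subseteq> L)"
      by (rule less.hyps[OF card Y' _ cY' _ sc' str']) (use YA cY in blast)+
    then obtain s' t' r' y z where X: "\<exists>w\<in>?Y'. s' = s \<otimes> ws \<otimes> w" "\<exists>w\<in>?Y'. t' = t \<otimes> wt \<otimes> w"
        "\<exists>w\<in>?Y'. r' = r \<otimes> wr \<otimes> w" and yz: "y \<in> ?Y'" "z \<in> ?Y'"
      and gen: "\<forall>L. subgroup L G \<longrightarrow>
        {s', t', r', y, z, c} \<union> {w \<in> ?Y'. \<forall>g\<in>{s', t', r', y, z}. comm g w = \<one>} \<subseteq> L \<longrightarrow> ?Y' \<subseteq> L"
      by (elim exE conjE) (rule that)
    obtain ws' where ws': "ws' \<in> ?Y'" "s' = s \<otimes> ws \<otimes> ws'" using X(1) by (rule bexE)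
    obtain wt' where wt': "wt' \<in> ?Y'" "t' = t \<otimes> wt \<otimes> wt'" using X(2) by (rule bexE)
    obtain wr' where wr': "wr' \<in> ?Y'" "r' = r \<otimes> wr \<otimes> wr'" using X(3) by (rule bexE)
    note w' = ws' wt' wr'
    have in_Y: "\<exists>w''\<in>Y. x \<otimes> w \<otimes> w' = x \<otimes> w''" if "x \<in> carrier G" "w \<in> Y" "w' \<in> ?Y'" for x w w'
      using that Yc by (intro bexI[of _ "w \<otimes> w'"]) (auto simp: m_assoc intro: subgroup.m_closed[OF Y])
    have commutes: "comm (x \<otimes> w) u = \<one> \<and> comm (x \<otimes> w) v = \<one>"
      if "x \<in> carrier G" "comm x u = \<one>" "comm x v = \<one>" "w \<in> ?Y'" for x w
    proof -
      have wc: "w \<in> carrier G" using that(4) Yc by blast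
      have "comm w u = \<one>" "comm w v = \<one>" using that(4) sym wc uc vc by blast+
      then show ?thesis using that wc uc vc by (simp add: comm_mult_left)
    qed
    \<comment> \<open>The split pair commutes with all five elements found for \<open>?Y'\<close>,
      so it falls into their centraliser and costs no generator.\<close>
    have uvU: "\<forall>g\<in>{s', t', r', y, z}. comm g u = \<one> \<and> comm g v = \<one>"
      using commutes[OF str'(1) ws(2,3) w'(1)] commutes[OF str'(2) wt(2,3) w'(3)]
        commutes[OF str'(3) wr(2,3) w'(5)] yz sym uc vc Yc unfolding w' by blast
    have gen_Y: "Y \<subseteq> L" if L: "subgroup L G"
        "{s', t', r', y, z, c} \<union> {w \<in> Y. \<forall>g\<in>{s', t', r', y, z}. comm g w = \<one>} \<subseteq> L" for L
    proof
      have uL: "u \<in> L" "v \<in> L" using L(2) u v uvU by blast+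
      have Y'L: "?Y' \<subseteq> L" by (rule gen[rule_format, OF L(1)]) (use L(2) in blast)
      fix x assume x: "x \<in> Y"
      obtain w where w: "w \<in> Y" "comm (x \<otimes> w) u = \<one>" "comm (x \<otimes> w) v = \<one>" "w \<in> L"
        using adjust[OF Yc[OF x]] L(1) uL by blast
      have xw: "x \<otimes> w \<in> Y" by (rule subgroup.m_closed[OF Y x w(1)])
      then have "x \<otimes> w \<in> ?Y'" using w(2,3) sym Yc uc vc by blast
      then have "x \<otimes> w \<otimes> inv w \<in> L"
        using Y'L subgroup.m_closed[OF L(1)] subgroup.m_inv_closed[OF L(1) w(4)] by blast
      then show "x \<in> L" using Yc[OF x] Yc[OF w(1)] by (simp add: m_assoc)
    qed
    have in_Y': "\<exists>w\<in>Y. s' = s \<otimes> w" "\<exists>w\<in>Y. t' = t \<otimes> w" "\<exists>w\<in>Y. r' = r \<otimes> w"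
      using in_Y[OF str(1) ws(1) w'(1)] in_Y[OF str(2) wt(1) w'(3)] in_Y[OF str(3) wr(1) w'(5)]
      unfolding w'(2,4,6) by auto
    show ?thesis
    proof (intro exI conjI allI impI)
      show "y \<in> Y" "z \<in> Y" using yz by auto
    qed (rule gen_Y in_Y' | assumption)+
  qed
qed

end

section \<open>Construction of the two factors\<close>

context layer_generators
begin

lemma central_decomposition:
  "\<exists>H U. subgroup H G \<and> subgroup U G \<and> carrier G = H <#> U \<and>
     (H \<lhd> G \<and> (\<exists>S. S \<subseteq> H \<and> finite S \<and> card S \<le> 5 \<and> generate G S = H)) \<and>
     (\<forall>i\<ge>2. lower_central (G\<lparr>carrier := H\<rparr>) i = \<gamma> i) \<and>
     (U \<lhd> G \<and> derived G U \<subseteq> \<gamma> 5) \<and>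
     (\<forall>h\<in>H. \<forall>u\<in>U. h \<otimes> u = u \<otimes> h)"
proof -
  define Y where "Y = {y \<in> carrier G. \<forall>x\<in>carrier G. comm y x \<in> \<gamma> 5}"
  have Y: "subgroup Y G"
    unfolding Y_def by (rule centralizer_mod_subgroup[OF lower_central_normal order_refl])
  note Yc = subgroup.mem_carrier[OF Y]
  have Y5: "comm y x \<in> \<gamma> 5" "comm x y \<in> \<gamma> 5" if "x \<in> carrier G" "y \<in> Y" for x y
    using that normal_comm_sym[OF lower_central_normal] unfolding Y_def by blast+
  have sym: "comm x y = \<one> \<longleftrightarrow> comm y x = \<one>" if "x \<in> carrier G" "y \<in> carrier G" for x y
    using comm_inv[OF that] comm_inv[OF that(2,1)] by (metis inv_one)
  have gY: "\<gamma> 5 \<subseteq> Y"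
    using lower_central_5_central lower_central_carrier
      subgroup.one_closed[OF lower_central_subgroup[of 5]] unfolding Y_def by auto
  have Yn: "x \<otimes> y \<otimes> inv x \<in> Y" if "x \<in> carrier G" "y \<in> Y" for x y
    using Y5(2)[OF that] gY subgroup.m_closed[OF Y] that Yc conj_eq_comm by auto
  \<comment> \<open>Three subgroups lemma: \<open>[Y, G]\<close> lies in the central subgroup
    \<open>\<gamma> 5\<close>, so \<open>[[Y, G], G]\<close> is trivial and \<open>Y\<close>
    centralises \<open>[G, G]\<close>.\<close>
  have Y2: "comm g y = \<one>" if g: "g \<in> \<gamma> 2" and y: "y \<in> Y" for g y
  proof -
    have "\<gamma> 2 \<subseteq> {x \<in> carrier G. \<forall>y\<in>{y}. comm x y \<in> {\<one>}}"
      unfolding lower_central_2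
    proof (rule derived_subset)
      show "subgroup {x \<in> carrier G. \<forall>y\<in>{y}. comm x y \<in> {\<one>}} G"
        by (rule centralizer_mod_subgroup[OF one_is_normal]) (use y Yc in auto)
      fix u v assume u: "u \<in> carrier G" and v: "v \<in> carrier G"
      define y' where "y' = inv v \<otimes> y \<otimes> inv (inv v)"
      have y': "y' \<in> Y" unfolding y'_def by (rule Yn) (use v y in auto)
      have eq: "v \<otimes> y' \<otimes> inv v = y" using v Yc[OF y] by (simp add: y'_def m_assoc)
      have "comm (comm u v) (v \<otimes> y' \<otimes> inv v) \<in> {\<one>}"
        by (rule three_subgroup_mod[OF one_is_normal Yc[OF y'] u v])
          (use Y5 y' Yc[OF y'] u v in \<open>simp_all add: lower_central_5_central\<close>)
      then show "comm u v \<in> {x \<in> carrier G. \<forall>y\<in>{y}. comm x y \<in> {\<one>}}"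
        using u v eq by simp
    qed
    then show ?thesis using g by blast
  qed
  have c2: "c \<in> \<gamma> 2" using mem_layers lower_central_antimono[of 2 4] by auto
  have cY: "c \<in> Y" unfolding Y_def using comm_5 mem_layers mem_carrier_layers by blast
  have Y_c: "comm y c = \<one>" if "y \<in> Y" for y
    using Y2[OF c2 that] sym[OF Yc[OF that] mem_carrier_layers(3)] by blast
  \<comment> \<open>The form defined by \<open>s\<close> on \<open>Y\<close> is nonzero at
    \<open>c\<close>, because \<chi> is 1 at \<open>s\<close>. As \<open>c\<close> lies in
    \<open>\<gamma> 2\<close>, this form requires no additional generator.\<close>
  have sc: "comm s c \<noteq> \<one>"
  proof
    assume "comm s c = \<one>"
    then have "comm c s = \<one>" using sym s mem_carrier_layers by blast
    then have "\<chi> s =\<^sub>p 0"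
      unfolding \<chi>_def using additive_mod_one[OF lower_central_subgroup central_char_additive[OF c5]] by simp
    then show False using s(3) not_1_eqp_0 eqp_sym eqp_trans by blast
  qed
  obtain r where r: "r \<in> carrier G" and gen: "\<forall>L. subgroup L G \<longrightarrow> s \<in> L \<longrightarrow> t \<in> L \<longrightarrow> r \<in> L \<longrightarrow> \<gamma> 2 \<subseteq> L \<longrightarrow>
     Y \<subseteq> L \<longrightarrow> L = carrier G"
    using third_generator unfolding Y_def by (rule bexE)
  have "\<exists>s' t' r' y z. (\<exists>w\<in>Y. s' = s \<otimes> w) \<and> (\<exists>w\<in>Y. t' = t \<otimes> w) \<and> (\<exists>w\<in>Y. r' = r \<otimes> w) \<and>
    y \<in> Y \<and> z \<in> Y \<and>
    (\<forall>L. subgroup L G \<longrightarrow> {s', t', r', y, z, c} \<union> {w \<in> Y. \<forall>g\<in>{s', t', r', y, z}. comm g w = \<one>} \<subseteq> L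
       \<longrightarrow> Y \<subseteq> L)"
    by (rule central_extraction[OF lower_central_normal c5 e5_exact Y Y5(2) cY Y_c sc s(1) t(1) r])
  then obtain s' t' r' y z where X: "\<exists>w\<in>Y. s' = s \<otimes> w" "\<exists>w\<in>Y. t' = t \<otimes> w" "\<exists>w\<in>Y. r' = r \<otimes> w"
    and yz: "y \<in> Y" "z \<in> Y"
    and ext: "\<forall>L. subgroup L G \<longrightarrow>
      {s', t', r', y, z, c} \<union> {w \<in> Y. \<forall>g\<in>{s', t', r', y, z}. comm g w = \<one>} \<subseteq> L \<longrightarrow> Y \<subseteq> L"
    by (elim exE conjE) (rule that)
  define S where "S = {s', t', r', y, z}"
  define H where "H = generate G S"
  define U where "U = {w \<in> Y. \<forall>g\<in>S. comm g w = \<one>}"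
  have Sc: "S \<subseteq> carrier G"
    using X yz Yc s t r unfolding S_def by auto
  have H: "subgroup H G" unfolding H_def by (rule generate_is_subgroup[OF Sc])
  note Hc = subgroup.mem_carrier[OF H]
  have SH: "S \<subseteq> H" unfolding H_def by (auto intro: generate.incl)
  have U: "subgroup U G"
  proof -
    have "comm w g = \<one> \<longleftrightarrow> comm g w = \<one>" if "w \<in> Y" "g \<in> S" for w g
      using sym[of w g] that Sc Yc by blast
    then have "U = Y \<inter> {w \<in> carrier G. \<forall>g\<in>S. comm w g \<in> {\<one>}}"
      unfolding U_def using Yc by auto
    then show ?thesis
      using subgroups_Inter_pair[OF Y centralizer_mod_subgroup[OF one_is_normal Sc]] by simp
  qed
  have UY: "U \<subseteq> Y" by (auto simp: U_def)
  then have Uc: "u \<in> carrier G" if "u \<in> U" for u using that Yc by blast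
  have "H \<subseteq> {h \<in> carrier G. \<forall>u\<in>U. comm h u \<in> {\<one>}}"
    unfolding H_def
    by (rule generate_subgroup_incl[OF _ centralizer_mod_subgroup[OF one_is_normal]])
      (use Sc Uc in \<open>auto simp: U_def\<close>)
  then have HU: "comm h u = \<one>" if "h \<in> H" "u \<in> U" for h u using that by blast
  have HU': "h \<otimes> u = u \<otimes> h" if "h \<in> H" "u \<in> U" for h u
    using HU[OF that] Hc[OF that(1)] Uc[OF that(2)] comm_eq_one_iff by blast
  have gU: "\<gamma> 5 \<subseteq> U"
  proof
    fix w assume w: "w \<in> \<gamma> 5"
    then have "comm g w = \<one>" if "g \<in> S" for g
      using lower_central_5_central[OF w, of g] sym lower_central_carrier[OF w] Sc that by blast
    then show "w \<in> U" using w gY unfolding U_def by blast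
  qed
  \<comment> \<open>Every subgroup between \<open>\<gamma> 5\<close> and \<open>Y\<close> is normal,
    because \<open>[G, Y]\<close> lies in \<open>\<gamma> 5\<close>.\<close>
  have Un: "U \<lhd> G"
    unfolding normal_inv_iff
  proof (intro conjI ballI U)
    fix x u assume x: "x \<in> carrier G" and u: "u \<in> U"
    have "comm x u \<in> U" using Y5(2)[OF x] u UY gU by blast
    then show "x \<otimes> u \<otimes> inv x \<in> U"
      using conj_eq_comm[OF x Uc[OF u]] subgroup.m_closed[OF U _ u] by simp
  qed
  let ?P = "U <#> H"
  have P: "subgroup ?P G" by (rule mult_norm_subgroup[OF Un H])
  have L: "subgroup (\<gamma> 2 <#> ?P) G" by (rule mult_norm_subgroup[OF lower_central_normal P])
  have sub: "\<gamma> 2 \<subseteq> \<gamma> 2 <#> ?P" "U \<subseteq> \<gamma> 2 <#> ?P" "H \<subseteq> \<gamma> 2 <#> ?P"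
    using set_mult_subsets[OF lower_central_subgroup[of 2] P] set_mult_subsets[OF U H] by blast+
  have YL: "Y \<subseteq> \<gamma> 2 <#> ?P"
    by (rule ext[rule_format, OF L]) (use sub SH c2 in \<open>auto simp: S_def U_def\<close>)
  have cancel: "x \<in> \<gamma> 2 <#> ?P" if ex: "\<exists>w\<in>Y. x' = x \<otimes> w" and xS: "x' \<in> S" and xc: "x \<in> carrier G" for x x'
  proof -
    obtain w where w: "w \<in> Y" "x' = x \<otimes> w" using ex by blast
    have "x' \<otimes> inv w \<in> \<gamma> 2 <#> ?P"
      using xS SH sub YL w(1) subgroup.m_inv_closed[OF L] by (intro subgroup.m_closed[OF L]) blast+
    then show ?thesis using w xc Yc by (simp add: m_assoc)
  qed
  have "\<gamma> 2 <#> ?P = carrier G"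
    by (rule gen[rule_format, OF L])
      (use cancel[OF X(1)] cancel[OF X(2)] cancel[OF X(3)] s t r sub YL in \<open>auto simp: S_def\<close>)
  \<comment> \<open>Here 4 + 2 = 6 is the index at which the series is trivial, so the factor
    \<open>\<gamma> 2\<close> disappears.\<close>
  from lower_central_supplement[OF P this, of 4] have "\<gamma> 6 <#> ?P = carrier G" by simp
  then have "{\<one>} <#> ?P = carrier G" by (simp only: lower_central_6)
  moreover have "{\<one>} <#> ?P = ?P"
    using subgroup.subset[OF P] by (auto simp: set_mult_def subset_iff)
  ultimately have G: "carrier G = H <#> U" using commut_normal[OF H Un] by simp
  have Hn: "H \<lhd> G"
    unfolding normal_inv_iff
  proof (intro conjI ballI H)
    fix x k assume x: "x \<in> carrier G" and k: "k \<in> H"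
    obtain h u where hu: "h \<in> H" "u \<in> U" "x = h \<otimes> u"
      using x G unfolding set_mult_def by blast
    have "x \<otimes> k \<otimes> inv x = h \<otimes> (u \<otimes> k) \<otimes> inv u \<otimes> inv h"
      using hu Hc Uc k by (simp add: inv_mult_group m_assoc)
    also have "\<dots> = h \<otimes> k \<otimes> inv h"
      using hu Hc Uc k by (simp add: HU'[OF k hu(2), symmetric] m_assoc)
    also have "\<dots> \<in> H"
      using hu k by (intro subgroup.m_closed[OF H] subgroup.m_inv_closed[OF H])
    finally show "x \<otimes> k \<otimes> inv x \<in> H" .
  qed
  have U5: "comm u v \<in> \<gamma> 5" if "u \<in> U" "v \<in> U" for u v
    using Y5(1) that UY Uc by blast
  have "derived G U \<subseteq> \<gamma> 5" by (rule derived_subset[OF lower_central_subgroup U5])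
  moreover have "\<forall>i\<ge>2. lower_central (G\<lparr>carrier := H\<rparr>) i = \<gamma> i"
    using lower_central_central_factor[OF H U G HU U5 lower_central_6] by blast
  moreover have "finite S" "card S \<le> 5"
    using card_length[of "[s', t', r', y, z]"] by (auto simp: S_def)
  ultimately show ?thesis
    using H U G Hn Un SH HU' H_def by blast
qed

end

theorem theorem1p2:
  fixes G :: "('a, 'b) monoid_scheme" and p n :: nat
  assumes "Factorial_Ring.prime p" and "p \<ge> 3"
    and "group G" and "order G = p ^ n"
    and "order (G\<lparr>carrier := derived G (carrier G)\<rparr> Mod derived G (derived G (carrier G))) = p ^ 3"
    and "derived G (derived G (carrier G)) \<noteq> {\<one>\<^bsub>G\<^esub>}"
  shows "\<exists>H U. subgroup H G \<and> subgroup U G \<and> carrier G = H <#>\<^bsub>G\<^esub> U \<and>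
     (H \<lhd> G \<and> (\<exists>S. S \<subseteq> H \<and> finite S \<and> card S \<le> 5 \<and> generate G S = H)) \<and>
     (\<forall>i\<ge>2. lower_central (G\<lparr>carrier := H\<rparr>) i = lower_central G i) \<and>
     (U \<lhd> G \<and> derived G U \<subseteq> lower_central G 5) \<and>
     (\<forall>h\<in>H. \<forall>u\<in>U. h \<otimes>\<^bsub>G\<^esub> u = u \<otimes>\<^bsub>G\<^esub> h)"
proof -
  interpret finite_p_group G p n
    using assms by (simp add: finite_p_group_def finite_p_group_axioms_def)
  let ?D = "derived G (carrier G)"
  have D: "subgroup ?D G" by (rule derived_is_subgroup) simp
  interpret D: group "G\<lparr>carrier := ?D\<rparr>" by (rule subgroup.subgroup_is_group[OF D group_axioms])
  have DD: "subgroup (derived G ?D) (G\<lparr>carrier := ?D\<rparr>)"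
    using D.derived_is_subgroup[of ?D] derived_consistent[OF order_refl D] by simp
  have "card ?D = p ^ 3 * card (derived G ?D)"
    using D.lagrange[OF DD] assms(5) by (simp add: order_def FactGroup_def)
  then interpret small_second_derived G p n
    using assms by unfold_locales (simp_all add: lower_central_2)
  obtain e2 a where e2: "layer_char 2 e2 a"
    using layer_char_exists[of 2] layer_orders(1) by auto
  obtain e3 b where e3: "layer_char 3 e3 b"
    using layer_char_exists[of 3] layer_orders(2) by auto
  obtain e4 c where e4: "layer_char 4 e4 c"
    using layer_char_exists[of 4] layer_orders(3) by auto
  have "\<gamma> 5 \<noteq> {\<one>\<^bsub>G\<^esub>}" using second_derived_nontrivial layer_orders(4) by simp
  then obtain e5 d where e5: "central_char (\<gamma> 5) e5" "d \<in> \<gamma> 5" "e5 d =\<^sub>p 1"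
    using central_char_exists[OF lower_central_normal] by blast
  interpret layer_coordinates G p n e2 e3 e4 e5 a b c d
    using e2 e3 e4 e5 by unfold_locales
  obtain s t where st: "s \<in> carrier G" "t \<in> carrier G" "\<psi> s =\<^sub>p 0" "\<chi> s =\<^sub>p 1" "\<psi> t =\<^sub>p 1" "\<chi> t =\<^sub>p 0"
    using s_t_exist by blast
  interpret layer_generators G p n e2 e3 e4 e5 a b c d s t
    using st by unfold_locales
  show ?thesis by (rule central_decomposition)
qed

end
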